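(* Let $\Omega\subset\mathbb{R}^n$, $n\ge2$, be a nonempty open bounded convex set with inradius $R_\Omega$, and let $\Lambda\ge\Lambda_\infty$. Then $$\lim_{p\to+\infty}\ \inf_{\lambda\ge 1/R_\Omega}\ \inf_{u\in W^{1,p}_1(\Omega)} J^{p,\lambda}_\Lambda(u)=m_\Lambda .$$
   Context: $\mathrm{Lip}_1(\Omega):=\{u\in W^{1,\infty}(\Omega):\ u\ge0 \text{ in }\Omega,\ u=1\text{ on }\partial\Omega\}$ (elements identified with their continuous representatives on $\overline\Omega$). For $\Lambda>0$, $J_\Lambda(u):=\|\nabla u\|_\infty+\Lambda\,|\{x\in\Omega:u(x)>0\}|$ for $u\in\mathrm{Lip}_1(\Omega)$, with $\|\cdot\|_\infty$ the $L^\infty(\Omega)$ norm and $|\cdot|$ Lebesgue measure. Problem $(P)_\Lambda$ is to minimize $J_\Lambda$ over $\mathrm{Lip}_1(\Omega)$; $m_\Lambda:=\min_{\mathrm{Lip}_1(\Omega)}J_\Lambda$, and a solution of $(P)_\Lambda$ is a minimizer. $\Lambda_\infty:=\inf\{\Lambda>0:(P)_\Lambda\text{ admits a non-constant solution}\}$. For $p>1$ and $\lambda>0$, $W^{1,p}_1(\Omega):=1+W^{1,p}_0(\Omega)$ and $$J^{p,\lambda}_\Lambda(u):=\frac1p\int_\Omega\Big(\frac{|\nabla u|}{\lambda}\Big)^p\,dx+\lambda+\frac{p-1}{p}\,\Lambda\,|\{x\in\Omega:u(x)>0\}|,\qquad u\in W^{1,p}_1(\Omega).$$ *)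

theory Defs
  imports "HOL-Analysis.Analysis" "HOL-Probability.Essential_Supremum"
begin

section \<open>Sobolev spaces\<close>

text \<open>Functions are total; for an element of a function space on \<open>\<Omega>\<close> only the values on \<open>\<Omega>\<close>
  (or on its closure, for continuous representatives) matter.\<close>

fun C_k :: "nat \<Rightarrow> ('a::euclidean_space \<Rightarrow> real) \<Rightarrow> bool" where
  "C_k 0 f \<longleftrightarrow> continuous_on UNIV f"
| "C_k (Suc k) f \<longleftrightarrow> f differentiable_on UNIV \<and>
     (\<forall>b\<in>Basis. C_k k (\<lambda>x. frechet_derivative f (at x) b))"

definition test_function :: "'a::euclidean_space set \<Rightarrow> ('a \<Rightarrow> real) \<Rightarrow> bool" where
  "test_function \<Omega> \<phi> \<longleftrightarrow> (\<forall>k. C_k k \<phi>) \<and>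
     compact (closure {x. \<phi> x \<noteq> 0}) \<and> closure {x. \<phi> x \<noteq> 0} \<subseteq> \<Omega>"

definition locally_integrable ::
  "'a::euclidean_space set \<Rightarrow> ('a \<Rightarrow> 'b::euclidean_space) \<Rightarrow> bool" where
  "locally_integrable \<Omega> u \<longleftrightarrow> (\<forall>K. compact K \<and> K \<subseteq> \<Omega> \<longrightarrow> u absolutely_integrable_on K)"

definition has_weak_gradient ::
  "'a::euclidean_space set \<Rightarrow> ('a \<Rightarrow> real) \<Rightarrow> ('a \<Rightarrow> 'a) \<Rightarrow> bool" where
  "has_weak_gradient \<Omega> u G \<longleftrightarrow> locally_integrable \<Omega> u \<and> locally_integrable \<Omega> G \<and>
     (\<forall>\<phi>. test_function \<Omega> \<phi> \<longrightarrow> (\<forall>b\<in>Basis.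
        (LINT x|lebesgue_on \<Omega>. u x * frechet_derivative \<phi> (at x) b) =
        - (LINT x|lebesgue_on \<Omega>. (G x \<bullet> b) * \<phi> x)))"

text \<open>Weak gradients are unique up to null sets, and only expressions invariant under changes on
  null sets are formed from the representative chosen here.\<close>

definition weak_gradient :: "'a::euclidean_space set \<Rightarrow> ('a \<Rightarrow> real) \<Rightarrow> 'a \<Rightarrow> 'a" where
  "weak_gradient \<Omega> u = (SOME G. has_weak_gradient \<Omega> u G)"

definition Lp :: "'a::euclidean_space set \<Rightarrow> real \<Rightarrow> ('a \<Rightarrow> 'b::euclidean_space) set" where
  "Lp \<Omega> p = {f \<in> borel_measurable (lebesgue_on \<Omega>).
     integrable (lebesgue_on \<Omega>) (\<lambda>x. norm (f x) powr p)}"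

definition Linf :: "'a::euclidean_space set \<Rightarrow> ('a \<Rightarrow> 'b::euclidean_space) set" where
  "Linf \<Omega> = {f \<in> borel_measurable (lebesgue_on \<Omega>).
     esssup (lebesgue_on \<Omega>) (\<lambda>x. ereal (norm (f x))) < \<infinity>}"

definition Linf_norm :: "'a::euclidean_space set \<Rightarrow> ('a \<Rightarrow> 'b::euclidean_space) \<Rightarrow> real" where
  "Linf_norm \<Omega> f = real_of_ereal (esssup (lebesgue_on \<Omega>) (\<lambda>x. ereal (norm (f x))))"

definition W1p :: "'a::euclidean_space set \<Rightarrow> real \<Rightarrow> ('a \<Rightarrow> real) set" where
  "W1p \<Omega> p = {u \<in> Lp \<Omega> p. \<exists>G \<in> Lp \<Omega> p. has_weak_gradient \<Omega> u G}"

definition W1inf :: "'a::euclidean_space set \<Rightarrow> ('a \<Rightarrow> real) set" where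
  "W1inf \<Omega> = {u \<in> Linf \<Omega>. \<exists>G \<in> Linf \<Omega>. has_weak_gradient \<Omega> u G}"

definition W1p_norm :: "'a::euclidean_space set \<Rightarrow> real \<Rightarrow> ('a \<Rightarrow> real) \<Rightarrow> real" where
  "W1p_norm \<Omega> p u =
     ((LINT x|lebesgue_on \<Omega>. \<bar>u x\<bar> powr p) +
      (LINT x|lebesgue_on \<Omega>. norm (weak_gradient \<Omega> u x) powr p)) powr (1 / p)"

text \<open>\<open>W\<^sub>0\<^sup>1\<^sup>,\<^sup>p\<close> is the closure of the test functions in the \<open>W\<^sup>1\<^sup>,\<^sup>p\<close> norm.\<close>

definition W1p_0 :: "'a::euclidean_space set \<Rightarrow> real \<Rightarrow> ('a \<Rightarrow> real) set" where
  "W1p_0 \<Omega> p = {u \<in> W1p \<Omega> p. \<exists>\<phi>. (\<forall>k. test_function \<Omega> (\<phi> k)) \<and>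
     (\<lambda>k::nat. W1p_norm \<Omega> p (\<lambda>x. u x - \<phi> k x)) \<longlonglongrightarrow> 0}"

definition W1p_1 :: "'a::euclidean_space set \<Rightarrow> real \<Rightarrow> ('a \<Rightarrow> real) set" where
  "W1p_1 \<Omega> p = {(\<lambda>x. 1 + v x) | v. v \<in> W1p_0 \<Omega> p}"


section \<open>The limit problem\<close>

definition inradius :: "'a::euclidean_space set \<Rightarrow> real" where
  "inradius \<Omega> = Sup {r. 0 < r \<and> (\<exists>x. ball x r \<subseteq> \<Omega>)}"

definition Lip1 :: "'a::euclidean_space set \<Rightarrow> ('a \<Rightarrow> real) set" where
  "Lip1 \<Omega> = {u \<in> W1inf \<Omega>. continuous_on (closure \<Omega>) u \<and>
     (\<forall>x\<in>\<Omega>. 0 \<le> u x) \<and> (\<forall>x\<in>frontier \<Omega>. u x = 1)}"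

definition J :: "'a::euclidean_space set \<Rightarrow> real \<Rightarrow> ('a \<Rightarrow> real) \<Rightarrow> real" where
  "J \<Omega> \<Lambda> u = Linf_norm \<Omega> (weak_gradient \<Omega> u) + \<Lambda> * measure lebesgue {x \<in> \<Omega>. 0 < u x}"

definition is_solution :: "'a::euclidean_space set \<Rightarrow> real \<Rightarrow> ('a \<Rightarrow> real) \<Rightarrow> bool" where
  "is_solution \<Omega> \<Lambda> u \<longleftrightarrow> u \<in> Lip1 \<Omega> \<and> (\<forall>v\<in>Lip1 \<Omega>. J \<Omega> \<Lambda> u \<le> J \<Omega> \<Lambda> v)"

text \<open>A genuine minimum: the value is determined only if the minimum is attained.\<close>

definition min_value :: "'a::euclidean_space set \<Rightarrow> real \<Rightarrow> real" where
  "min_value \<Omega> \<Lambda> = (LEAST m. m \<in> J \<Omega> \<Lambda> ` Lip1 \<Omega>)"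

definition Lambda_inf :: "'a::euclidean_space set \<Rightarrow> real" where
  "Lambda_inf \<Omega> = Inf {\<Lambda>. 0 < \<Lambda> \<and> (\<exists>u. is_solution \<Omega> \<Lambda> u \<and> \<not> u constant_on \<Omega>)}"


section \<open>The approximating functionals\<close>

definition Jp :: "'a::euclidean_space set \<Rightarrow> real \<Rightarrow> real \<Rightarrow> real \<Rightarrow> ('a \<Rightarrow> real) \<Rightarrow> real" where
  "Jp \<Omega> \<Lambda> p l u =
     1 / p * (LINT x|lebesgue_on \<Omega>. (norm (weak_gradient \<Omega> u x) / l) powr p) + l +
     (p - 1) / p * \<Lambda> * measure lebesgue {x \<in> \<Omega>. 0 < u x}"

end

theory Submission
  imports Defs
begin

text \<open>Put \<open>d(x) = inf\<^sub>e (h(e) - x \<bullet> e)\<close>, the infimum over unit vectors of the slacks of the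
  supporting half-spaces; on \<open>\<Omega>\<close> it is the distance to the boundary. For \<open>u\<close> in \<open>Lip1\<close> with
  gradient bound \<open>L\<close> the set where \<open>u > 0\<close> contains the collar \<open>{d < 1/L}\<close>, with equality for the
  convex function \<open>max(0, 1 - L d)\<close>. Hence for \<open>\<Lambda> \<ge> \<Lambda>\<^sub>\<infinity>\<close> the minimum is
  \<open>M = min {l + \<Lambda> |{d < 1/l}| : l \<ge> 1/R}\<close>.

  Upper bound: a soft minimum of finitely many slacks is smooth with gradient at most 1 and close to
  \<open>d\<close>, so it yields \<open>1 - \<phi>\<close> with \<open>\<phi>\<close> a test function, \<open>|\<nabla>\<phi>| \<le> l\<close> and positivity set almost the
  collar; its gradient term is at most \<open>|\<Omega>|/p\<close>.

  Lower bound: if \<open>J\<^sup>p(u) < M\<close> then \<open>\<integral> |\<nabla>u|\<^sup>p \<le> p M l\<^sup>p\<close>. On a slab of thickness \<open>s = \<theta>/l\<close> cut off by a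
  supporting half-space, \<open>1 - u\<close> vanishes beyond the half-space, so \<open>\<integral> |1 - u|\<^sup>p \<le> s\<^sup>p \<integral> |\<nabla>u|\<^sup>p \<le> p M \<theta>\<^sup>p\<close>,
  and by Markov's inequality \<open>u > 0\<close> on the slab up to an exponentially small set. Finitely many
  slabs, uniformly in \<open>l\<close>, cover a slightly thinner collar.\<close>

section \<open>Smooth functions\<close>

text \<open>The constant function 1 competes with every cone: its limit energy is \<Lambda>
  |\<Omega>|, whereas in the approximating problems the term \<lambda> \<ge> 1 / R makes it
  costlier. \<open>Lambda_inf \<Omega> \<le> \<Lambda>\<close> is used to show that its limit energy
  is not below that of the best cone. The delicate constant is the one in the slab inequality. A
  factor C^p with C > 1 would turn the error p \<theta>^p into p (C \<theta>)^p, which does not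
  vanish for \<theta> near 1. The sharp s^p therefore has to survive both the discretisation and the
  density argument. Of the two factors \<theta> lost in the lower bound, one makes \<theta>^p decay
  and the other pays for replacing all directions by a finite net. The function d is concave on the
  whole space, so the cones are globally convex. Monotone difference quotients then yield their weak
  gradients, in place of an almost everywhere differentiability theorem. Of the collar measure only
  monotonicity, left continuity and its range are used: both bounds perturb l rather than the collar
  width.\<close>

lemma C_k_SucI:
  assumes "\<And>x. (f has_derivative f' x) (at x)"
    and "\<And>b. b \<in> Basis \<Longrightarrow> C_k k (\<lambda>x. f' x b)"
  shows "C_k (Suc k) f"
proof -
  have "frechet_derivative f (at x) = f' x" for x
    using frechet_derivative_at[OF assms(1)] by simp
  then show ?thesis
    using assms by (auto simp: differentiable_on_def differentiable_def)
qed

lemma C_k_Suc_has_derivative: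
  assumes "C_k (Suc k) f"
  shows "(f has_derivative frechet_derivative f (at x)) (at x)"
  using assms by (auto simp: differentiable_on_def frechet_derivative_works[symmetric])

lemma C_k_Suc_imp: "C_k (Suc k) f \<Longrightarrow> C_k k f"
proof (induction k arbitrary: f)
  case 0
  then show ?case by (auto intro: differentiable_imp_continuous_on)
next
  case (Suc k)
  then show ?case by (metis C_k.simps(2))
qed

lemma C_k_const [intro]: "C_k k (\<lambda>x. c)"
proof (induction k arbitrary: c)
  case (Suc k)
  show ?case by (rule C_k_SucI[where f' = "\<lambda>x v. 0"]) (use Suc in auto)
qed auto

lemma C_k_add:
  "C_k k f \<Longrightarrow> C_k k g \<Longrightarrow> C_k k (\<lambda>x. f x + g x)"
proof (induction k arbitrary: f g)
  case 0
  then show ?case by (auto intro: continuous_on_add)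
next
  case (Suc k)
  show ?case
  proof (rule C_k_SucI)
    show "((\<lambda>x. f x + g x) has_derivative
        (\<lambda>v. frechet_derivative f (at x) v + frechet_derivative g (at x) v)) (at x)" for x
      using Suc.prems by (intro has_derivative_add C_k_Suc_has_derivative)
  next
    fix b :: 'a assume "b \<in> Basis"
    then show "C_k k (\<lambda>x. frechet_derivative f (at x) b + frechet_derivative g (at x) b)"
      using Suc.prems by (intro Suc.IH) auto
  qed
qed

lemma C_k_mult:
  "C_k k f \<Longrightarrow> C_k k g \<Longrightarrow> C_k k (\<lambda>x. f x * g x)"
proof (induction k arbitrary: f g)
  case 0
  then show ?case by (auto intro: continuous_on_mult)
next
  case (Suc k)
  show ?case
  proof (rule C_k_SucI)
    show "((\<lambda>x. f x * g x) has_derivative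
        (\<lambda>v. f x * frechet_derivative g (at x) v + frechet_derivative f (at x) v * g x)) (at x)" for x
      using Suc.prems by (intro has_derivative_mult C_k_Suc_has_derivative)
  next
    fix b :: 'a assume "b \<in> Basis"
    then show "C_k k (\<lambda>x. f x * frechet_derivative g (at x) b + frechet_derivative f (at x) b * g x)"
      using Suc.prems C_k_Suc_imp[of k f] C_k_Suc_imp[of k g]
      by (intro C_k_add Suc.IH) auto
  qed
qed

lemma C_k_sum:
  "(\<And>i. i \<in> A \<Longrightarrow> C_k k (f i)) \<Longrightarrow> C_k k (\<lambda>x. \<Sum>i\<in>A. f i x)"
proof (induction A rule: infinite_finite_induct)
  case (insert i A)
  then have "C_k k (\<lambda>x. f i x + (\<Sum>i\<in>A. f i x))" by (intro C_k_add) blast+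
  then show ?case using insert.hyps by simp
qed (simp_all add: C_k_const)

lemma C_k_prod:
  "(\<And>i. i \<in> A \<Longrightarrow> C_k k (f i)) \<Longrightarrow> C_k k (\<lambda>x. \<Prod>i\<in>A. f i x)"
proof (induction A rule: infinite_finite_induct)
  case (insert i A)
  then have "C_k k (\<lambda>x. f i x * (\<Prod>i\<in>A. f i x))" by (intro C_k_mult) blast+
  then show ?case using insert.hyps by simp
qed (simp_all add: C_k_const)

lemma C_k_uminus: "C_k k f \<Longrightarrow> C_k k (\<lambda>x. - f x)"
  using C_k_mult[OF C_k_const[of k "-1"], of f] by simp

lemma C_k_inner: "C_k k (\<lambda>x. x \<bullet> a)"
proof (cases k)
  case (Suc n)
  have "C_k (Suc n) (\<lambda>x. x \<bullet> a)"
    by (rule C_k_SucI[where f' = "\<lambda>x v. v \<bullet> a"]) (auto intro!: derivative_eq_intros)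
  then show ?thesis using Suc by simp
qed (auto intro!: continuous_intros)

lemma C_k_real_SucI:
  assumes "\<And>t::real. (f has_real_derivative f' t) (at t)" and "C_k k f'"
  shows "C_k (Suc k) f"
  using assms by (intro C_k_SucI[where f' = "\<lambda>t v. f' t * v"]) (auto simp: has_field_derivative_def)

lemma C_k_compose_real:
  fixes \<psi> :: "real \<Rightarrow> real"
  shows "C_k k \<psi> \<Longrightarrow> C_k k f \<Longrightarrow> C_k k (\<lambda>x. \<psi> (f x))"
proof (induction k arbitrary: \<psi> f)
  case 0
  then show ?case by (simp, intro continuous_on_compose2[of UNIV \<psi> UNIV f]) auto
next
  case (Suc k)
  show ?case
  proof (rule C_k_SucI)
    fix x
    have "((\<lambda>x. \<psi> (f x)) has_derivative
        (\<lambda>v. frechet_derivative \<psi> (at (f x)) (frechet_derivative f (at x) v))) (at x)"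
      using has_derivative_compose[OF C_k_Suc_has_derivative[OF Suc.prems(2)]
          C_k_Suc_has_derivative[OF Suc.prems(1)]] .
    \<comment> \<open>A linear map on the reals is multiplication by its value at 1. This turns the
      chain rule into a product of a partial of \<open>f\<close> and a composition with the
      derivative of \<open>\<psi>\<close>, to which the induction hypothesis applies.\<close>
    also have "(\<lambda>v. frechet_derivative \<psi> (at (f x)) (frechet_derivative f (at x) v)) =
        (\<lambda>v. frechet_derivative f (at x) v * frechet_derivative \<psi> (at (f x)) 1)"
    proof
      fix v
      have "linear (frechet_derivative \<psi> (at (f x)))"
        using C_k_Suc_has_derivative[OF Suc.prems(1)] has_derivative_linear by blast
      from linear_cmul[OF this, of "frechet_derivative f (at x) v" 1]
      show "frechet_derivative \<psi> (at (f x)) (frechet_derivative f (at x) v) =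
          frechet_derivative f (at x) v * frechet_derivative \<psi> (at (f x)) 1" by simp
    qed
    finally show "((\<lambda>x. \<psi> (f x)) has_derivative
        (\<lambda>v. frechet_derivative f (at x) v * frechet_derivative \<psi> (at (f x)) 1)) (at x)" .
  next
    fix b :: 'a assume "b \<in> Basis"
    then show "C_k k (\<lambda>x. frechet_derivative f (at x) b * frechet_derivative \<psi> (at (f x)) 1)"
      using Suc.prems C_k_Suc_imp[of k f]
      by (intro C_k_mult Suc.IH[where \<psi> = "\<lambda>t. frechet_derivative \<psi> (at t) 1"]) auto
  qed
qed

lemma C_k_exp: "C_k k (exp :: real \<Rightarrow> real)"
proof (induction k)
  case (Suc k)
  show ?case by (rule C_k_real_SucI[OF DERIV_exp Suc])
qed (auto intro: continuous_intros)

lemma C_k_inverse: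
  assumes "\<And>x. f x \<noteq> 0"
  shows "C_k k f \<Longrightarrow> C_k k (\<lambda>x. inverse (f x))"
proof (induction k)
  case 0
  then show ?case using assms by (auto intro: continuous_on_inverse)
next
  case (Suc k)
  show ?case
  proof (rule C_k_SucI)
    show "((\<lambda>x. inverse (f x)) has_derivative
       (\<lambda>v. - (inverse (f x) * frechet_derivative f (at x) v * inverse (f x)))) (at x)" for x
      using Suc.prems assms by (intro Deriv.has_derivative_inverse C_k_Suc_has_derivative)
  next
    fix b :: 'a assume "b \<in> Basis"
    then show "C_k k (\<lambda>x. - (inverse (f x) * frechet_derivative f (at x) b * inverse (f x)))"
      using Suc C_k_Suc_imp[of k f] by (intro C_k_uminus C_k_mult) auto
  qed
qed

lemma C_k_ln:
  assumes "\<And>x. f x > (0::real)" and f: "C_k k f"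
  shows "C_k k (\<lambda>x. ln (f x))"
proof (cases k)
  case 0
  then show ?thesis using f assms(1) by (simp, intro continuous_on_ln) (auto simp: less_imp_neq[symmetric])
next
  case (Suc n)
  have "C_k (Suc n) (\<lambda>x. ln (f x))"
  proof (rule C_k_SucI)
    show "((\<lambda>x. ln (f x)) has_derivative
       (\<lambda>v. frechet_derivative f (at x) v * inverse (f x))) (at x)" for x
    proof -
      have "(ln has_derivative (\<lambda>t. t * inverse (f x))) (at (f x))"
        using DERIV_ln[OF assms(1), of x] by (simp add: has_field_derivative_def mult.commute[of _ "inverse _"])
      with C_k_Suc_has_derivative[OF f[unfolded Suc]] show ?thesis
        by (rule has_derivative_compose)
    qed
  next
    fix b :: 'a assume "b \<in> Basis"
    then show "C_k n (\<lambda>x. frechet_derivative f (at x) b * inverse (f x))"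
      using f Suc C_k_Suc_imp[of n f] assms(1)
      by (intro C_k_mult C_k_inverse) (auto simp: less_imp_neq[symmetric])
  qed
  then show ?thesis using Suc by simp
qed

lemma C_k_translate: "C_k k f \<Longrightarrow> C_k k (\<lambda>x. f (x + a))"
proof (induction k arbitrary: f)
  case 0
  then show ?case by (simp, intro continuous_on_compose2[of UNIV f UNIV "\<lambda>x. x + a"]) (auto intro: continuous_intros)
next
  case (Suc k)
  show ?case
  proof (rule C_k_SucI)
    show "((\<lambda>x. f (x + a)) has_derivative frechet_derivative f (at (x + a))) (at x)" for x
    proof -
      have "((\<lambda>x. x + a) has_derivative (\<lambda>v. v)) (at x)"
        by (auto intro!: derivative_eq_intros)
      from has_derivative_compose[OF this C_k_Suc_has_derivative[OF Suc.prems]]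
      show ?thesis .
    qed
  next
    fix b :: 'a assume "b \<in> Basis"
    then have "C_k k (\<lambda>x. frechet_derivative f (at x) b)" using Suc.prems by simp
    then show "C_k k (\<lambda>x. frechet_derivative f (at (x + a)) b)" by (rule Suc.IH)
  qed
qed

text \<open>The index \<open>m\<close> makes the family closed under differentiation.\<close>

definition flat :: "nat \<Rightarrow> real \<Rightarrow> real" where
  "flat m t = (if t > 0 then (1 / t) ^ m * exp (- 1 / t) else 0)"

text \<open>On the right, the substitution of 1/t for t reduces the limit to the decay of a power
  against the exponential.\<close>

lemma flat_at_0: "(flat m \<longlongrightarrow> 0) (at 0)"
proof -
  have "((\<lambda>t. inverse t ^ m / exp (inverse t)) \<longlongrightarrow> (0::real)) (at_right 0)"
    using filterlim_compose[OF tendsto_power_div_exp_0 filterlim_inverse_at_top_right] .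
  then have "(flat m \<longlongrightarrow> 0) (at_right 0)"
    by (rule Lim_transform_eventually)
      (auto simp: eventually_at_filter flat_def inverse_eq_divide exp_minus divide_simps power_one_over)
  moreover have "(flat m \<longlongrightarrow> 0) (at_left 0)"
    by (rule Lim_transform_eventually[OF tendsto_const]) (auto simp: eventually_at_filter flat_def)
  ultimately show ?thesis by (simp add: filterlim_split_at)
qed

lemma DERIV_flat: "(flat m has_real_derivative (flat (m + 2) t - m * flat (m + 1) t)) (at t)"
proof -
  consider "t > 0" | "t = 0" | "t < 0" by linarith
  then show ?thesis
  proof cases
    case 1
    have "((\<lambda>t. (1 / t) ^ m * exp (- 1 / t)) has_real_derivative (flat (m + 2) t - m * flat (m + 1) t)) (at t)"
    proof -
      have "((\<lambda>t. 1 / t) has_real_derivative - (1 / t) * (1 / t)) (at t)"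
        using 1 by (auto intro!: derivative_eq_intros)
      from DERIV_power[OF this, of m]
      have "((\<lambda>t. (1 / t) ^ m) has_real_derivative - (m * (1 / t) ^ (m + 1))) (at t)"
        by (cases m) (auto simp: algebra_simps)
      moreover have "((\<lambda>t. exp (- 1 / t)) has_real_derivative exp (- 1 / t) * ((1 / t) * (1 / t))) (at t)"
        using 1 by (auto intro!: derivative_eq_intros)
      ultimately have "((\<lambda>t. (1 / t) ^ m * exp (- 1 / t)) has_real_derivative
          - (m * (1 / t) ^ (m + 1)) * exp (- 1 / t) + exp (- 1 / t) * ((1 / t) * (1 / t)) * (1 / t) ^ m) (at t)"
        by (rule DERIV_mult)
      also have "- (m * (1 / t) ^ (m + 1)) * exp (- 1 / t) + exp (- 1 / t) * ((1 / t) * (1 / t)) * (1 / t) ^ m =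
          flat (m + 2) t - m * flat (m + 1) t"
        using 1 by (simp add: flat_def algebra_simps)
      finally show ?thesis .
    qed
    then show ?thesis
      by (rule has_field_derivative_transform_within_open[where S = "{0<..}"]) (use 1 in \<open>auto simp: flat_def\<close>)
  next
    case 2
    \<comment> \<open>Off the origin, the difference quotient of \<open>flat m\<close> at 0 is
      \<open>flat (m + 1)\<close> itself.\<close>
    have "((\<lambda>y. flat (m + 1) y) \<longlongrightarrow> 0) (at 0)" by (rule flat_at_0)
    then have "((\<lambda>y. (flat m y - flat m 0) / (y - 0)) \<longlongrightarrow> 0) (at 0)"
      by (rule Lim_transform_eventually) (auto simp: flat_def eventually_at_filter)
    then show ?thesis using 2 by (simp add: has_field_derivative_iff flat_def)
  next
    case 3
    have "((\<lambda>t. 0) has_real_derivative (flat (m + 2) t - m * flat (m + 1) t)) (at t)"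
      using 3 by (simp add: flat_def)
    then show ?thesis
      by (rule has_field_derivative_transform_within_open[where S = "{..<0}"]) (use 3 in \<open>auto simp: flat_def\<close>)
  qed
qed

lemma C_k_flat: "C_k k (flat m)"
proof (induction k arbitrary: m)
  case 0
  have "isCont (flat m) t" for t by (rule DERIV_isCont[OF DERIV_flat])
  then show ?case by (simp add: continuous_at_imp_continuous_on)
next
  case (Suc k)
  have "C_k k (\<lambda>t. flat (m + 2) t + (- real m) * flat (m + 1) t)"
    by (intro C_k_add C_k_mult C_k_const Suc)
  then show ?case by (intro C_k_real_SucI[OF DERIV_flat]) simp
qed

lemma flat_bounds: "0 \<le> flat 0 t" "flat 0 t \<le> 1"
  by (auto simp: flat_def)

section \<open>Test functions and their derivatives\<close>

abbreviation pd :: "('a::euclidean_space \<Rightarrow> real) \<Rightarrow> 'a \<Rightarrow> 'a \<Rightarrow> real" where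
  "pd \<phi> x e \<equiv> frechet_derivative \<phi> (at x) e"

lemma nonzero_in_closure: "\<phi> x \<noteq> 0 \<Longrightarrow> x \<in> closure {x. \<phi> x \<noteq> 0}"
  using closure_subset by fastforce

lemma test_functionI:
  assumes "\<And>k. C_k k \<phi>" "compact K" "K \<subseteq> \<Omega>" "\<And>x. \<phi> x \<noteq> 0 \<Longrightarrow> x \<in> K"
  shows "test_function \<Omega> \<phi>"
proof -
  have "closure {x. \<phi> x \<noteq> 0} \<subseteq> K"
    using assms by (intro closure_minimal) (auto simp: compact_imp_closed)
  then show ?thesis
    using assms(1,3) compact_Int_closed[OF assms(2), of "closure {x. \<phi> x \<noteq> 0}"]
    unfolding test_function_def by (metis Int_absorb1 closed_closure subset_trans)
qed

lemma test_function_mono: "test_function A \<phi> \<Longrightarrow> A \<subseteq> B \<Longrightarrow> test_function B \<phi>"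
  by (auto simp: test_function_def)

lemma test_function_eq_0: "test_function \<Omega> \<phi> \<Longrightarrow> x \<notin> \<Omega> \<Longrightarrow> \<phi> x = 0"
  using closure_subset[of "{x. \<phi> x \<noteq> 0}"] by (auto simp: test_function_def)

lemma test_function_has_derivative:
  "test_function \<Omega> \<phi> \<Longrightarrow> (\<phi> has_derivative frechet_derivative \<phi> (at x)) (at x)"
  unfolding test_function_def using C_k_Suc_has_derivative by blast

lemma test_function_continuous: "test_function \<Omega> \<phi> \<Longrightarrow> continuous_on A \<phi>"
  using C_k.simps(1) continuous_on_subset unfolding test_function_def by blast

lemma test_function_mult:
  assumes "test_function \<Omega> \<phi>" "\<And>k. C_k k \<psi>"
  shows "test_function \<Omega> (\<lambda>x. \<phi> x * \<psi> x)"
  using assms closure_subset[of "{x. \<phi> x \<noteq> 0}"]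
  by (intro test_functionI[of _ "closure {x. \<phi> x \<noteq> 0}"] C_k_mult) (auto simp: test_function_def)

lemma test_function_add:
  assumes "test_function \<Omega> \<phi>" "test_function \<Omega> \<psi>"
  shows "test_function \<Omega> (\<lambda>x. \<phi> x + \<psi> x)"
  using assms closure_subset[of "{x. \<phi> x \<noteq> 0}"] closure_subset[of "{x. \<psi> x \<noteq> 0}"]
  by (intro test_functionI[of _ "closure {x. \<phi> x \<noteq> 0} \<union> closure {x. \<psi> x \<noteq> 0}"] C_k_add)
    (fastforce simp: test_function_def)+

lemma test_function_0: "test_function \<Omega> (\<lambda>x. 0)"
  by (intro test_functionI[of _ "{}"]) auto

lemma test_function_sum:
  "(\<And>i. i \<in> A \<Longrightarrow> test_function \<Omega> (f i)) \<Longrightarrow> test_function \<Omega> (\<lambda>x. \<Sum>i\<in>A. f i x)"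
proof (induction A rule: infinite_finite_induct)
  case (insert i A)
  then have "test_function \<Omega> (\<lambda>x. f i x + (\<Sum>i\<in>A. f i x))" by (intro test_function_add) blast+
  then show ?case using insert.hyps by simp
qed (simp_all add: test_function_0)

lemma test_function_translate:
  assumes "test_function \<Omega> \<phi>" "(\<lambda>x. x - a) ` closure {x. \<phi> x \<noteq> 0} \<subseteq> \<Omega>'"
  shows "test_function \<Omega>' (\<lambda>x. \<phi> (x + a))"
proof (rule test_functionI)
  show "compact ((\<lambda>x. x - a) ` closure {x. \<phi> x \<noteq> 0})"
    using assms(1) by (intro compact_continuous_image continuous_intros) (auto simp: test_function_def)
  show "x \<in> (\<lambda>x. x - a) ` closure {x. \<phi> x \<noteq> 0}" if "\<phi> (x + a) \<noteq> 0" for x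
    using that by (intro image_eqI[of _ _ "x + a"]) (auto intro: nonzero_in_closure)
qed (use assms in \<open>auto simp: test_function_def intro: C_k_translate\<close>)

lemma frechet_derivative_eq_0:
  assumes "x \<notin> closure {x. \<phi> x \<noteq> 0}"
  shows "frechet_derivative \<phi> (at x) = (\<lambda>_. 0 :: real)"
proof -
  have "(\<phi> has_derivative (\<lambda>_. 0)) (at x)"
    by (rule has_derivative_transform_within_open[where s = "- closure {x. \<phi> x \<noteq> 0}" and f = "\<lambda>_. 0"])
      (use assms nonzero_in_closure[of \<phi>] in auto)
  then show ?thesis by (rule frechet_derivative_at[symmetric])
qed

lemma frechet_derivative_Basis_sum:
  fixes f :: "'a::euclidean_space \<Rightarrow> real"
  assumes "(f has_derivative frechet_derivative f (at x)) (at x)"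
  shows "pd f x e = (\<Sum>b\<in>Basis. (e \<bullet> b) * pd f x b)"
proof -
  have l: "linear (frechet_derivative f (at x))" using assms has_derivative_linear by blast
  have "pd f x e = frechet_derivative f (at x) (\<Sum>b\<in>Basis. (e \<bullet> b) *\<^sub>R b)"
    by (simp add: euclidean_representation)
  then show ?thesis by (simp add: linear_sum[OF l] linear_cmul[OF l])
qed

text \<open>\<open>C_k\<close> speaks of coordinate directions only; an arbitrary direction is
  reached as a linear combination.\<close>

lemma test_function_partial:
  assumes "test_function \<Omega> \<phi>"
  shows "test_function \<Omega> (\<lambda>x. pd \<phi> x e)"
proof -
  have "test_function \<Omega> (\<lambda>x. pd \<phi> x b)" if b: "b \<in> Basis" for b
  proof (rule test_functionI)
    fix k
    have "C_k (Suc k) \<phi>" using assms unfolding test_function_def by blast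
    then show "C_k k (\<lambda>x. pd \<phi> x b)" using b by simp
  next
    fix x assume "pd \<phi> x b \<noteq> 0"
    then show "x \<in> closure {x. \<phi> x \<noteq> 0}" using frechet_derivative_eq_0[of x \<phi>] by metis
  qed (use assms in \<open>auto simp: test_function_def\<close>)
  then have "test_function \<Omega> (\<lambda>x. pd \<phi> x b * (e \<bullet> b))" if "b \<in> Basis" for b
    using that by (intro test_function_mult) auto
  then have "test_function \<Omega> (\<lambda>x. \<Sum>b\<in>Basis. pd \<phi> x b * (e \<bullet> b))"
    by (intro test_function_sum) auto
  then show ?thesis
    by (subst frechet_derivative_Basis_sum[OF test_function_has_derivative[OF assms]])
      (simp add: mult.commute)
qed

lemma test_function_bounded:
  assumes "test_function \<Omega> \<phi>"
  obtains B where "B \<ge> 0" "\<And>x. \<bar>\<phi> x\<bar> \<le> B"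
proof -
  let ?K = "closure {x. \<phi> x \<noteq> 0}"
  have "compact (\<phi> ` ?K)"
    using assms by (intro compact_continuous_image test_function_continuous[OF assms]) (auto simp: test_function_def)
  then obtain B where B: "\<And>x. x \<in> ?K \<Longrightarrow> norm (\<phi> x) \<le> B"
    using compact_imp_bounded bounded_iff by (metis imageI)
  have "\<bar>\<phi> x\<bar> \<le> max B 0" for x
    using B[of x] closure_subset[of "{x. \<phi> x \<noteq> 0}"] by (cases "\<phi> x = 0") (auto simp: le_max_iff_disj)
  then show ?thesis by (intro that[of "max B 0"]) auto
qed

lemma test_function_lipschitz:
  assumes "test_function \<Omega> \<phi>"
  obtains B where "B \<ge> 0" "\<And>x y. \<bar>\<phi> x - \<phi> y\<bar> \<le> B * norm (x - y)"
proof -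
  have "\<exists>c. 0 \<le> c \<and> (\<forall>x. \<bar>pd \<phi> x b\<bar> \<le> c)" for b
    using test_function_bounded[OF test_function_partial[OF assms, of b]] by metis
  then obtain c where c: "\<And>b. 0 \<le> c b \<and> (\<forall>x. \<bar>pd \<phi> x b\<bar> \<le> c b)"
    by metis
  have "onorm (frechet_derivative \<phi> (at x)) \<le> (\<Sum>b\<in>Basis. c b)" for x
  proof (rule onorm_le)
    fix v
    have "norm (pd \<phi> x v) \<le> (\<Sum>b\<in>Basis. norm ((v \<bullet> b) * pd \<phi> x b))"
      unfolding frechet_derivative_Basis_sum[OF test_function_has_derivative[OF assms], of x v] by (rule norm_sum)
    also have "\<dots> \<le> (\<Sum>b\<in>Basis. norm v * c b)"
      using c by (intro sum_mono) (auto simp: abs_mult intro!: mult_mono Basis_le_norm)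
    finally show "norm (pd \<phi> x v) \<le> (\<Sum>b\<in>Basis. c b) * norm v"
      by (simp add: sum_distrib_left mult.commute)
  qed
  then have "norm (\<phi> x - \<phi> y) \<le> (\<Sum>b\<in>Basis. c b) * norm (x - y)" for x y
    by (intro differentiable_bound[OF convex_UNIV, of _ "\<lambda>x. frechet_derivative \<phi> (at x)"])
      (auto intro: test_function_has_derivative[OF assms])
  then show ?thesis using c by (intro that[of "\<Sum>b\<in>Basis. c b"]) (auto intro: sum_nonneg)
qed

lemma has_derivative_difference_quotient:
  fixes f :: "'a::euclidean_space \<Rightarrow> real"
  assumes "(f has_derivative f') (at x)" "h \<longlonglongrightarrow> 0" "\<And>n. h n \<noteq> 0"
  shows "(\<lambda>n. (f (x + h n *\<^sub>R e) - f x) / h n) \<longlonglongrightarrow> f' e"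
proof -
  have "((\<lambda>t. x + t *\<^sub>R e) has_derivative (\<lambda>t. t *\<^sub>R e)) (at 0)"
    by (auto intro!: derivative_eq_intros)
  then have "((\<lambda>t. f (x + t *\<^sub>R e)) has_derivative (\<lambda>t. f' (t *\<^sub>R e))) (at 0)"
    by (rule has_derivative_compose) (use assms in simp)
  moreover have "(\<lambda>t. f' (t *\<^sub>R e)) = (*) (f' e)"
    using linear_cmul[OF has_derivative_linear[OF assms(1)]] by (auto simp: mult.commute)
  ultimately have "((\<lambda>t. f (x + t *\<^sub>R e)) has_real_derivative f' e) (at 0)"
    by (simp add: has_field_derivative_def)
  then have "((\<lambda>t. (f (x + t *\<^sub>R e) - f x) / t) \<longlongrightarrow> f' e) (at 0)"
    by (simp add: has_field_derivative_iff)
  then show ?thesis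
    using assms(2,3) unfolding tendsto_at_iff_sequentially by (auto simp: o_def)
qed

section \<open>Integration against test functions\<close>

lemma lebesgue_on_integral_eq:
  fixes f :: "'a::euclidean_space \<Rightarrow> 'b::euclidean_space"
  assumes "S \<in> sets lebesgue" "\<And>x. x \<notin> S \<Longrightarrow> f x = 0"
  shows "(LINT x|lebesgue_on S. f x) = (LINT x|lebesgue. f x)"
    and "integrable (lebesgue_on S) f \<longleftrightarrow> integrable lebesgue f"
proof -
  have "(\<lambda>x. indicator S x *\<^sub>R f x) = f" using assms(2) by (auto simp: indicator_def)
  then show "(LINT x|lebesgue_on S. f x) = (LINT x|lebesgue. f x)"
    "integrable (lebesgue_on S) f \<longleftrightarrow> integrable lebesgue f"
    using assms(1) by (simp_all add: integral_restrict_space integrable_restrict_space)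
qed

lemma lebesgue_integral_translate:
  fixes f :: "'a::euclidean_space \<Rightarrow> real"
  assumes [measurable]: "f \<in> borel_measurable borel"
  shows "(LINT x|lebesgue. f (x + a)) = (LINT x|lebesgue. f x)"
    and "integrable lebesgue (\<lambda>x. f (x + a)) \<longleftrightarrow> integrable lebesgue f"
proof -
  have "(LINT x|lebesgue. f (x + a)) = (LINT x|lborel. f (a + x))"
    by (subst integral_completion) (auto simp: add.commute)
  also have "\<dots> = (LINT x|distr lborel borel ((+) a). f x)"
    by (subst integral_distr) auto
  finally show "(LINT x|lebesgue. f (x + a)) = (LINT x|lebesgue. f x)"
    by (simp add: lborel_distr_plus integral_completion)
  have "integrable lebesgue (\<lambda>x. f (x + a)) \<longleftrightarrow> integrable lborel (\<lambda>x. f (a + x))"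
    by (subst integrable_completion) (auto simp: add.commute)
  also have "\<dots> \<longleftrightarrow> integrable (distr lborel borel ((+) a)) f"
    by (subst integrable_distr_eq) auto
  finally show "integrable lebesgue (\<lambda>x. f (x + a)) \<longleftrightarrow> integrable lebesgue f"
    by (simp add: lborel_distr_plus integrable_completion)
qed

lemma continuous_lebesgue_measurable:
  fixes f :: "'a::euclidean_space \<Rightarrow> 'b::euclidean_space"
  shows "continuous_on UNIV f \<Longrightarrow> f \<in> borel_measurable lebesgue"
  by (intro measurable_completion) (simp add: borel_measurable_continuous_onI)

lemma locally_integrable_mult_test:
  assumes g: "locally_integrable \<Omega> g" and \<phi>: "test_function \<Omega> \<phi>"
  shows "integrable lebesgue (\<lambda>x. \<phi> x *\<^sub>R g x)"
proof -
  define K where "K = closure {x. \<phi> x \<noteq> 0}"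
  have K: "compact K" "K \<subseteq> \<Omega>" using \<phi> by (auto simp: test_function_def K_def)
  have 1: "integrable lebesgue (\<lambda>x. indicator K x *\<^sub>R g x)"
    using g K by (auto simp: locally_integrable_def set_integrable_def)
  obtain B where B: "B \<ge> 0" "\<And>x. \<bar>\<phi> x\<bar> \<le> B" using test_function_bounded[OF \<phi>] by blast
  have eq: "\<phi> x *\<^sub>R g x = \<phi> x *\<^sub>R (indicator K x *\<^sub>R g x)" for x
    using nonzero_in_closure[of \<phi> x] by (auto simp: K_def indicator_def)
  show ?thesis unfolding eq
  proof (rule Bochner_Integration.integrable_bound[where f = "\<lambda>x. B *\<^sub>R (indicator K x *\<^sub>R g x)"])
    show "(\<lambda>x. \<phi> x *\<^sub>R (indicator K x *\<^sub>R g x)) \<in> borel_measurable lebesgue"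
      using continuous_lebesgue_measurable[OF test_function_continuous[OF \<phi>]] borel_measurable_integrable[OF 1]
      by (rule borel_measurable_scaleR)
    show "AE x in lebesgue. norm (\<phi> x *\<^sub>R (indicator K x *\<^sub>R g x)) \<le> norm (B *\<^sub>R (indicator K x *\<^sub>R g x))"
      using B by (intro AE_I2) (auto simp: abs_mult intro!: mult_right_mono)
    show "integrable lebesgue (\<lambda>x. B *\<^sub>R (indicator K x *\<^sub>R g x))"
      using 1 by (rule integrable_scaleR_right)
  qed
qed

lemma absolutely_integrable_continuous_compact:
  fixes f :: "'a::euclidean_space \<Rightarrow> 'b::euclidean_space"
  assumes "compact K" "continuous_on K f"
  shows "f absolutely_integrable_on K"
proof -
  have "integrable lborel (\<lambda>x. indicator K x *\<^sub>R f x)"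
    using borel_integrable_compact[OF assms] .
  then show ?thesis
    unfolding set_integrable_def by (subst integrable_completion) auto
qed

lemma continuous_imp_locally_integrable:
  fixes f :: "'a::euclidean_space \<Rightarrow> 'b::euclidean_space"
  assumes "continuous_on \<Omega> f"
  shows "locally_integrable \<Omega> f"
  unfolding locally_integrable_def
proof safe
  fix K assume "compact K" "K \<subseteq> \<Omega>"
  then show "f absolutely_integrable_on K"
    using assms continuous_on_subset by (intro absolutely_integrable_continuous_compact) blast+
qed

lemma bounded_imp_locally_integrable:
  fixes f :: "'a::euclidean_space \<Rightarrow> 'b::euclidean_space"
  assumes "f \<in> borel_measurable lebesgue" "\<And>x. norm (f x) \<le> B"
  shows "locally_integrable \<Omega> f"
  unfolding locally_integrable_def
proof safe
  fix K :: "'a set" assume K: "compact K"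
  show "f absolutely_integrable_on K" unfolding set_integrable_def
  proof (rule Bochner_Integration.integrable_bound[where f = "\<lambda>x. B *\<^sub>R indicator K x :: real"])
    show "integrable lebesgue (\<lambda>x. B *\<^sub>R indicator K x :: real)"
      using lmeasurable_compact[OF K] by (intro integrable_scaleR_right integrable_real_indicator) (auto simp: fmeasurable_def)
    show "(\<lambda>x. indicator K x *\<^sub>R f x) \<in> borel_measurable lebesgue"
      using assms(1) lmeasurable_compact[OF K] by (intro borel_measurable_scaleR) auto
    show "AE x in lebesgue. norm (indicator K x *\<^sub>R f x) \<le> norm (B *\<^sub>R indicator K x :: real)"
      using assms(2) by (intro AE_I2) (auto simp: indicator_def intro: order_trans[OF _ abs_ge_self])
  qed
qed

text \<open>Dominated convergence with the Lipschitz constant of \<open>\<phi>\<close>. The weight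
  \<open>w\<close> is merely integrable, so this serves both integration by parts and the
  differentiation of an average along a moving bump.\<close>

lemma test_difference_quotient_integral:
  assumes w: "integrable lebesgue w" and \<phi>: "test_function \<Omega> \<phi>"
    and h: "h \<longlonglongrightarrow> 0" "\<And>n. h n \<noteq> 0"
  shows "(\<lambda>n. LINT x|lebesgue. w x * ((\<phi> (x + h n *\<^sub>R e) - \<phi> x) / h n))
    \<longlonglongrightarrow> (LINT x|lebesgue. w x * pd \<phi> x e)"
proof -
  obtain B where B: "B \<ge> 0" "\<And>x y. \<bar>\<phi> x - \<phi> y\<bar> \<le> B * norm (x - y)" using test_function_lipschitz[OF \<phi>] by blast
  show ?thesis
  proof (rule integral_dominated_convergence[where w = "\<lambda>x. \<bar>w x\<bar> * (B * norm e)"])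
    show "(\<lambda>x. w x * pd \<phi> x e) \<in> borel_measurable lebesgue"
      using borel_measurable_integrable[OF w]
        continuous_lebesgue_measurable[OF test_function_continuous[OF test_function_partial[OF \<phi>]]]
      by (rule borel_measurable_times)
    show "(\<lambda>x. w x * ((\<phi> (x + h n *\<^sub>R e) - \<phi> x) / h n)) \<in> borel_measurable lebesgue" for n
    proof (rule borel_measurable_times[OF borel_measurable_integrable[OF w] continuous_lebesgue_measurable])
      show "continuous_on UNIV (\<lambda>x. (\<phi> (x + h n *\<^sub>R e) - \<phi> x) / h n)"
        by (intro continuous_intros continuous_on_compose2[OF test_function_continuous[OF \<phi>]]) (auto simp: h)
    qed
    show "integrable lebesgue (\<lambda>x. \<bar>w x\<bar> * (B * norm e))" using w by auto
    show "AE x in lebesgue. (\<lambda>n. w x * ((\<phi> (x + h n *\<^sub>R e) - \<phi> x) / h n)) \<longlonglongrightarrow> w x * pd \<phi> x e"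
      by (intro AE_I2 tendsto_mult tendsto_const
          has_derivative_difference_quotient[OF test_function_has_derivative[OF \<phi>] h])
    show "AE x in lebesgue. norm (w x * ((\<phi> (x + h n *\<^sub>R e) - \<phi> x) / h n)) \<le> \<bar>w x\<bar> * (B * norm e)" for n
    proof (rule AE_I2)
      fix x
      have "\<bar>\<phi> (x + h n *\<^sub>R e) - \<phi> x\<bar> / \<bar>h n\<bar> \<le> B * norm e"
        using B(2)[of "x + h n *\<^sub>R e" x] h(2)[of n] by (simp add: field_simps)
      from mult_left_mono[OF this abs_ge_zero[of "w x"]]
      show "norm (w x * ((\<phi> (x + h n *\<^sub>R e) - \<phi> x) / h n)) \<le> \<bar>w x\<bar> * (B * norm e)"
        by (simp add: abs_mult)
    qed
  qed
qed

lemma integrable_continuous_mult_test: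
  fixes f :: "'a::euclidean_space \<Rightarrow> real"
  assumes "continuous_on UNIV f" "test_function \<Omega> \<phi>"
  shows "integrable lebesgue (\<lambda>x. f x * \<phi> x)"
  using locally_integrable_mult_test[OF continuous_imp_locally_integrable test_function_mono[OF assms(2)], of UNIV f] assms(1)
  by (simp add: mult.commute)

lemma lipschitz_imp_continuous:
  fixes U :: "'a::real_normed_vector \<Rightarrow> real"
  assumes "\<And>x y. \<bar>U x - U y\<bar> \<le> B * norm (x - y)"
  shows "continuous_on A U"
proof (rule lipschitz_on_continuous_on[of "max B 0"], rule lipschitz_onI)
  show "dist (U x) (U y) \<le> max B 0 * dist x y" for x y
    using assms[of x y] mult_right_mono[of B "max B 0" "norm (x - y)"] by (auto simp: dist_norm)
qed auto

lemma test_function_support_radius: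
  assumes "test_function \<Omega> \<phi>"
  obtains r where "closure {x. \<phi> x \<noteq> 0} \<subseteq> cball 0 r"
    "\<And>x t. \<phi> (x + t *\<^sub>R e) \<noteq> 0 \<Longrightarrow> norm x \<le> r + \<bar>t\<bar> * norm e"
proof -
  have "bounded {x. \<phi> x \<noteq> 0}"
    using assms compact_imp_bounded bounded_subset[OF _ closure_subset] unfolding test_function_def by blast
  then obtain r where r: "\<And>x. \<phi> x \<noteq> 0 \<Longrightarrow> norm x \<le> r" unfolding bounded_iff by auto
  show ?thesis
  proof
    show "closure {x. \<phi> x \<noteq> 0} \<subseteq> cball 0 r" using r by (intro closure_minimal) auto
    show "norm x \<le> r + \<bar>t\<bar> * norm e" if "\<phi> (x + t *\<^sub>R e) \<noteq> 0" for x t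
      using r[OF that] norm_triangle_ineq4[of "x + t *\<^sub>R e" "t *\<^sub>R e"] by simp
  qed
qed

text \<open>Translation invariance of Lebesgue measure moves the difference quotient from
  \<open>\<phi>\<close> to \<open>U\<close>, and both sides pass to the limit by domination. The
  limit hypothesis is one-sided and pointwise everywhere, which is what convex functions
  offer.\<close>

lemma lipschitz_integration_by_parts:
  fixes U :: "'a::euclidean_space \<Rightarrow> real"
  assumes lip: "\<And>x y. \<bar>U x - U y\<bar> \<le> B * norm (x - y)"
    and lim: "\<And>x. (\<lambda>n. (U (x + inverse (real (Suc n)) *\<^sub>R e) - U x) / inverse (real (Suc n))) \<longlonglongrightarrow> Ue x"
    and \<phi>: "test_function \<Omega> \<phi>"
  shows "(LINT x|lebesgue. U x * pd \<phi> x e) = - (LINT x|lebesgue. Ue x * \<phi> x)"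
proof -
  define h where "h n = inverse (real (Suc n))" for n
  have h: "h \<longlonglongrightarrow> 0" "\<And>n. h n > 0" "\<And>n. h n \<le> 1"
    using LIMSEQ_inverse_real_of_nat by (auto simp: h_def[abs_def] divide_simps)
  have contU: "continuous_on UNIV U" by (rule lipschitz_imp_continuous[OF lip])
  have cont\<phi>: "continuous_on UNIV \<phi>" using test_function_continuous[OF \<phi>] .
  obtain r where r: "closure {x. \<phi> x \<noteq> 0} \<subseteq> cball 0 r"
    "\<And>x t. \<phi> (x + t *\<^sub>R e) \<noteq> 0 \<Longrightarrow> norm x \<le> r + \<bar>t\<bar> * norm e"
    using test_function_support_radius[OF \<phi>] by metis
  \<comment> \<open>Steps along \<open>e\<close> have length at most 1 times \<open>norm e\<close>,
    so this ball contains the support of \<open>\<phi>\<close> together with all its translates in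
    use.\<close>
  define K where "K = cball (0::'a) (r + norm e)"
  have z: "\<phi> (x + s *\<^sub>R e) = 0" if "x \<notin> K" "\<bar>s\<bar> \<le> 1" for x s
    using r(2)[of x s] that mult_left_le_one_le[of "norm e" "\<bar>s\<bar>"] by (force simp: K_def)
  have "cball 0 r \<subseteq> K" unfolding K_def by (rule subset_cball) simp
  then have z': "pd \<phi> x e = 0" if "x \<notin> K" for x
    using r(1) that by (subst frechet_derivative_eq_0) auto
  have wK: "integrable lebesgue (\<lambda>x. indicator K x * U x)"
  proof -
    have "U absolutely_integrable_on K"
      using contU continuous_on_subset by (intro absolutely_integrable_continuous_compact) (auto simp: K_def)
    then show ?thesis by (simp add: set_integrable_def)
  qed
  have int1: "integrable lebesgue (\<lambda>x. U x * \<phi> x)"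
    by (rule integrable_continuous_mult_test[OF contU \<phi>])
  have int2: "integrable lebesgue (\<lambda>x. U (x + a) * \<phi> x)" for a
    by (rule integrable_continuous_mult_test[OF _ \<phi>])
      (intro continuous_on_compose2[OF contU] continuous_intros, auto)
  have m2: "(\<lambda>x. U (x + a) * \<phi> x) \<in> borel_measurable borel" for a
    by (intro borel_measurable_continuous_onI continuous_on_mult cont\<phi> continuous_on_compose2[OF contU])
      (auto intro: continuous_intros)
  have tr: "(LINT x|lebesgue. U x * \<phi> (x - a)) = (LINT x|lebesgue. U (x + a) * \<phi> x)"
    and int3: "integrable lebesgue (\<lambda>x. U x * \<phi> (x - a))" for a
    using lebesgue_integral_translate[OF m2[of a], of "- a"] int2[of a] by simp_all
  \<comment> \<open>A backward step on \<open>\<phi>\<close> becomes, after translation, the forward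
    quotient of \<open>U\<close> that \<open>lim\<close> controls.\<close>
  have "(\<lambda>n. LINT x|lebesgue. (indicator K x * U x) * ((\<phi> (x + (- h n) *\<^sub>R e) - \<phi> x) / (- h n)))
    \<longlonglongrightarrow> (LINT x|lebesgue. (indicator K x * U x) * pd \<phi> x e)"
    using tendsto_minus[OF h(1)] h(2)
    by (intro test_difference_quotient_integral[OF wK \<phi>]) (auto simp: less_imp_neq[symmetric])
  also have "(\<lambda>x. (indicator K x * U x) * pd \<phi> x e) = (\<lambda>x. U x * pd \<phi> x e)"
    using z' by (intro ext) (auto simp: indicator_def)
  also have "(\<lambda>n. LINT x|lebesgue. (indicator K x * U x) * ((\<phi> (x + (- h n) *\<^sub>R e) - \<phi> x) / (- h n))) =
    (\<lambda>n. - (LINT x|lebesgue. (U (x + h n *\<^sub>R e) - U x) / h n * \<phi> x))"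
  proof
    fix n
    have "(indicator K x * U x) * ((\<phi> (x + (- h n) *\<^sub>R e) - \<phi> x) / (- h n)) =
        (U x * \<phi> x - U x * \<phi> (x - h n *\<^sub>R e)) / h n" for x
      using z[of x "- h n"] z[of x 0] h(2,3)[of n] by (cases "x \<in> K") (auto simp: field_simps)
    then have "(LINT x|lebesgue. (indicator K x * U x) * ((\<phi> (x + (- h n) *\<^sub>R e) - \<phi> x) / (- h n))) =
      ((LINT x|lebesgue. U x * \<phi> x) - (LINT x|lebesgue. U (x + h n *\<^sub>R e) * \<phi> x)) / h n"
      using int1 int3 tr by simp
    also have "\<dots> = - ((LINT x|lebesgue. U (x + h n *\<^sub>R e) * \<phi> x - U x * \<phi> x) / h n)"
      by (simp only: Bochner_Integration.integral_diff[OF int2 int1] minus_divide_left minus_diff_eq)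
    also have "\<dots> = - (LINT x|lebesgue. (U (x + h n *\<^sub>R e) * \<phi> x - U x * \<phi> x) / h n)"
      by simp
    also have "(\<lambda>x. (U (x + h n *\<^sub>R e) * \<phi> x - U x * \<phi> x) / h n) = (\<lambda>x. (U (x + h n *\<^sub>R e) - U x) / h n * \<phi> x)"
      by (auto simp: field_simps)
    finally show "(LINT x|lebesgue. (indicator K x * U x) * ((\<phi> (x + (- h n) *\<^sub>R e) - \<phi> x) / (- h n))) =
      - (LINT x|lebesgue. (U (x + h n *\<^sub>R e) - U x) / h n * \<phi> x)" .
  qed
  finally have lim1: "(\<lambda>n. - (LINT x|lebesgue. (U (x + h n *\<^sub>R e) - U x) / h n * \<phi> x))
    \<longlonglongrightarrow> (LINT x|lebesgue. U x * pd \<phi> x e)" .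
  have m: "(\<lambda>x. (U (x + h n *\<^sub>R e) - U x) / h n) \<in> borel_measurable lebesgue" for n
    using h(2)[of n]
    by (intro continuous_lebesgue_measurable continuous_intros continuous_on_compose2[OF contU]) auto
  have mUe: "Ue \<in> borel_measurable lebesgue"
    by (rule borel_measurable_LIMSEQ_real[OF _ m]) (use lim in \<open>simp add: h_def\<close>)
  have m\<phi>: "\<phi> \<in> borel_measurable lebesgue" by (rule continuous_lebesgue_measurable[OF cont\<phi>])
  have "(\<lambda>n. LINT x|lebesgue. (U (x + h n *\<^sub>R e) - U x) / h n * \<phi> x) \<longlonglongrightarrow> (LINT x|lebesgue. Ue x * \<phi> x)"
  proof (rule integral_dominated_convergence[where w = "\<lambda>x. B * norm e * \<bar>\<phi> x\<bar>"])
    show "AE x in lebesgue. (\<lambda>n. (U (x + h n *\<^sub>R e) - U x) / h n * \<phi> x) \<longlonglongrightarrow> Ue x * \<phi> x"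
      using lim by (intro AE_I2 tendsto_mult tendsto_const) (simp add: h_def)
    show "integrable lebesgue (\<lambda>x. B * norm e * \<bar>\<phi> x\<bar>)"
      using integrable_continuous_mult_test[OF continuous_on_const[of UNIV 1] \<phi>] by auto
    show "AE x in lebesgue. norm ((U (x + h n *\<^sub>R e) - U x) / h n * \<phi> x) \<le> B * norm e * \<bar>\<phi> x\<bar>" for n
    proof (rule AE_I2)
      fix x
      have "\<bar>U (x + h n *\<^sub>R e) - U x\<bar> / h n \<le> B * norm e"
        using lip[of "x + h n *\<^sub>R e" x] h(2)[of n] by (simp add: field_simps)
      then show "norm ((U (x + h n *\<^sub>R e) - U x) / h n * \<phi> x) \<le> B * norm e * \<bar>\<phi> x\<bar>"
        using h(2)[of n] mult_right_mono[of "\<bar>U (x + h n *\<^sub>R e) - U x\<bar> / h n" "B * norm e" "\<bar>\<phi> x\<bar>"]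
        by (simp add: abs_mult)
    qed
    show "(\<lambda>x. Ue x * \<phi> x) \<in> borel_measurable lebesgue"
      using mUe m\<phi> by (rule borel_measurable_times)
    show "(\<lambda>x. (U (x + h n *\<^sub>R e) - U x) / h n * \<phi> x) \<in> borel_measurable lebesgue" for n
      using m m\<phi> by (rule borel_measurable_times)
  qed
  from tendsto_minus[OF this] lim1 show ?thesis using LIMSEQ_unique by blast
qed

section \<open>The fundamental lemma of the calculus of variations\<close>

text \<open>The factor \<open>k\<close> drives every one-dimensional factor to 1 inside the box, so
  the bumps tend to the indicator of the open box while vanishing outside it.\<close>

definition box_bump :: "'a::euclidean_space \<Rightarrow> 'a \<Rightarrow> nat \<Rightarrow> 'a \<Rightarrow> real" where
  "box_bump a b k x = (\<Prod>i\<in>Basis. flat 0 (real k * (x \<bullet> i - a \<bullet> i)) * flat 0 (real k * (b \<bullet> i - x \<bullet> i)))"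

lemma box_bump_bounds: "0 \<le> box_bump a b k x" "box_bump a b k x \<le> 1"
  unfolding box_bump_def
  by (auto intro!: prod_nonneg prod_le_1 mult_nonneg_nonneg mult_le_one flat_bounds)

lemma box_bump_pos_iff: "0 < box_bump a b (Suc k) x \<longleftrightarrow> x \<in> box a b"
proof -
  have "flat 0 (real (Suc k) * t) > 0 \<longleftrightarrow> t > 0" for t
    by (auto simp: flat_def zero_less_mult_iff)
  moreover have "0 < box_bump a b (Suc k) x \<longleftrightarrow> (\<forall>i\<in>Basis. flat 0 (real (Suc k) * (x \<bullet> i - a \<bullet> i)) > 0
      \<and> flat 0 (real (Suc k) * (b \<bullet> i - x \<bullet> i)) > 0)"
    unfolding box_bump_def less_le prod_zero_iff[OF finite_Basis]
    using flat_bounds by (auto simp: prod_nonneg intro!: prod_nonneg)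
  ultimately show ?thesis by (auto simp: mem_box)
qed

lemma box_bump_outside: "x \<notin> box a b \<Longrightarrow> box_bump a b (Suc k) x = 0"
  using box_bump_pos_iff[of a b k x] box_bump_bounds(1)[of a b "Suc k" x] by linarith

lemma test_function_box_bump:
  assumes "cbox a b \<subseteq> \<Omega>"
  shows "test_function \<Omega> (box_bump a b (Suc k))"
proof (rule test_functionI)
  fix m
  have "C_k m (\<lambda>x. flat 0 (real (Suc k) * (x \<bullet> i + - (a \<bullet> i))))" for i
    by (intro C_k_compose_real[OF C_k_flat] C_k_mult[OF C_k_const] C_k_add[OF _ C_k_const] C_k_inner)
  moreover have "C_k m (\<lambda>x. flat 0 (real (Suc k) * (b \<bullet> i + - (x \<bullet> i))))" for i
    by (intro C_k_compose_real[OF C_k_flat] C_k_mult[OF C_k_const] C_k_add[OF C_k_const] C_k_inner C_k_uminus)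
  ultimately have "C_k m (\<lambda>x. \<Prod>i\<in>Basis. flat 0 (real (Suc k) * (x \<bullet> i + - (a \<bullet> i))) *
      flat 0 (real (Suc k) * (b \<bullet> i + - (x \<bullet> i))))"
    by (intro C_k_prod C_k_mult)
  moreover have "box_bump a b (Suc k) = (\<lambda>x. \<Prod>i\<in>Basis. flat 0 (real (Suc k) * (x \<bullet> i + - (a \<bullet> i))) *
      flat 0 (real (Suc k) * (b \<bullet> i + - (x \<bullet> i))))"
    by (auto simp: box_bump_def fun_eq_iff)
  ultimately show "C_k m (box_bump a b (Suc k))" by simp
next
  fix x assume "box_bump a b (Suc k) x \<noteq> 0"
  then show "x \<in> cbox a b" using box_bump_outside box_subset_cbox by blast
qed (use assms in auto)

lemma flat_scaled_LIMSEQ: "t > 0 \<Longrightarrow> (\<lambda>k. flat 0 (real (Suc k) * t)) \<longlonglongrightarrow> 1"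
proof -
  assume t: "t > 0"
  have "(\<lambda>k. exp (- (inverse (real (Suc k)) * inverse t))) \<longlonglongrightarrow> exp (- (0 * inverse t))"
    by (intro tendsto_intros LIMSEQ_inverse_real_of_nat)
  moreover have "flat 0 (real (Suc k) * t) = exp (- (inverse (real (Suc k)) * inverse t))" for k
    using t by (simp add: flat_def zero_less_mult_iff inverse_eq_divide)
  ultimately show ?thesis by simp
qed

lemma box_bump_LIMSEQ: "(\<lambda>k. box_bump a b (Suc k) x) \<longlonglongrightarrow> indicator (box a b) x"
proof (cases "x \<in> box a b")
  case True
  then have "(\<lambda>k. box_bump a b (Suc k) x) \<longlonglongrightarrow> (\<Prod>i\<in>(Basis::'a set). 1 * 1)"
    unfolding box_bump_def by (intro tendsto_prod tendsto_mult flat_scaled_LIMSEQ) (auto simp: mem_box)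
  then show ?thesis using True by simp
next
  case False
  then show ?thesis by (simp add: box_bump_outside)
qed

text \<open>The bumps converge to the indicator of the box and are dominated by \<bar>g\<bar> on the
  closed box, where local integrability makes it integrable; the boundary of the box is
  null.\<close>

lemma integral_cbox_eq_0_of_test:
  fixes g :: "'a::euclidean_space \<Rightarrow> real"
  assumes g: "locally_integrable \<Omega> g" and sub: "cbox a b \<subseteq> \<Omega>"
    and 0: "\<And>\<phi>. test_function \<Omega> \<phi> \<Longrightarrow> (LINT x|lebesgue. g x * \<phi> x) = 0"
  shows "integral (cbox a b) g = 0"
proof -
  have abs: "g absolutely_integrable_on cbox a b"
    using g sub by (simp add: locally_integrable_def)
  then have i1: "integrable lebesgue (\<lambda>x. indicator (cbox a b) x * g x)"
    by (simp add: set_integrable_def)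
  have abs': "g absolutely_integrable_on box a b"
    using abs by (rule set_integrable_subset) (auto simp: box_subset_cbox)
  then have i2: "integrable lebesgue (\<lambda>x. indicator (box a b) x * g x)"
    by (simp add: set_integrable_def)
  have "(\<lambda>k. LINT x|lebesgue. g x * box_bump a b (Suc k) x) \<longlonglongrightarrow> (LINT x|lebesgue. indicator (box a b) x * g x)"
  proof (rule integral_dominated_convergence[where w = "\<lambda>x. \<bar>indicator (cbox a b) x * g x\<bar>"])
    show "(\<lambda>x. g x * box_bump a b (Suc k) x) \<in> borel_measurable lebesgue" for k
      using locally_integrable_mult_test[OF g test_function_box_bump[OF sub, of k]]
      by (auto simp: mult.commute dest: borel_measurable_integrable)
    show "AE x in lebesgue. (\<lambda>k. g x * box_bump a b (Suc k) x) \<longlonglongrightarrow> indicator (box a b) x * g x"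
    proof (rule AE_I2)
      fix x show "(\<lambda>k. g x * box_bump a b (Suc k) x) \<longlonglongrightarrow> indicator (box a b) x * g x"
        using tendsto_mult_left[OF box_bump_LIMSEQ[of a b x], of "g x"] by (simp add: mult.commute)
    qed
    show "AE x in lebesgue. norm (g x * box_bump a b (Suc k) x) \<le> \<bar>indicator (cbox a b) x * g x\<bar>" for k
    proof (rule AE_I2)
      fix x
      show "norm (g x * box_bump a b (Suc k) x) \<le> \<bar>indicator (cbox a b) x * g x\<bar>"
      proof (cases "x \<in> box a b")
        case True
        then have "x \<in> cbox a b" using box_subset_cbox by blast
        then show ?thesis
          using box_bump_bounds[of a b "Suc k" x] by (auto simp: abs_mult intro: mult_left_le)
      qed (simp add: box_bump_outside)
    qed
  qed (use i1 i2 in \<open>auto dest: borel_measurable_integrable\<close>)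
  then have "(LINT x|lebesgue. indicator (box a b) x * g x) = 0"
    using 0[OF test_function_box_bump[OF sub]] by (simp add: LIMSEQ_const_iff)
  then have "integral (box a b) g = 0"
    using set_lebesgue_integral_eq_integral(2)[OF abs'] by (simp add: set_lebesgue_integral_def)
  then show ?thesis by (simp add: integral_open_interval)
qed

text \<open>Lebesgue differentiation: outside a null set, \<open>f x\<close> is the limit of
  averages over small cubes with corner \<open>x\<close>, and all of these vanish.\<close>

lemma ae_zero_of_integral_cbox_0:
  fixes f :: "'a::euclidean_space \<Rightarrow> real"
  assumes "\<And>a b. f integrable_on cbox a b" "\<And>a b. integral (cbox a b) f = 0"
  shows "negligible {x. f x \<noteq> 0}"
proof -
  obtain N where N: "negligible N"
    "\<And>x e. \<lbrakk>x \<notin> N; 0 < e\<rbrakk> \<Longrightarrow> \<exists>d>0. \<forall>h. 0 < h \<and> h < d \<longrightarrow>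
       norm (integral (cbox x (x + h *\<^sub>R One)) f /\<^sub>R h ^ DIM('a) - f x) < e"
    using integrable_ccontinuous_explicit[OF assms(1)] by blast
  have "f x = 0" if "x \<notin> N" for x
  proof (rule ccontr)
    assume "f x \<noteq> 0"
    then have "\<exists>d>0. \<forall>h. 0 < h \<and> h < d \<longrightarrow>
       norm (integral (cbox x (x + h *\<^sub>R One)) f /\<^sub>R h ^ DIM('a) - f x) < \<bar>f x\<bar>"
      by (intro N(2)[OF that]) simp
    then obtain d where "d > 0" and d: "\<forall>h. 0 < h \<and> h < d \<longrightarrow>
       norm (integral (cbox x (x + h *\<^sub>R One)) f /\<^sub>R h ^ DIM('a) - f x) < \<bar>f x\<bar>"
      by blast
    from d[rule_format, of "d / 2"] \<open>d > 0\<close> show False unfolding assms(2) by simp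
  qed
  then show ?thesis by (intro negligible_subset[OF N(1)]) auto
qed

text \<open>An open set is a countable union of closed boxes. On each box \<open>g\<close> is
  extended by zero; since the intersection of two boxes is again a box, all box integrals of the
  extension vanish.\<close>

lemma fundamental_lemma:
  fixes g :: "'a::euclidean_space \<Rightarrow> real"
  assumes \<Omega>: "open \<Omega>" and g: "locally_integrable \<Omega> g"
    and 0: "\<And>\<phi>. test_function \<Omega> \<phi> \<Longrightarrow> (LINT x|lebesgue. g x * \<phi> x) = 0"
  shows "AE x in lebesgue_on \<Omega>. g x = 0"
proof -
  obtain D where D: "countable D" "D \<subseteq> Pow \<Omega>" "\<And>X. X \<in> D \<Longrightarrow> \<exists>a b. X = cbox a b" "\<Union>D = \<Omega>"
    using open_countable_Union_open_cbox[OF \<Omega>] by blast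
  have "negligible {x \<in> X. g x \<noteq> 0}" if "X \<in> D" for X
  proof -
    obtain a b where X: "X = cbox a b" using D(3)[OF \<open>X \<in> D\<close>] by blast
    have sub: "cbox a b \<subseteq> \<Omega>" using D(2) that X by blast
    define f where "f x = (if x \<in> X then g x else 0)" for x
    have "f integrable_on cbox c d \<and> integral (cbox c d) f = 0" for c d
    proof -
      obtain c' d' where Int: "X \<inter> cbox c d = cbox c' d'" unfolding X Int_interval by blast
      have sub': "cbox c' d' \<subseteq> \<Omega>" using Int sub X by blast
      have "g integrable_on cbox c' d'"
        using g sub' by (intro set_lebesgue_integral_eq_integral(1)) (auto simp: locally_integrable_def)
      moreover have "integral (cbox c' d') g = 0"
        by (rule integral_cbox_eq_0_of_test[OF g sub' 0])
      ultimately show ?thesis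
        unfolding f_def[abs_def] integrable_restrict_Int integral_restrict_Int Int by blast
    qed
    then have "negligible {x. f x \<noteq> 0}" by (intro ae_zero_of_integral_cbox_0) auto
    then show ?thesis by (rule negligible_subset) (auto simp: f_def)
  qed
  then have "negligible (\<Union>X\<in>D. {x \<in> X. g x \<noteq> 0})"
    using D(1) by (intro negligible_countable_Union) auto
  moreover have "(\<Union>X\<in>D. {x \<in> X. g x \<noteq> 0}) = {x \<in> \<Omega>. g x \<noteq> 0}" using D(4) by auto
  ultimately have "{x \<in> \<Omega>. g x \<noteq> 0} \<in> null_sets lebesgue"
    by (simp add: negligible_iff_null_sets)
  then have "AE x in lebesgue. x \<in> \<Omega> \<longrightarrow> g x = 0"
    by (rule AE_I') auto
  then show ?thesis using \<Omega> by (subst AE_restrict_space_iff) auto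
qed

section \<open>Weak gradients\<close>

definition grad :: "('a::euclidean_space \<Rightarrow> real) \<Rightarrow> 'a \<Rightarrow> 'a" where
  "grad \<phi> x = (\<Sum>b\<in>Basis. pd \<phi> x b *\<^sub>R b)"

lemma grad_inner:
  assumes "(\<phi> has_derivative frechet_derivative \<phi> (at x)) (at x)"
  shows "grad \<phi> x \<bullet> e = pd \<phi> x e"
  unfolding grad_def frechet_derivative_Basis_sum[OF assms, of e]
  by (simp add: inner_sum_left inner_commute[of e] mult.commute)

text \<open>Recovers a norm from directional bounds, by testing in the direction of the vector
  itself.\<close>

lemma norm_le_of_inner_le:
  fixes v :: "'a::real_inner"
  assumes "0 \<le> L" "v \<bullet> v \<le> L * norm v"
  shows "norm v \<le> L"
  using assms by (cases "v = 0") (auto simp: dot_square_norm power2_eq_square)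

lemma locally_integrable_inner:
  assumes "locally_integrable \<Omega> G"
  shows "locally_integrable \<Omega> (\<lambda>x. G x \<bullet> b)"
  unfolding locally_integrable_def
proof safe
  fix K assume "compact K" "K \<subseteq> \<Omega>"
  then have "integrable lebesgue (\<lambda>x. indicator K x *\<^sub>R G x)"
    using assms by (auto simp: locally_integrable_def set_integrable_def)
  from integrable_inner_left[OF this, of b]
  show "(\<lambda>x. G x \<bullet> b) absolutely_integrable_on K" by (simp add: set_integrable_def)
qed

lemma locally_integrable_add:
  "locally_integrable \<Omega> f \<Longrightarrow> locally_integrable \<Omega> g \<Longrightarrow> locally_integrable \<Omega> (\<lambda>x. f x + g x)"
  by (auto simp: locally_integrable_def intro!: set_integral_add(1))

lemma locally_integrable_diff:
  "locally_integrable \<Omega> f \<Longrightarrow> locally_integrable \<Omega> g \<Longrightarrow> locally_integrable \<Omega> (\<lambda>x. f x - g x)"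
  by (auto simp: locally_integrable_def intro!: set_integral_diff(1))

lemma locally_integrable_mult_test_real:
  fixes g :: "'a::euclidean_space \<Rightarrow> real"
  assumes "locally_integrable \<Omega> g" and "test_function \<Omega> \<phi>"
  shows "integrable lebesgue (\<lambda>x. g x * \<phi> x)"
  using locally_integrable_mult_test[OF assms] by (simp add: mult.commute)

lemma test_derivative_outside:
  assumes "test_function \<Omega> \<phi>" "x \<notin> \<Omega>"
  shows "pd \<phi> x e = 0"
proof -
  have "x \<notin> closure {x. \<phi> x \<noteq> 0}" using assms by (auto simp: test_function_def)
  then show ?thesis by (simp add: frechet_derivative_eq_0)
qed

text \<open>Test functions and their derivatives vanish off \<Omega>, so the integrals extend to the
  whole space, where translation is available.\<close>

lemma has_weak_gradient_iff:
  assumes \<Omega>: "open \<Omega>"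
  shows "has_weak_gradient \<Omega> u G \<longleftrightarrow> locally_integrable \<Omega> u \<and> locally_integrable \<Omega> G \<and>
    (\<forall>\<phi>. test_function \<Omega> \<phi> \<longrightarrow> (\<forall>b\<in>Basis.
      (LINT x|lebesgue. u x * pd \<phi> x b) = - (LINT x|lebesgue. (G x \<bullet> b) * \<phi> x)))"
proof -
  have [simp]: "\<Omega> \<in> sets lebesgue" using \<Omega> by auto
  have 1: "(LINT x|lebesgue_on \<Omega>. u x * pd \<phi> x b) =
      (LINT x|lebesgue. u x * pd \<phi> x b)" if "test_function \<Omega> \<phi>" for \<phi> b
    using that by (intro lebesgue_on_integral_eq) (auto simp: test_derivative_outside)
  have 2: "(LINT x|lebesgue_on \<Omega>. (G x \<bullet> b) * \<phi> x) = (LINT x|lebesgue. (G x \<bullet> b) * \<phi> x)"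
    if "test_function \<Omega> \<phi>" for \<phi> b
    using that by (intro lebesgue_on_integral_eq) (auto simp: test_function_eq_0)
  show ?thesis unfolding has_weak_gradient_def by (simp add: 1 2 cong: conj_cong imp_cong)
qed

text \<open>The weak identity is linear in the direction, so it passes from the basis to every
  \<open>e\<close>. General directions are needed for the rate of change along a segment and for the
  Euclidean norm bound on a gradient.\<close>

lemma has_weak_gradientD:
  assumes \<Omega>: "open \<Omega>" and G: "has_weak_gradient \<Omega> u G" and \<phi>: "test_function \<Omega> \<phi>"
  shows "(LINT x|lebesgue. u x * pd \<phi> x e) = - (LINT x|lebesgue. (G x \<bullet> e) * \<phi> x)"
proof -
  have u: "locally_integrable \<Omega> u" and Gl: "locally_integrable \<Omega> G"
    using G by (auto simp: has_weak_gradient_def)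
  have iu: "integrable lebesgue (\<lambda>x. u x * pd \<phi> x b)" for b
    by (rule locally_integrable_mult_test_real[OF u test_function_partial[OF \<phi>]])
  have iG: "integrable lebesgue (\<lambda>x. (G x \<bullet> b) * \<phi> x)" for b
    by (rule locally_integrable_mult_test_real[OF locally_integrable_inner[OF Gl] \<phi>])
  have "(LINT x|lebesgue. u x * pd \<phi> x e) =
      (LINT x|lebesgue. (\<Sum>b\<in>Basis. (e \<bullet> b) * (u x * pd \<phi> x b)))"
    by (subst frechet_derivative_Basis_sum[OF test_function_has_derivative[OF \<phi>]])
      (simp add: sum_distrib_left algebra_simps)
  also have "\<dots> = (\<Sum>b\<in>Basis. (e \<bullet> b) * (LINT x|lebesgue. u x * pd \<phi> x b))"
    using iu by (subst Bochner_Integration.integral_sum) auto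
  also have "\<dots> = (\<Sum>b\<in>Basis. (e \<bullet> b) * - (LINT x|lebesgue. (G x \<bullet> b) * \<phi> x))"
    using G \<phi> unfolding has_weak_gradient_iff[OF \<Omega>] by (intro sum.cong) auto
  also have "\<dots> = - (\<Sum>b\<in>Basis. (e \<bullet> b) * (LINT x|lebesgue. (G x \<bullet> b) * \<phi> x))"
    by (simp add: sum_negf)
  also have "(\<Sum>b\<in>Basis. (e \<bullet> b) * (LINT x|lebesgue. (G x \<bullet> b) * \<phi> x)) =
      (LINT x|lebesgue. (\<Sum>b\<in>Basis. (e \<bullet> b) * ((G x \<bullet> b) * \<phi> x)))"
    using iG by (subst Bochner_Integration.integral_sum) auto
  also have "(\<lambda>x. \<Sum>b\<in>Basis. (e \<bullet> b) * ((G x \<bullet> b) * \<phi> x)) = (\<lambda>x. (G x \<bullet> e) * \<phi> x)"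
    by (rule ext, subst (2) euclidean_inner) (simp add: sum_distrib_left sum_distrib_right algebra_simps)
  finally show ?thesis .
qed

lemma has_weak_gradient_AE_unique:
  assumes \<Omega>: "open \<Omega>" and G: "has_weak_gradient \<Omega> u G" and H: "has_weak_gradient \<Omega> u H"
  shows "AE x in lebesgue_on \<Omega>. G x = H x"
proof -
  have l: "locally_integrable \<Omega> (\<lambda>x. G x \<bullet> b)" "locally_integrable \<Omega> (\<lambda>x. H x \<bullet> b)" for b
    using G H unfolding has_weak_gradient_def by (blast intro: locally_integrable_inner)+
  have "AE x in lebesgue_on \<Omega>. G x \<bullet> b - H x \<bullet> b = 0" for b
  proof (rule fundamental_lemma[OF \<Omega> locally_integrable_diff[OF l]])
    fix \<phi> assume \<phi>: "test_function \<Omega> \<phi>"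
    have "(LINT x|lebesgue. (G x \<bullet> b - H x \<bullet> b) * \<phi> x) =
        (LINT x|lebesgue. (G x \<bullet> b) * \<phi> x) - (LINT x|lebesgue. (H x \<bullet> b) * \<phi> x)"
      using Bochner_Integration.integral_diff[OF locally_integrable_mult_test_real[OF l(1)[of b] \<phi>]
          locally_integrable_mult_test_real[OF l(2)[of b] \<phi>]]
      by (simp add: left_diff_distrib)
    then show "(LINT x|lebesgue. (G x \<bullet> b - H x \<bullet> b) * \<phi> x) = 0"
      using has_weak_gradientD[OF \<Omega> G \<phi>, of b] has_weak_gradientD[OF \<Omega> H \<phi>, of b] by simp
  qed
  then have "AE x in lebesgue_on \<Omega>. \<forall>b\<in>Basis. G x \<bullet> b - H x \<bullet> b = 0"
    by (intro AE_finite_allI) auto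
  then show ?thesis
  proof eventually_elim
    case (elim x)
    then show ?case by (intro euclidean_eqI[of "G x" "H x"]) simp
  qed
qed

lemma has_weak_gradient_weak_gradient:
  "has_weak_gradient \<Omega> u G \<Longrightarrow> has_weak_gradient \<Omega> u (weak_gradient \<Omega> u)"
  unfolding weak_gradient_def by (rule someI[of "has_weak_gradient \<Omega> u"])

lemma weak_gradient_AE:
  "open \<Omega> \<Longrightarrow> has_weak_gradient \<Omega> u G \<Longrightarrow> AE x in lebesgue_on \<Omega>. weak_gradient \<Omega> u x = G x"
  by (rule has_weak_gradient_AE_unique[OF _ has_weak_gradient_weak_gradient])

lemma has_weak_gradient_add:
  assumes \<Omega>: "open \<Omega>" and G: "has_weak_gradient \<Omega> u G" and H: "has_weak_gradient \<Omega> v H"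
  shows "has_weak_gradient \<Omega> (\<lambda>x. u x + v x) (\<lambda>x. G x + H x)"
proof -
  have l: "locally_integrable \<Omega> u" "locally_integrable \<Omega> v" "locally_integrable \<Omega> G" "locally_integrable \<Omega> H"
    using G H by (auto simp: has_weak_gradient_def)
  show ?thesis unfolding has_weak_gradient_iff[OF \<Omega>]
  proof (intro conjI allI impI ballI locally_integrable_add l)
    fix \<phi> b assume \<phi>: "test_function \<Omega> \<phi>"
    note I = locally_integrable_mult_test_real[OF l(1) test_function_partial[OF \<phi>, of b]]
      locally_integrable_mult_test_real[OF l(2) test_function_partial[OF \<phi>, of b]]
      locally_integrable_mult_test_real[OF locally_integrable_inner[OF l(3), of b] \<phi>]
      locally_integrable_mult_test_real[OF locally_integrable_inner[OF l(4), of b] \<phi>]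
    show "(LINT x|lebesgue. (u x + v x) * pd \<phi> x b) =
        - (LINT x|lebesgue. ((G x + H x) \<bullet> b) * \<phi> x)"
      using has_weak_gradientD[OF \<Omega> G \<phi>, of b] has_weak_gradientD[OF \<Omega> H \<phi>, of b] I
      by (simp add: distrib_right inner_add_left)
  qed
qed

lemma has_weak_gradient_uminus:
  assumes \<Omega>: "open \<Omega>" and G: "has_weak_gradient \<Omega> u G"
  shows "has_weak_gradient \<Omega> (\<lambda>x. - u x) (\<lambda>x. - G x)"
proof -
  have l: "locally_integrable \<Omega> u" "locally_integrable \<Omega> G"
    using G by (auto simp: has_weak_gradient_def)
  have m: "locally_integrable \<Omega> (\<lambda>x. - u x)" "locally_integrable \<Omega> (\<lambda>x. - G x)"
    using l by (auto simp: locally_integrable_def set_integrable_def)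
  then show ?thesis unfolding has_weak_gradient_iff[OF \<Omega>]
    using has_weak_gradientD[OF \<Omega> G] by simp
qed

lemma has_weak_gradient_diff:
  assumes "open \<Omega>" "has_weak_gradient \<Omega> u G" "has_weak_gradient \<Omega> v H"
  shows "has_weak_gradient \<Omega> (\<lambda>x. u x - v x) (\<lambda>x. G x - H x)"
  using has_weak_gradient_add[OF assms(1,2) has_weak_gradient_uminus[OF assms(1,3)]] by simp

lemma LIMSEQ_h: "(\<lambda>n. inverse (real (Suc n))) \<longlonglongrightarrow> 0" "inverse (real (Suc n)) \<noteq> 0"
  using LIMSEQ_inverse_real_of_nat by auto

lemma has_weak_gradient_lipschitz:
  fixes U :: "'a::euclidean_space \<Rightarrow> real"
  assumes \<Omega>: "open \<Omega>" and lip: "\<And>x y. \<bar>U x - U y\<bar> \<le> B * norm (x - y)"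
    and lim: "\<And>x b. b \<in> Basis \<Longrightarrow>
      (\<lambda>n. (U (x + inverse (real (Suc n)) *\<^sub>R b) - U x) / inverse (real (Suc n))) \<longlonglongrightarrow> G x \<bullet> b"
    and G: "locally_integrable \<Omega> G"
  shows "has_weak_gradient \<Omega> U G"
  unfolding has_weak_gradient_iff[OF \<Omega>]
proof (intro conjI allI impI ballI)
  show "locally_integrable \<Omega> U"
    by (rule continuous_imp_locally_integrable) (rule lipschitz_imp_continuous[OF lip])
  show "(LINT x|lebesgue. U x * pd \<phi> x b) = - (LINT x|lebesgue. (G x \<bullet> b) * \<phi> x)"
    if "test_function \<Omega> \<phi>" "b \<in> Basis" for \<phi> b
    using lipschitz_integration_by_parts[OF lip lim[OF that(2)] that(1)] .
qed (rule G)

lemma has_weak_gradient_const: "open \<Omega> \<Longrightarrow> has_weak_gradient \<Omega> (\<lambda>x. c) (\<lambda>x. 0)"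
  by (rule has_weak_gradient_lipschitz[where B = 0]) (auto intro!: continuous_imp_locally_integrable)

lemma grad_continuous:
  assumes "test_function \<Omega> \<phi>"
  shows "continuous_on A (grad \<phi>)"
  unfolding grad_def
  by (intro continuous_intros test_function_continuous[OF test_function_partial[OF assms]])

lemma has_weak_gradient_test:
  assumes \<Omega>: "open \<Omega>" and \<phi>: "test_function \<Omega> \<phi>"
  shows "has_weak_gradient \<Omega> \<phi> (grad \<phi>)"
proof -
  obtain B where B: "B \<ge> 0" "\<And>x y. \<bar>\<phi> x - \<phi> y\<bar> \<le> B * norm (x - y)"
    using test_function_lipschitz[OF \<phi>] by blast
  show ?thesis
  proof (rule has_weak_gradient_lipschitz[OF \<Omega> B(2)])
    show "(\<lambda>n. (\<phi> (x + inverse (real (Suc n)) *\<^sub>R b) - \<phi> x) / inverse (real (Suc n))) \<longlonglongrightarrow> grad \<phi> x \<bullet> b" for x b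
      unfolding grad_inner[OF test_function_has_derivative[OF \<phi>]]
      by (rule has_derivative_difference_quotient[OF test_function_has_derivative[OF \<phi>] LIMSEQ_h])
  qed (rule continuous_imp_locally_integrable[OF grad_continuous[OF \<phi>]])
qed

section \<open>Distance to the boundary of a convex domain\<close>

definition support_fun :: "'a::euclidean_space set \<Rightarrow> 'a \<Rightarrow> real" where
  "support_fun \<Omega> e = (SUP y\<in>\<Omega>. y \<bullet> e)"

text \<open>An infimum of affine functions over supporting half-spaces. Unlike the distance to the
  frontier it is concave on the whole space, because it becomes nonpositive outside a convex
  domain.\<close>

definition bdist :: "'a::euclidean_space set \<Rightarrow> 'a \<Rightarrow> real" where
  "bdist \<Omega> x = (INF e\<in>sphere 0 1. support_fun \<Omega> e - x \<bullet> e)"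

definition collar :: "'a::euclidean_space set \<Rightarrow> real \<Rightarrow> real" where
  "collar \<Omega> s = measure lebesgue {x \<in> \<Omega>. bdist \<Omega> x < s}"

locale convex_domain =
  fixes \<Omega> :: "'a::euclidean_space set"
  assumes nonempty: "\<Omega> \<noteq> {}" and open_dom: "open \<Omega>" and bounded_dom: "bounded \<Omega>" and convex_dom: "convex \<Omega>"
begin

lemma obtain_bound: obtains B where "B > 0" "\<And>y. y \<in> \<Omega> \<Longrightarrow> norm y \<le> B"
  using bounded_dom bounded_pos by metis

lemma inner_le_norm: "norm e = 1 \<Longrightarrow> y \<bullet> e \<le> norm y" for y e :: 'a
  using norm_cauchy_schwarz[of y e] by simp

lemma bdd_above_inner: "bdd_above ((\<lambda>y. y \<bullet> e) ` \<Omega>)"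
proof -
  obtain B where B: "B > 0" "\<And>y. y \<in> \<Omega> \<Longrightarrow> norm y \<le> B" using obtain_bound by blast
  have "y \<bullet> e \<le> B * norm e" if "y \<in> \<Omega>" for y
    using norm_cauchy_schwarz[of y e] mult_right_mono[OF B(2)[OF that], of "norm e"] by simp
  then show ?thesis by (intro bdd_aboveI2)
qed

lemma support_fun_ge: "y \<in> \<Omega> \<Longrightarrow> y \<bullet> e \<le> support_fun \<Omega> e"
  unfolding support_fun_def by (intro cSUP_upper bdd_above_inner)

lemma support_fun_le: "(\<And>y. y \<in> \<Omega> \<Longrightarrow> y \<bullet> e \<le> c) \<Longrightarrow> support_fun \<Omega> e \<le> c"
  unfolding support_fun_def using nonempty by (intro cSUP_least)

lemma sphere_nonempty: "sphere (0::'a) 1 \<noteq> {}"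
  by simp

lemma bdd_below_slack: "bdd_below ((\<lambda>e. support_fun \<Omega> e - x \<bullet> e) ` sphere 0 1)"
proof -
  obtain y where y: "y \<in> \<Omega>" using nonempty by blast
  have "- norm (x - y) \<le> support_fun \<Omega> e - x \<bullet> e" if "norm e = 1" for e
    using support_fun_ge[OF y, of e] inner_le_norm[OF that, of "x - y"] by (simp add: inner_diff_left)
  then show ?thesis by (intro bdd_belowI2[of _ "- norm (x - y)"]) auto
qed

lemma bdist_le: "norm e = 1 \<Longrightarrow> bdist \<Omega> x \<le> support_fun \<Omega> e - x \<bullet> e"
  unfolding bdist_def by (intro cINF_lower bdd_below_slack) simp

lemma bdist_ge: "(\<And>e. norm e = 1 \<Longrightarrow> c \<le> support_fun \<Omega> e - x \<bullet> e) \<Longrightarrow> c \<le> bdist \<Omega> x"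
  unfolding bdist_def using sphere_nonempty by (intro cINF_greatest) auto

lemma bdist_less:
  assumes "bdist \<Omega> x < s"
  obtains e where "norm e = 1" "support_fun \<Omega> e - x \<bullet> e < s"
  using assms unfolding bdist_def
  by (subst (asm) cINF_less_iff[OF sphere_nonempty bdd_below_slack]) auto

lemma bdist_le_add: "bdist \<Omega> x \<le> bdist \<Omega> y + norm (x - y)"
proof -
  have "bdist \<Omega> x - norm (x - y) \<le> bdist \<Omega> y"
  proof (rule bdist_ge)
    fix e :: 'a assume e: "norm e = 1"
    show "bdist \<Omega> x - norm (x - y) \<le> support_fun \<Omega> e - y \<bullet> e"
      using bdist_le[OF e, of x] inner_le_norm[OF e, of "y - x"]
      by (simp add: inner_diff_left norm_minus_commute)
  qed
  then show ?thesis by simp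
qed

lemma bdist_lipschitz: "\<bar>bdist \<Omega> x - bdist \<Omega> y\<bar> \<le> norm (x - y)"
  using bdist_le_add[of x y] bdist_le_add[of y x] by (simp add: norm_minus_commute abs_le_iff)

lemma continuous_bdist: "continuous_on A (bdist \<Omega>)"
  by (rule lipschitz_imp_continuous[where B = 1]) (simp add: bdist_lipschitz)

lemma bdist_concave:
  assumes "0 \<le> t" "t \<le> 1"
  shows "(1 - t) * bdist \<Omega> x + t * bdist \<Omega> y \<le> bdist \<Omega> ((1 - t) *\<^sub>R x + t *\<^sub>R y)"
proof (rule bdist_ge)
  fix e :: 'a assume e: "norm e = 1"
  have "(1 - t) * bdist \<Omega> x + t * bdist \<Omega> y \<le>
      (1 - t) * (support_fun \<Omega> e - x \<bullet> e) + t * (support_fun \<Omega> e - y \<bullet> e)"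
    using assms by (intro add_mono mult_left_mono bdist_le e) auto
  also have "\<dots> = support_fun \<Omega> e - ((1 - t) *\<^sub>R x + t *\<^sub>R y) \<bullet> e"
    by (simp add: inner_add_left algebra_simps)
  finally show "(1 - t) * bdist \<Omega> x + t * bdist \<Omega> y \<le> support_fun \<Omega> e - ((1 - t) *\<^sub>R x + t *\<^sub>R y) \<bullet> e" .
qed

text \<open>In each direction the slack at \<open>x\<close> is at least the distance one can travel
  inside \<Omega>. The ball is open, hence the detour through radii below \<open>r\<close>.\<close>

lemma bdist_ge_radius:
  assumes "ball x r \<subseteq> \<Omega>" "0 < r"
  shows "r \<le> bdist \<Omega> x"
proof (rule bdist_ge)
  fix e :: 'a assume e: "norm e = 1"
  show "r \<le> support_fun \<Omega> e - x \<bullet> e"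
  proof (rule dense_le_bounded[OF assms(2)])
    fix s assume s: "0 < s" "s < r"
    then have "x + s *\<^sub>R e \<in> \<Omega>" using assms e by (intro subsetD[OF assms(1)]) (simp add: dist_norm)
    from support_fun_ge[OF this, of e] show "s \<le> support_fun \<Omega> e - x \<bullet> e"
      using e by (simp add: inner_add_left dot_square_norm)
  qed
qed

text \<open>Convexity enters here: a hyperplane separating \<open>x\<close> from \<Omega> supplies a
  unit direction with nonpositive slack.\<close>

lemma bdist_nonpos_outside:
  assumes "x \<notin> \<Omega>"
  shows "bdist \<Omega> x \<le> 0"
proof -
  obtain a b where ab: "a \<noteq> 0" "\<And>z. z \<in> \<Omega> \<Longrightarrow> a \<bullet> z \<le> b" "a \<bullet> x \<ge> b"
    using separating_hyperplane_sets[of \<Omega> "{x}"] convex_dom nonempty assms by auto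
  define e where "e = a /\<^sub>R norm a"
  have e: "norm e = 1" using ab(1) by (simp add: e_def)
  have "support_fun \<Omega> e \<le> x \<bullet> e"
  proof (rule support_fun_le)
    fix y assume "y \<in> \<Omega>"
    then have "a \<bullet> y \<le> a \<bullet> x" using ab by force
    then have "inverse (norm a) * (a \<bullet> y) \<le> inverse (norm a) * (a \<bullet> x)" by (intro mult_left_mono) auto
    then show "y \<bullet> e \<le> x \<bullet> e" by (simp add: e_def inner_commute)
  qed
  then show ?thesis using bdist_le[OF e, of x] by simp
qed

lemma bdist_pos_iff: "0 < bdist \<Omega> x \<longleftrightarrow> x \<in> \<Omega>"
proof
  assume "x \<in> \<Omega>"
  then obtain r where "r > 0" "ball x r \<subseteq> \<Omega>" using open_dom open_contains_ball by blast
  then show "0 < bdist \<Omega> x" using bdist_ge_radius[of x r] by simp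
qed (use bdist_nonpos_outside in force)

lemma bdist_frontier:
  assumes "x \<in> frontier \<Omega>"
  shows "bdist \<Omega> x = 0"
proof (rule antisym)
  show "bdist \<Omega> x \<le> 0" using assms open_dom by (intro bdist_nonpos_outside) (simp add: frontier_def interior_open)
  have "closure \<Omega> \<subseteq> {x. 0 \<le> bdist \<Omega> x}"
    using bdist_pos_iff by (intro closure_minimal closed_Collect_le continuous_bdist) (auto simp: less_imp_le)
  then show "0 \<le> bdist \<Omega> x" using assms by (auto simp: frontier_def)
qed

text \<open>With \<open>bdist_ge_radius\<close>, this identifies \<open>bdist\<close> at a point of
  \<Omega> as the radius of the largest open ball about it in \<Omega>, which links it to the
  inradius.\<close>

lemma ball_bdist_subset: "ball x (bdist \<Omega> x) \<subseteq> \<Omega>"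
proof
  fix y assume "y \<in> ball x (bdist \<Omega> x)"
  then have "0 < bdist \<Omega> y" using bdist_le_add[of x y] by (simp add: dist_norm)
  then show "y \<in> \<Omega>" by (simp add: bdist_pos_iff)
qed

lemma bdd_above_radii: "bdd_above {r. 0 < r \<and> (\<exists>x. ball x r \<subseteq> \<Omega>)}"
proof -
  obtain B where B: "B > 0" "\<And>y. y \<in> \<Omega> \<Longrightarrow> norm y \<le> B" using obtain_bound by blast
  have "r \<le> 2 * B" if r: "0 < r" "ball x r \<subseteq> \<Omega>" for x r
  proof -
    obtain e :: 'a where "e \<in> sphere 0 1" using sphere_nonempty by blast
    then have e: "norm e = 1" by simp
    have "x \<in> \<Omega>" using r by auto
    have "r \<le> support_fun \<Omega> e - x \<bullet> e" using bdist_ge_radius[OF r(2,1)] bdist_le[OF e, of x] by simp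
    moreover have "support_fun \<Omega> e \<le> B"
      by (rule support_fun_le) (use B inner_le_norm[OF e] in \<open>auto intro: order_trans\<close>)
    moreover have "- (x \<bullet> e) \<le> B"
      using inner_le_norm[OF e, of "- x"] B(2)[OF \<open>x \<in> \<Omega>\<close>] by simp
    ultimately show ?thesis by simp
  qed
  then show ?thesis by (intro bdd_aboveI[of _ "2 * B"]) auto
qed

lemma bdist_le_inradius:
  assumes "x \<in> \<Omega>"
  shows "bdist \<Omega> x \<le> inradius \<Omega>"
  unfolding inradius_def using ball_bdist_subset[of x] assms
  by (intro cSup_upper bdd_above_radii) (auto simp: bdist_pos_iff)

lemma inradius_pos: "0 < inradius \<Omega>"
proof -
  obtain x where x: "x \<in> \<Omega>" using nonempty by blast
  then show ?thesis using bdist_le_inradius[OF x] bdist_pos_iff[of x] by simp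
qed

lemma dom_lmeasurable: "\<Omega> \<in> lmeasurable"
  using open_dom bounded_dom by (rule lmeasurable_open[rotated])

lemma collar_lmeasurable: "{x \<in> \<Omega>. bdist \<Omega> x < s} \<in> lmeasurable"
proof -
  have "open {x. bdist \<Omega> x < s}"
    by (intro open_Collect_less continuous_bdist continuous_on_const)
  then have "open (\<Omega> \<inter> {x. bdist \<Omega> x < s})" using open_dom by blast
  moreover have "\<Omega> \<inter> {x. bdist \<Omega> x < s} = {x \<in> \<Omega>. bdist \<Omega> x < s}" by blast
  ultimately show ?thesis using bounded_dom by (intro lmeasurable_open) (auto intro: bounded_subset)
qed

lemma collar_nonneg: "0 \<le> collar \<Omega> s"
  by (simp add: collar_def)

lemma collar_mono: "s \<le> t \<Longrightarrow> collar \<Omega> s \<le> collar \<Omega> t"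
  unfolding collar_def using collar_lmeasurable by (intro measure_mono_fmeasurable) (auto dest: fmeasurableD)

lemma collar_le_dom: "collar \<Omega> s \<le> measure lebesgue \<Omega>"
  unfolding collar_def using collar_lmeasurable dom_lmeasurable
  by (intro measure_mono_fmeasurable) (auto dest: fmeasurableD)

lemma collar_eq_dom:
  assumes "inradius \<Omega> < s"
  shows "collar \<Omega> s = measure lebesgue \<Omega>"
proof -
  have "{x \<in> \<Omega>. bdist \<Omega> x < s} = \<Omega>" using bdist_le_inradius assms by force
  then show ?thesis by (simp add: collar_def)
qed

text \<open>Half the boundary distance of a point gives a ball that misses the collar of that width.
  The positive gap makes a nonconstant function win for large \<Lambda>.\<close>

lemma collar_less_dom:
  obtains r where "0 < r" "r \<le> inradius \<Omega>" "collar \<Omega> r < measure lebesgue \<Omega>"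
proof -
  obtain x where x: "x \<in> \<Omega>" using nonempty by blast
  define r where "r = bdist \<Omega> x / 2"
  have r: "0 < r" "r \<le> inradius \<Omega>" using x bdist_pos_iff[of x] bdist_le_inradius[OF x] by (auto simp: r_def)
  have sub: "ball x r \<subseteq> \<Omega> - {x \<in> \<Omega>. bdist \<Omega> x < r}"
  proof
    fix y assume "y \<in> ball x r"
    then have "r \<le> bdist \<Omega> y" using bdist_le_add[of x y] by (simp add: dist_norm r_def)
    then show "y \<in> \<Omega> - {x \<in> \<Omega>. bdist \<Omega> x < r}" using r(1) bdist_pos_iff[of y] by auto
  qed
  have "0 < measure lebesgue (ball x r)"
    using r(1) by (simp add: content_ball_pos)
  also have "\<dots> \<le> measure lebesgue (\<Omega> - {x \<in> \<Omega>. bdist \<Omega> x < r})"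
    using sub dom_lmeasurable collar_lmeasurable by (intro measure_mono_fmeasurable) (auto dest: fmeasurableD)
  also have "\<dots> = measure lebesgue \<Omega> - collar \<Omega> r"
    unfolding collar_def using dom_lmeasurable collar_lmeasurable
    by (intro measurable_measure_Diff) (auto dest: fmeasurableD)
  finally show ?thesis using r that by simp
qed

text \<open>The strict inequality in \<open>collar\<close> makes the sets increase to their union.
  For a nondecreasing function left continuity is lower semicontinuity, which is what attaining the
  minimum requires.\<close>

lemma collar_left_LIMSEQ:
  assumes "incseq s" "s \<longlonglongrightarrow> t" "\<And>n. s n < t"
  shows "(\<lambda>n. collar \<Omega> (s n)) \<longlonglongrightarrow> collar \<Omega> t"
proof -
  have "(\<lambda>n. measure lebesgue {x \<in> \<Omega>. bdist \<Omega> x < s n}) \<longlonglongrightarrow> measure lebesgue (\<Union>n. {x \<in> \<Omega>. bdist \<Omega> x < s n})"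
  proof (rule Lim_measure_incseq)
    show "range (\<lambda>n. {x \<in> \<Omega>. bdist \<Omega> x < s n}) \<subseteq> sets lebesgue"
      using collar_lmeasurable by (auto dest: fmeasurableD)
    show "incseq (\<lambda>n. {x \<in> \<Omega>. bdist \<Omega> x < s n})"
      using assms(1) unfolding incseq_def by (auto intro: less_le_trans)
    have "emeasure lebesgue (\<Union>n. {x \<in> \<Omega>. bdist \<Omega> x < s n}) \<le> emeasure lebesgue \<Omega>"
      using dom_lmeasurable by (intro emeasure_mono) (auto dest: fmeasurableD)
    also have "\<dots> < \<infinity>" using dom_lmeasurable by (auto simp: fmeasurable_def)
    finally show "emeasure lebesgue (\<Union>n. {x \<in> \<Omega>. bdist \<Omega> x < s n}) \<noteq> \<infinity>" by simp
  qed
  also have "(\<Union>n. {x \<in> \<Omega>. bdist \<Omega> x < s n}) = {x \<in> \<Omega>. bdist \<Omega> x < t}"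
  proof -
    have "\<exists>n. bdist \<Omega> x < s n" if "bdist \<Omega> x < t" for x
      using order_tendstoD(1)[OF assms(2) that] by (auto simp: eventually_sequentially)
    then show ?thesis using assms(3) by (auto intro: less_trans)
  qed
  finally show ?thesis by (simp add: collar_def)
qed

text \<open>Leaving the domain within distance \<open>s\<close>: move in the direction of an almost optimal half-space.\<close>

lemma exit_point:
  assumes "x \<in> \<Omega>" "bdist \<Omega> x < s"
  obtains y where "y \<in> frontier \<Omega>" "norm (y - x) \<le> s" 
proof -
  obtain e where e: "norm e = 1" "support_fun \<Omega> e - x \<bullet> e < s" using bdist_less[OF assms(2)] by blast
  have s: "0 < s" using assms bdist_pos_iff[of x] by simp
  have "x + s *\<^sub>R e \<notin> \<Omega>"
    using support_fun_ge[of "x + s *\<^sub>R e" e] e by (auto simp: inner_add_left dot_square_norm)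
  then have "closed_segment x (x + s *\<^sub>R e) \<inter> frontier \<Omega> \<noteq> {}"
    using assms(1) by (intro connected_Int_frontier) auto
  then obtain y where y: "y \<in> closed_segment x (x + s *\<^sub>R e)" "y \<in> frontier \<Omega>" by blast
  have "norm (y - x) \<le> norm (x + s *\<^sub>R e - x)" using segment_bound1[OF y(1)] by (simp add: norm_minus_commute)
  then show ?thesis using y e s that by simp
qed

end

section \<open>Lipschitz continuity from a gradient bound\<close>

lemma lebesgue_integral_abs_le:
  fixes f g :: "'a \<Rightarrow> real"
  assumes "integrable M f" "integrable M g" "AE x in M. \<bar>f x\<bar> \<le> g x"
  shows "\<bar>LINT x|M. f x\<bar> \<le> (LINT x|M. g x)"
proof -
  have "\<bar>LINT x|M. f x\<bar> \<le> (LINT x|M. \<bar>f x\<bar>)" by (rule integral_abs_bound)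
  also have "\<dots> \<le> (LINT x|M. g x)" using assms by (intro integral_mono_AE) auto
  finally show ?thesis .
qed

lemma small_bump:
  fixes r :: real
  assumes "r > 0"
  obtains \<phi> :: "'a::euclidean_space \<Rightarrow> real" where
    "test_function (ball 0 r) \<phi>" "\<And>x. 0 \<le> \<phi> x" "0 < (LINT x|lebesgue. \<phi> x)"
proof -
  obtain a b :: 'a where ab: "cbox a b \<subseteq> ball 0 r" "0 \<in> box a b"
    using open_contains_cbox[of "ball (0::'a) r" 0] assms by (metis centre_in_ball open_ball)
  define \<phi> where "\<phi> = box_bump a b (Suc 0)"
  have t: "test_function (ball 0 r) \<phi>" unfolding \<phi>_def by (rule test_function_box_bump[OF ab(1)])
  have nn: "0 \<le> \<phi> x" for x unfolding \<phi>_def by (rule box_bump_bounds)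
  have int: "integrable lebesgue \<phi>"
    using integrable_continuous_mult_test[OF continuous_on_const[of UNIV 1] t] by simp
  have "(LINT x|lebesgue. \<phi> x) \<noteq> 0"
  proof
    assume "(LINT x|lebesgue. \<phi> x) = 0"
    then have "AE x in lebesgue. \<phi> x = 0"
      using integral_nonneg_eq_0_iff_AE[OF int] nn by simp
    then have "AE x in lebesgue. x \<notin> box a b"
    proof eventually_elim
      case (elim x)
      then show ?case using box_bump_pos_iff[of a b 0 x] by (simp add: \<phi>_def)
    qed
    then have "box a b \<in> null_sets lebesgue"
      by (subst (asm) AE_iff_null_sets[symmetric]) auto
    then have "negligible (box a b)" by (simp add: negligible_iff_null_sets)
    then show False using ab(2) open_not_negligible[of "box a b"] by auto
  qed
  moreover have "0 \<le> (LINT x|lebesgue. \<phi> x)" using nn by simp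
  ultimately have "0 < (LINT x|lebesgue. \<phi> x)" by linarith
  with t nn show ?thesis by (rule that)
qed

text \<open>Moving the bump \<open>\<phi>\<close> along the segment changes \<open>\<integral> u \<phi>\<close> at a rate
  controlled by the gradient bound; concentrating \<open>\<phi>\<close> recovers \<open>u\<close>.\<close>

lemma weak_gradient_bound_imp_lipschitz:
  fixes u :: "'a::euclidean_space \<Rightarrow> real"
  assumes \<Omega>: "open \<Omega>" "convex \<Omega>" and u: "continuous_on \<Omega> u" and G: "has_weak_gradient \<Omega> u G"
    and L: "AE x in lebesgue_on \<Omega>. norm (G x) \<le> L" and xy: "x \<in> \<Omega>" "y \<in> \<Omega>"
  shows "\<bar>u y - u x\<bar> \<le> L * norm (y - x)"
proof (rule field_le_epsilon)
  fix \<epsilon> :: real assume "\<epsilon> > 0"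
  define e where "e = y - x"
  have "closed_segment x y \<subseteq> \<Omega>" using \<Omega>(2) xy by (simp add: closed_segment_subset)
  then obtain r0 where r0: "r0 > 0" "(\<Union>z\<in>closed_segment x y. ball z r0) \<subseteq> \<Omega>"
    using compact_subset_open_imp_ball_epsilon_subset[OF compact_segment \<Omega>(1)] by blast
  have "\<exists>d>0. \<forall>z'\<in>\<Omega>. dist z' z < d \<longrightarrow> dist (u z') (u z) < \<epsilon> / 2" if "z \<in> \<Omega>" for z
    using u \<open>\<epsilon> > 0\<close> that unfolding continuous_on_iff by (meson half_gt_zero)
  then obtain d where d: "\<And>z. z \<in> \<Omega> \<Longrightarrow> d z > 0"
    "\<And>z z'. z \<in> \<Omega> \<Longrightarrow> z' \<in> \<Omega> \<Longrightarrow> dist z' z < d z \<Longrightarrow> dist (u z') (u z) < \<epsilon> / 2"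
    by metis
  \<comment> \<open>Half of \<open>r0\<close> keeps closed balls along the segment inside \<Omega>;
    \<open>d x\<close> and \<open>d y\<close> make \<open>u\<close> almost constant near the two
    endpoints, the only places where this matters.\<close>
  define r where "r = min (r0 / 2) (min (d x) (d y))"
  have r: "r > 0" "r \<le> r0 / 2" "r \<le> d x" "r \<le> d y" using r0 d(1) xy by (auto simp: r_def)
  obtain \<phi> :: "'a \<Rightarrow> real" where \<phi>: "test_function (ball 0 r) \<phi>" "\<And>x. 0 \<le> \<phi> x" "0 < (LINT x|lebesgue. \<phi> x)"
    using small_bump[OF r(1)] by blast
  define c where "c = (LINT x|lebesgue. \<phi> x)"
  have int\<phi>: "integrable lebesgue \<phi>"
    using integrable_continuous_mult_test[OF continuous_on_const[of UNIV 1] \<phi>(1)] by simp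
  have m\<phi>: "\<phi> \<in> borel_measurable borel"
    by (rule borel_measurable_continuous_onI[OF test_function_continuous[OF \<phi>(1)]])
  define \<psi> where "\<psi> t z = \<phi> (z + - (x + t *\<^sub>R e))" for t z
  have \<psi>_int: "(LINT z|lebesgue. \<psi> t z) = c" "integrable lebesgue (\<psi> t)" for t
    using lebesgue_integral_translate[OF m\<phi>, of "- (x + t *\<^sub>R e)"] int\<phi> by (simp_all add: \<psi>_def[abs_def] c_def)
  have \<psi>_nn: "0 \<le> \<psi> t z" for t z using \<phi>(2) by (simp add: \<psi>_def)
  have \<psi>_test: "test_function (ball (x + t *\<^sub>R e) r) (\<psi> t)" for t
    unfolding \<psi>_def using \<phi>(1)
    by (intro test_function_translate[OF \<phi>(1)]) (auto simp: test_function_def dist_norm)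
  define S where "S = (\<Union>z\<in>closed_segment x y. cball z r)"
  have S: "compact S" "S \<subseteq> \<Omega>"
  proof -
    have "S = {z + w | z w. z \<in> closed_segment x y \<and> w \<in> cball 0 r}"
    proof (intro set_eqI iffI)
      fix v assume "v \<in> S"
      then obtain z where "z \<in> closed_segment x y" "dist z v \<le> r" by (auto simp: S_def)
      then have "v = z + (v - z) \<and> z \<in> closed_segment x y \<and> v - z \<in> cball 0 r"
        by (simp add: dist_norm norm_minus_commute)
      then show "v \<in> {z + w | z w. z \<in> closed_segment x y \<and> w \<in> cball 0 r}" by blast
    next
      fix v assume "v \<in> {z + w | z w. z \<in> closed_segment x y \<and> w \<in> cball 0 r}"
      then obtain z w where "v = z + w" "z \<in> closed_segment x y" "norm w \<le> r" by auto
      then show "v \<in> S" by (auto simp: S_def dist_norm intro!: bexI[of _ z])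
    qed
    then show "compact S" using compact_sums[OF compact_segment compact_cball, of x y 0 r] by simp
    show "S \<subseteq> \<Omega>"
    proof
      fix z assume "z \<in> S"
      then obtain w where w: "w \<in> closed_segment x y" "dist w z \<le> r" by (auto simp: S_def)
      then have "z \<in> ball w r0" using r r0(1) by simp
      then show "z \<in> \<Omega>" using w(1) r0(2) by blast
    qed
  qed
  have inS: "ball (x + t *\<^sub>R e) r \<subseteq> S" if "0 \<le> t" "t \<le> 1" for t
  proof -
    have "x + t *\<^sub>R e \<in> closed_segment x y"
      using that by (auto simp: closed_segment_def e_def algebra_simps intro!: exI[of _ t])
    then show ?thesis by (force simp: S_def)
  qed
  have u_loc: "locally_integrable \<Omega> u" and G_loc: "locally_integrable \<Omega> G"
    using G unfolding has_weak_gradient_def by blast+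
  \<comment> \<open>Cutting off to the compact tube \<open>S\<close> makes the integrand globally
    integrable without affecting the integrals for \<open>t\<close> in [0,1], whose bumps live in
    \<open>S\<close>.\<close>
  define w where "w z = indicator S z * u z" for z
  have w: "integrable lebesgue w"
    using u_loc S by (auto simp: locally_integrable_def set_integrable_def w_def[abs_def])
  define F where "F t = (LINT z|lebesgue. w z * \<psi> t z)" for t
  have w\<psi>: "integrable lebesgue (\<lambda>z. w z * \<psi> t z)" for t
  proof -
    obtain B where B: "B \<ge> 0" "\<And>z. \<bar>\<psi> t z\<bar> \<le> B" using test_function_bounded[OF \<psi>_test] by blast
    show ?thesis
    proof (rule Bochner_Integration.integrable_bound[where f = "\<lambda>z. B * w z"])
      show "(\<lambda>z. w z * \<psi> t z) \<in> borel_measurable lebesgue"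
        using borel_measurable_integrable[OF w] borel_measurable_integrable[OF \<psi>_int(2)] by (rule borel_measurable_times)
      show "AE z in lebesgue. norm (w z * \<psi> t z) \<le> norm (B * w z)"
        using B by (intro AE_I2) (simp add: abs_mult mult.commute[of B] mult_left_mono)
    qed (use w in simp)
  qed
  have DF: "(F has_real_derivative - (LINT z|lebesgue. w z * pd (\<psi> t) z e)) (at t)" for t
    unfolding DERIV_def tendsto_at_iff_sequentially
  proof (intro allI impI)
    fix h :: "nat \<Rightarrow> real" assume h: "\<forall>i. h i \<in> UNIV - {0}" "h \<longlonglongrightarrow> 0"
    \<comment> \<open>Moving the centre of the bump by \<open>h n\<close> along \<open>e\<close>
      shifts its argument by the opposite vector, hence the direction \<open>- e\<close>.\<close>
    have "(\<lambda>n. LINT z|lebesgue. w z * ((\<psi> t (z + h n *\<^sub>R (- e)) - \<psi> t z) / h n))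
      \<longlonglongrightarrow> (LINT z|lebesgue. w z * pd (\<psi> t) z (- e))"
      using h by (intro test_difference_quotient_integral[OF w \<psi>_test]) auto
    also have "(\<lambda>n. LINT z|lebesgue. w z * ((\<psi> t (z + h n *\<^sub>R (- e)) - \<psi> t z) / h n)) =
      (\<lambda>n. (F (t + h n) - F t) / h n)"
    proof
      fix n
      have "\<psi> t (z + h n *\<^sub>R (- e)) = \<psi> (t + h n) z" for z
        by (simp add: \<psi>_def algebra_simps)
      then have "(LINT z|lebesgue. w z * ((\<psi> t (z + h n *\<^sub>R (- e)) - \<psi> t z) / h n)) =
          (LINT z|lebesgue. (w z * \<psi> (t + h n) z - w z * \<psi> t z) / h n)"
        by (simp add: algebra_simps)
      also have "\<dots> = (F (t + h n) - F t) / h n"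
        unfolding F_def using w\<psi> by simp
      finally show "(LINT z|lebesgue. w z * ((\<psi> t (z + h n *\<^sub>R (- e)) - \<psi> t z) / h n)) = (F (t + h n) - F t) / h n" .
    qed
    also have "(LINT z|lebesgue. w z * pd (\<psi> t) z (- e)) =
        - (LINT z|lebesgue. w z * pd (\<psi> t) z e)"
    proof -
      have "pd (\<psi> t) z (- e) = - pd (\<psi> t) z e" for z
        using has_derivative_linear[OF test_function_has_derivative[OF \<psi>_test]] linear_neg by blast
      then show ?thesis by simp
    qed
    finally show "((\<lambda>y. (F (t + y) - F t) / y) \<circ> h) \<longlonglongrightarrow> - (LINT z|lebesgue. w z * pd (\<psi> t) z e)"
      by (simp add: o_def)
  qed
  have bound: "\<bar>LINT z|lebesgue. w z * pd (\<psi> t) z e\<bar> \<le> L * norm e * c"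
    if t: "0 \<le> t" "t \<le> 1" for t
  proof -
    have tS: "test_function S (\<psi> t)" using \<psi>_test inS[OF t] test_function_mono by blast
    then have t\<Omega>: "test_function \<Omega> (\<psi> t)" using S(2) test_function_mono by blast
    have "(\<lambda>z. w z * pd (\<psi> t) z e) = (\<lambda>z. u z * pd (\<psi> t) z e)"
    proof
      fix z show "w z * pd (\<psi> t) z e = u z * pd (\<psi> t) z e"
        using test_derivative_outside[OF tS, of z] by (cases "z \<in> S") (auto simp: w_def)
    qed
    then have "(LINT z|lebesgue. w z * pd (\<psi> t) z e) = - (LINT z|lebesgue. (G z \<bullet> e) * \<psi> t z)"
      using has_weak_gradientD[OF \<Omega>(1) G t\<Omega>, of e] by simp
    moreover have "\<bar>LINT z|lebesgue. (G z \<bullet> e) * \<psi> t z\<bar> \<le> (LINT z|lebesgue. L * norm e * \<psi> t z)"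
    proof (rule lebesgue_integral_abs_le)
      show "integrable lebesgue (\<lambda>z. G z \<bullet> e * \<psi> t z)"
        by (rule locally_integrable_mult_test_real[OF locally_integrable_inner[OF G_loc] t\<Omega>])
      show "integrable lebesgue (\<lambda>z. L * norm e * \<psi> t z)" using \<psi>_int by simp
      have "AE z in lebesgue. z \<in> \<Omega> \<longrightarrow> norm (G z) \<le> L"
        using L \<Omega>(1) by (subst (asm) AE_restrict_space_iff) auto
      then show "AE z in lebesgue. \<bar>G z \<bullet> e * \<psi> t z\<bar> \<le> L * norm e * \<psi> t z"
      proof eventually_elim
        case (elim z)
        show ?case
        proof (cases "z \<in> \<Omega>")
          case True
          have "\<bar>G z \<bullet> e\<bar> \<le> L * norm e"
            using Cauchy_Schwarz_ineq2[of "G z" e] elim True mult_right_mono[of "norm (G z)" L "norm e"] by auto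
          then show ?thesis using \<psi>_nn[of t z] by (simp add: abs_mult mult_right_mono)
        qed (simp add: test_function_eq_0[OF t\<Omega>])
      qed
    qed
    ultimately show ?thesis using \<psi>_int by simp
  qed
  have "\<exists>z. 0 < z \<and> z < 1 \<and> F 1 - F 0 = (1 - 0) * - (LINT v|lebesgue. w v * pd (\<psi> z) v e)"
    by (rule MVT2) (auto intro: DF)
  then obtain t where "0 < t" "t < 1" "F 1 - F 0 = - (LINT v|lebesgue. w v * pd (\<psi> t) v e)"
    by auto
  then have F10: "\<bar>F 1 - F 0\<bar> \<le> L * norm e * c" using bound[of t] by simp
  have near: "\<bar>F t - u (x + t *\<^sub>R e) * c\<bar> \<le> \<epsilon> / 2 * c"
    if t: "0 \<le> t" "t \<le> 1" and p: "x + t *\<^sub>R e \<in> \<Omega>" "r \<le> d (x + t *\<^sub>R e)" for t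
  proof -
    have "F t - u (x + t *\<^sub>R e) * c = (LINT z|lebesgue. (w z - u (x + t *\<^sub>R e)) * \<psi> t z)"
      unfolding F_def left_diff_distrib using w\<psi> \<psi>_int by simp
    also have "\<bar>\<dots>\<bar> \<le> (LINT z|lebesgue. \<epsilon> / 2 * \<psi> t z)"
    proof (rule lebesgue_integral_abs_le)
      show "integrable lebesgue (\<lambda>z. (w z - u (x + t *\<^sub>R e)) * \<psi> t z)"
        unfolding left_diff_distrib using w\<psi> \<psi>_int by simp
      show "integrable lebesgue (\<lambda>z. \<epsilon> / 2 * \<psi> t z)" using \<psi>_int by simp
      show "AE z in lebesgue. \<bar>(w z - u (x + t *\<^sub>R e)) * \<psi> t z\<bar> \<le> \<epsilon> / 2 * \<psi> t z"
      proof (rule AE_I2)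
        fix z
        show "\<bar>(w z - u (x + t *\<^sub>R e)) * \<psi> t z\<bar> \<le> \<epsilon> / 2 * \<psi> t z"
        proof (cases "z \<in> ball (x + t *\<^sub>R e) r")
          case True
          then have "z \<in> S" using inS[OF t] by blast
          then have "dist (u z) (u (x + t *\<^sub>R e)) < \<epsilon> / 2"
            using True S(2) p by (intro d(2)) (auto simp: dist_commute)
          then have "\<bar>w z - u (x + t *\<^sub>R e)\<bar> \<le> \<epsilon> / 2" using \<open>z \<in> S\<close> by (simp add: w_def dist_real_def)
          then have "\<bar>w z - u (x + t *\<^sub>R e)\<bar> * \<psi> t z \<le> \<epsilon> / 2 * \<psi> t z" by (rule mult_right_mono[OF _ \<psi>_nn])
          then show ?thesis using \<psi>_nn[of t z] by (simp add: abs_mult)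
        qed (simp add: test_function_eq_0[OF \<psi>_test])
      qed
    qed
    finally show ?thesis using \<psi>_int by simp
  qed
  have "\<bar>F 0 - u x * c\<bar> \<le> \<epsilon> / 2 * c" using near[of 0] xy r by simp
  moreover have "\<bar>F 1 - u y * c\<bar> \<le> \<epsilon> / 2 * c" using near[of 1] xy r by (simp add: e_def)
  ultimately have "\<bar>u y * c - u x * c\<bar> \<le> L * norm e * c + \<epsilon> * c" using F10 by linarith
  then have "\<bar>u y - u x\<bar> * c \<le> (L * norm e + \<epsilon>) * c"
    using \<phi>(3) by (simp add: c_def[symmetric] left_diff_distrib[symmetric] distrib_right abs_mult)
  then show "\<bar>u y - u x\<bar> \<le> L * norm (y - x) + \<epsilon>"
    using \<phi>(3) by (simp add: c_def[symmetric] e_def)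
qed

section \<open>Competitors for the limit problem\<close>

text \<open>\<open>weak_gradient\<close> is an arbitrary choice, known only almost everywhere;
  completeness of Lebesgue measure is what transfers measurability to it.\<close>

lemma measurable_lebesgue_on_AE_cong:
  fixes G H :: "'a::euclidean_space \<Rightarrow> 'b::euclidean_space"
  assumes S: "S \<in> sets lebesgue" and G: "G \<in> borel_measurable (lebesgue_on S)"
    and eq: "AE x in lebesgue_on S. H x = G x"
  shows "H \<in> borel_measurable (lebesgue_on S)"
proof -
  have "(\<lambda>x. indicator S x *\<^sub>R G x) \<in> borel_measurable lebesgue"
    using G S by (simp add: borel_measurable_restrict_space_iff)
  moreover have "AE x in lebesgue. x \<in> S \<longrightarrow> H x = G x"
    using eq S by (subst (asm) AE_restrict_space_iff) auto
  then have "AE x in lebesgue. indicator S x *\<^sub>R G x = indicator S x *\<^sub>R H x"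
    by eventually_elim (auto simp: indicator_def)
  ultimately have "(\<lambda>x. indicator S x *\<^sub>R H x) \<in> borel_measurable lebesgue"
    by (rule borel_measurable_AE)
  then show ?thesis using S by (simp add: borel_measurable_restrict_space_iff)
qed

lemma weak_gradient_Linf:
  assumes \<Omega>: "open \<Omega>" and G: "G \<in> Linf \<Omega>" "has_weak_gradient \<Omega> u G"
  shows "weak_gradient \<Omega> u \<in> borel_measurable (lebesgue_on \<Omega>)"
    and "esssup (lebesgue_on \<Omega>) (\<lambda>x. ereal (norm (weak_gradient \<Omega> u x))) =
         esssup (lebesgue_on \<Omega>) (\<lambda>x. ereal (norm (G x)))"
proof -
  have eq: "AE x in lebesgue_on \<Omega>. weak_gradient \<Omega> u x = G x"
    by (rule weak_gradient_AE[OF \<Omega> G(2)])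
  have mG: "G \<in> borel_measurable (lebesgue_on \<Omega>)" using G(1) by (simp add: Linf_def)
  show m: "weak_gradient \<Omega> u \<in> borel_measurable (lebesgue_on \<Omega>)"
    by (rule measurable_lebesgue_on_AE_cong[OF _ mG eq]) (use \<Omega> in auto)
  show "esssup (lebesgue_on \<Omega>) (\<lambda>x. ereal (norm (weak_gradient \<Omega> u x))) =
         esssup (lebesgue_on \<Omega>) (\<lambda>x. ereal (norm (G x)))"
  proof (rule esssup_AE_cong)
    show "AE x in lebesgue_on \<Omega>. ereal (norm (weak_gradient \<Omega> u x)) = ereal (norm (G x))"
      using eq by eventually_elim simp
  qed (use m mG in measurable)
qed

text \<open>Over a null set the essential supremum would be -\<infinity>. Positive measure and
  finiteness together make it a real number, so \<open>real_of_ereal\<close> loses no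
  information.\<close>

lemma Linf_norm_bound:
  assumes S: "S \<in> sets lebesgue" "emeasure lebesgue S \<noteq> 0"
    and m: "G \<in> borel_measurable (lebesgue_on S)"
    and fin: "esssup (lebesgue_on S) (\<lambda>x. ereal (norm (G x))) < \<infinity>"
  shows "0 \<le> Linf_norm S G" and "AE x in lebesgue_on S. norm (G x) \<le> Linf_norm S G"
proof -
  let ?E = "esssup (lebesgue_on S) (\<lambda>x. ereal (norm (G x)))"
  have "emeasure (lebesgue_on S) (space (lebesgue_on S)) \<noteq> 0"
    using S by (simp add: emeasure_restrict_space)
  then have "(0::ereal) = esssup (lebesgue_on S) (\<lambda>x. 0)" by (simp add: esssup_const)
  also have "\<dots> \<le> ?E" by (rule esssup_mono) auto
  finally have "0 \<le> ?E" .
  with fin have E: "?E = ereal (Linf_norm S G)" unfolding Linf_norm_def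
    by (cases ?E) auto
  show "0 \<le> Linf_norm S G" using \<open>0 \<le> ?E\<close> E by simp
  show "AE x in lebesgue_on S. norm (G x) \<le> Linf_norm S G"
    using esssup_AE[of "\<lambda>x. ereal (norm (G x))" "lebesgue_on S"] unfolding E by simp
qed

lemma Linf_norm_le:
  assumes m: "G \<in> borel_measurable (lebesgue_on S)" and "0 \<le> L"
    and "AE x in lebesgue_on S. norm (G x) \<le> L"
  shows "Linf_norm S G \<le> L"
proof -
  have "esssup (lebesgue_on S) (\<lambda>x. ereal (norm (G x))) \<le> ereal L"
    using assms by (intro esssup_I) auto
  \<comment> \<open>If the essential supremum is -\<infinity>, its real value is 0, whence the use
    of \<open>0 \<le> L\<close>.\<close>
  then show ?thesis unfolding Linf_norm_def using assms(2)
    by (cases "esssup (lebesgue_on S) (\<lambda>x. ereal (norm (G x)))") auto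
qed

context convex_domain
begin

lemma dom_not_null: "emeasure lebesgue \<Omega> \<noteq> 0"
proof
  assume "emeasure lebesgue \<Omega> = 0"
  then have "negligible \<Omega>" using open_dom by (simp add: negligible_iff_null_sets null_sets_def)
  then show False using open_dom nonempty open_not_negligible by blast
qed

lemma measure_dom_pos: "0 < measure lebesgue \<Omega>"
  using dom_not_null dom_lmeasurable by (simp add: zero_less_measure_iff emeasure_eq_measure2)

text \<open>The Lipschitz bound is extended by continuity to the closure in one variable, so that an
  interior point can be compared with the frontier, where \<open>u\<close> is 1.\<close>

lemma Lip1_gradient_bound:
  assumes u: "u \<in> Lip1 \<Omega>"
  defines "L \<equiv> Linf_norm \<Omega> (weak_gradient \<Omega> u)"
  shows "0 \<le> L" and "x \<in> \<Omega> \<Longrightarrow> y \<in> closure \<Omega> \<Longrightarrow> \<bar>u y - u x\<bar> \<le> L * norm (y - x)"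
proof -
  obtain G where G: "G \<in> Linf \<Omega>" "has_weak_gradient \<Omega> u G" and cont: "continuous_on (closure \<Omega>) u"
    using u by (auto simp: Lip1_def W1inf_def)
  have m: "weak_gradient \<Omega> u \<in> borel_measurable (lebesgue_on \<Omega>)"
    and f: "esssup (lebesgue_on \<Omega>) (\<lambda>x. ereal (norm (weak_gradient \<Omega> u x))) < \<infinity>"
    using weak_gradient_Linf[OF open_dom G] G(1) by (auto simp: Linf_def)
  have b: "0 \<le> L" "AE x in lebesgue_on \<Omega>. norm (weak_gradient \<Omega> u x) \<le> L"
    unfolding L_def using Linf_norm_bound[OF _ dom_not_null m f] open_dom by auto
  show "0 \<le> L" by (rule b)
  have lip: "\<bar>u y - u x\<bar> \<le> L * norm (y - x)" if "x \<in> \<Omega>" "y \<in> \<Omega>" for x y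
    using continuous_on_subset[OF cont closure_subset]
    by (rule weak_gradient_bound_imp_lipschitz[OF open_dom convex_dom _ has_weak_gradient_weak_gradient[OF G(2)] b(2) that])
  show "\<bar>u y - u x\<bar> \<le> L * norm (y - x)" if x: "x \<in> \<Omega>" and y: "y \<in> closure \<Omega>"
  proof -
    have "\<bar>u y - u x\<bar> - L * norm (y - x) \<le> 0"
      by (rule continuous_le_on_closure[of \<Omega> "\<lambda>y. \<bar>u y - u x\<bar> - L * norm (y - x)"])
        (use cont y lip[OF x] in \<open>auto intro!: continuous_intros\<close>)
    then show ?thesis by simp
  qed
qed

lemma positivity_set_lmeasurable:
  fixes u :: "'a \<Rightarrow> real"
  assumes "continuous_on (closure \<Omega>) u"
  shows "{x \<in> \<Omega>. 0 < u x} \<in> lmeasurable"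
proof -
  have "open (\<Omega> \<inter> u -` {0<..})"
    using continuous_on_subset[OF assms closure_subset] open_dom by (intro continuous_open_preimage) auto
  moreover have "\<Omega> \<inter> u -` {0<..} = {x \<in> \<Omega>. 0 < u x}" by auto
  ultimately show ?thesis using bounded_dom by (intro lmeasurable_open) (auto intro: bounded_subset)
qed

text \<open>Walking from a collar point to the frontier covers less than \<open>t\<close>, so
  \<open>u\<close> falls short of its boundary value 1 by less than 1.\<close>

lemma collar_le_positivity:
  assumes u: "u \<in> Lip1 \<Omega>" and t: "0 < t" "Linf_norm \<Omega> (weak_gradient \<Omega> u) * t \<le> 1"
  shows "collar \<Omega> t \<le> measure lebesgue {x \<in> \<Omega>. 0 < u x}"
proof -
  define L where "L = Linf_norm \<Omega> (weak_gradient \<Omega> u)"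
  have L: "0 \<le> L" "L * t \<le> 1" using Lip1_gradient_bound(1)[OF u] t by (auto simp: L_def)
  have "0 < u x" if x: "x \<in> \<Omega>" "bdist \<Omega> x < t" for x
  proof -
    \<comment> \<open>\<open>exit_point\<close> bounds the distance only by \<open>\<le> s\<close>;
      the room between \<open>s\<close> and \<open>t\<close> restores strictness when
      \<open>L * t = 1\<close>.\<close>
    obtain s where s: "bdist \<Omega> x < s" "s < t" using dense x(2) by blast
    obtain y where y: "y \<in> frontier \<Omega>" "norm (y - x) \<le> s" using exit_point[OF x(1) s(1)] by blast
    have "0 < s" using s(1) x(1) bdist_pos_iff[of x] by simp
    have "\<bar>u y - u x\<bar> \<le> L * norm (y - x)"
      unfolding L_def using Lip1_gradient_bound(2)[OF u x(1)] y(1) by (auto simp: frontier_def)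
    also have "\<dots> \<le> L * s" using y(2) L(1) by (rule mult_left_mono)
    also have "\<dots> < 1"
    proof (cases "L = 0")
      case False
      then have "L * s < L * t" using L(1) s(2) by simp
      then show ?thesis using L(2) by simp
    qed simp
    finally show ?thesis using u y(1) by (auto simp: Lip1_def)
  qed
  then show ?thesis
    unfolding collar_def using u positivity_set_lmeasurable[of u] collar_lmeasurable
    by (intro measure_mono_fmeasurable) (auto simp: Lip1_def dest: fmeasurableD)
qed

text \<open>Two regimes: a slope below 1 / R cannot reach zero anywhere in \<Omega>, so the whole
  volume is paid; from 1 / R on, at least the collar is paid.\<close>

lemma J_ge_collar:
  assumes u: "u \<in> Lip1 \<Omega>" and "0 \<le> \<Lambda>"
  defines "L \<equiv> Linf_norm \<Omega> (weak_gradient \<Omega> u)"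
  shows "L < 1 / inradius \<Omega> \<Longrightarrow> L + \<Lambda> * measure lebesgue \<Omega> \<le> J \<Omega> \<Lambda> u"
    and "1 / inradius \<Omega> \<le> L \<Longrightarrow> L + \<Lambda> * collar \<Omega> (1 / L) \<le> J \<Omega> \<Lambda> u"
proof -
  have L: "0 \<le> L" unfolding L_def by (rule Lip1_gradient_bound(1)[OF u])
  show "L + \<Lambda> * measure lebesgue \<Omega> \<le> J \<Omega> \<Lambda> u" if "L < 1 / inradius \<Omega>"
  proof -
    \<comment> \<open>For \<open>L = 0\<close> the quotient \<open>1 / L\<close> is 0 in HOL; any
      width beyond the inradius serves instead.\<close>
    define t where "t = (if L = 0 then inradius \<Omega> + 1 else 1 / L)"
    have t: "0 < t" "L * t \<le> 1" "inradius \<Omega> < t"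
      using L that inradius_pos by (auto simp: t_def field_simps)
    then have "measure lebesgue \<Omega> \<le> measure lebesgue {x \<in> \<Omega>. 0 < u x}"
      using collar_le_positivity[OF u t(1)] collar_eq_dom[OF t(3)] by (simp add: L_def)
    then show ?thesis unfolding J_def L_def using assms(2) by (simp add: mult_left_mono)
  qed
  show "L + \<Lambda> * collar \<Omega> (1 / L) \<le> J \<Omega> \<Lambda> u" if "1 / inradius \<Omega> \<le> L"
  proof -
    have "0 < 1 / inradius \<Omega>" using inradius_pos by simp
    then have "0 < L" using that by linarith
    then have "collar \<Omega> (1 / L) \<le> measure lebesgue {x \<in> \<Omega>. 0 < u x}"
      using collar_le_positivity[OF u, of "1 / L"] by (simp add: L_def)
    then show ?thesis unfolding J_def L_def using assms(2) by (simp add: mult_left_mono)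
  qed
qed

end

text \<open>Convexity makes one-sided difference quotients monotone, so one-sided derivatives exist
  everywhere in every direction. Those along the basis form the weak gradient. The sharp bound
  \<open>L\<close> on its Euclidean norm needs all directions: for each fixed \<open>e\<close> the
  function \<open>dd e\<close> agrees with \<open>G x \<bullet> e\<close> almost everywhere, since
  both arise from integrating \<open>U\<close> by parts along \<open>e\<close>.\<close>

lemma convex_lipschitz_has_weak_gradient:
  fixes U :: "'a::euclidean_space \<Rightarrow> real"
  assumes \<Omega>: "open \<Omega>" and conv: "convex_on UNIV U"
    and lip: "\<And>x y. \<bar>U x - U y\<bar> \<le> L * norm (x - y)" and L: "0 \<le> L"
  obtains G where "has_weak_gradient \<Omega> U G" "G \<in> borel_measurable lebesgue"
    "AE x in lebesgue_on \<Omega>. norm (G x) \<le> L"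
proof -
  define h where "h n = inverse (real (Suc n))" for n
  define q where "q e x n = (U (x + h n *\<^sub>R e) - U x) / h n" for e x n
  define dd where "dd e x = lim (q e x)" for e x
  have h: "h n > 0" for n by (simp add: h_def)
  have q_bound: "\<bar>q e x n\<bar> \<le> L * norm e" for e x n
    using lip[of "x + h n *\<^sub>R e" x] h[of n] by (simp add: q_def field_simps)
  have "decseq (q e x)" for e x
  proof (rule decseq_SucI)
    fix n
    define \<theta> where "\<theta> = h (Suc n) / h n"
    have \<theta>: "0 < \<theta>" "\<theta> \<le> 1" "h (Suc n) = \<theta> * h n" by (auto simp: \<theta>_def h_def field_simps)
    have "U ((1 - \<theta>) *\<^sub>R x + \<theta> *\<^sub>R (x + h n *\<^sub>R e)) \<le> (1 - \<theta>) * U x + \<theta> * U (x + h n *\<^sub>R e)"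
      using \<theta> by (intro convex_onD[OF conv]) auto
    moreover have "(1 - \<theta>) *\<^sub>R x + \<theta> *\<^sub>R (x + h n *\<^sub>R e) = x + h (Suc n) *\<^sub>R e"
      unfolding \<theta>(3) by (simp add: algebra_simps)
    ultimately have "U (x + h (Suc n) *\<^sub>R e) \<le> (1 - \<theta>) * U x + \<theta> * U (x + h n *\<^sub>R e)" by simp
    then have "U (x + h (Suc n) *\<^sub>R e) - U x \<le> \<theta> * (U (x + h n *\<^sub>R e) - U x)"
      by (simp add: algebra_simps)
    then have "(U (x + h (Suc n) *\<^sub>R e) - U x) / h (Suc n) \<le> \<theta> * (U (x + h n *\<^sub>R e) - U x) / h (Suc n)"
      using h by (intro divide_right_mono) (auto simp: less_imp_le)
    then show "q e x (Suc n) \<le> q e x n" using \<theta> h[of n] by (simp add: q_def)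
  qed
  then have "convergent (q e x)" for e x
    using q_bound by (intro Bseq_monoseq_convergent BseqI'[of _ "L * norm e"]) (auto simp: monoseq_iff)
  then have q_lim: "q e x \<longlonglongrightarrow> dd e x" for e x unfolding dd_def by (simp add: convergent_LIMSEQ_iff)
  have dd_bound: "\<bar>dd e x\<bar> \<le> L * norm e" for e x
    by (rule LIMSEQ_le_const2[OF tendsto_rabs[OF q_lim]]) (use q_bound in auto)
  have contU: "continuous_on A U" for A using lipschitz_imp_continuous[OF lip] .
  have dd_meas: "dd e \<in> borel_measurable lebesgue" for e
  proof (rule borel_measurable_LIMSEQ_real[OF q_lim])
    show "(\<lambda>x. q e x n) \<in> borel_measurable lebesgue" for n
      unfolding q_def using h[of n]
      by (intro continuous_lebesgue_measurable continuous_intros continuous_on_compose2[OF contU[of UNIV]]) auto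
  qed
  define G where "G x = (\<Sum>b\<in>Basis. dd b x *\<^sub>R b)" for x
  have G_inner: "G x \<bullet> b = dd b x" if "b \<in> Basis" for x b
    using that by (simp add: G_def inner_sum_left inner_Basis if_distrib sum.delta cong: if_cong)
  have G_meas: "G \<in> borel_measurable lebesgue"
    unfolding G_def using dd_meas by (intro borel_measurable_sum borel_measurable_scaleR) auto
  \<comment> \<open>This crude bound serves local integrability only.\<close>
  have G_bound: "norm (G x) \<le> (\<Sum>b\<in>(Basis::'a set). L)" for x
    unfolding G_def
  proof (rule order_trans[OF norm_sum sum_mono])
    fix b :: 'a assume "b \<in> Basis"
    then show "norm (dd b x *\<^sub>R b) \<le> L" using dd_bound[of b x] by simp
  qed
  have G_loc: "locally_integrable \<Omega> G" by (rule bounded_imp_locally_integrable[OF G_meas G_bound])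
  have dd_loc: "locally_integrable \<Omega> (dd e)" for e
    by (rule bounded_imp_locally_integrable[OF dd_meas]) (use dd_bound in simp)
  have wg: "has_weak_gradient \<Omega> U G"
    by (rule has_weak_gradient_lipschitz[OF \<Omega> lip _ G_loc])
      (use q_lim in \<open>simp add: G_inner q_def[abs_def] h_def\<close>)
  have AE_dd: "AE x in lebesgue_on \<Omega>. G x \<bullet> e \<le> L * norm e" for e
  proof -
    have l: "locally_integrable \<Omega> (\<lambda>x. G x \<bullet> e)" by (rule locally_integrable_inner[OF G_loc])
    have "AE x in lebesgue_on \<Omega>. G x \<bullet> e - dd e x = 0"
    proof (rule fundamental_lemma[OF \<Omega> locally_integrable_diff[OF l dd_loc]])
      fix \<phi> assume \<phi>: "test_function \<Omega> \<phi>"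
      have "(LINT x|lebesgue. U x * pd \<phi> x e) = - (LINT x|lebesgue. dd e x * \<phi> x)"
        by (rule lipschitz_integration_by_parts[OF lip _ \<phi>]) (use q_lim in \<open>simp add: q_def[abs_def] h_def\<close>)
      then have "(LINT x|lebesgue. G x \<bullet> e * \<phi> x) = (LINT x|lebesgue. dd e x * \<phi> x)"
        using has_weak_gradientD[OF \<Omega> wg \<phi>, of e] by simp
      then show "(LINT x|lebesgue. (G x \<bullet> e - dd e x) * \<phi> x) = 0"
        using Bochner_Integration.integral_diff[OF locally_integrable_mult_test_real[OF l \<phi>]
            locally_integrable_mult_test_real[OF dd_loc[of e] \<phi>]]
        by (simp add: left_diff_distrib)
    qed
    then show ?thesis
    proof eventually_elim
      case (elim x)
      then show ?case using dd_bound[of e x] by simp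
    qed
  qed
  \<comment> \<open>The exceptional null set depends on the direction, so only countably many
    directions can be combined; density and continuity in \<open>e\<close> recover the
    others.\<close>
  obtain D :: "'a set" where D: "countable D" "\<And>X. open X \<Longrightarrow> X \<noteq> {} \<Longrightarrow> \<exists>d\<in>D. d \<in> X"
    using countable_dense_exists by metis
  have "AE x in lebesgue_on \<Omega>. \<forall>e\<in>D. G x \<bullet> e \<le> L * norm e"
    using AE_dd D(1) by (simp add: AE_ball_countable)
  then have "AE x in lebesgue_on \<Omega>. norm (G x) \<le> L"
  proof eventually_elim
    case (elim x)
    have "open {e. L * norm e < G x \<bullet> e}"
      by (intro open_Collect_less continuous_intros)
    then have "{e. L * norm e < G x \<bullet> e} = {}" using D(2)[of "{e. L * norm e < G x \<bullet> e}"] elim by force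
    then have "G x \<bullet> G x \<le> L * norm (G x)" by (simp add: not_less)
    then show ?case by (rule norm_le_of_inner_le[OF L])
  qed
  with wg G_meas show ?thesis by (rule that)
qed

context convex_domain
begin

definition cone_fun :: "real \<Rightarrow> 'a \<Rightarrow> real" where
  "cone_fun l x = max 0 (1 - l * bdist \<Omega> x)"

lemma cone_fun_lipschitz:
  assumes "0 \<le> l"
  shows "\<bar>cone_fun l x - cone_fun l y\<bar> \<le> l * norm (x - y)"
proof -
  have "\<bar>cone_fun l x - cone_fun l y\<bar> \<le> \<bar>l * (bdist \<Omega> x - bdist \<Omega> y)\<bar>"
    unfolding cone_fun_def right_diff_distrib by linarith
  also have "\<dots> \<le> l * norm (x - y)"
    using assms bdist_lipschitz[of x y] by (simp add: abs_mult mult_left_mono)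
  finally show ?thesis .
qed

lemma cone_fun_convex:
  assumes "0 \<le> l"
  shows "convex_on UNIV (cone_fun l)"
proof (rule convex_onI)
  fix t :: real and x y :: 'a assume t: "0 < t" "t < 1"
  have "l * ((1 - t) * bdist \<Omega> x + t * bdist \<Omega> y) \<le> l * bdist \<Omega> ((1 - t) *\<^sub>R x + t *\<^sub>R y)"
    using t assms by (intro mult_left_mono bdist_concave) auto
  then have "1 - l * bdist \<Omega> ((1 - t) *\<^sub>R x + t *\<^sub>R y) \<le> (1 - t) * (1 - l * bdist \<Omega> x) + t * (1 - l * bdist \<Omega> y)"
    by (simp add: algebra_simps)
  also have "\<dots> \<le> (1 - t) * cone_fun l x + t * cone_fun l y"
    using t by (intro add_mono mult_left_mono) (auto simp: cone_fun_def)
  finally show "cone_fun l ((1 - t) *\<^sub>R x + t *\<^sub>R y) \<le> (1 - t) * cone_fun l x + t * cone_fun l y"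
    using t unfolding cone_fun_def[of l "(1 - t) *\<^sub>R x + t *\<^sub>R y"]
    by (simp add: cone_fun_def)
qed simp

text \<open>An upper bound for the energy suffices: at a minimising slope \<open>J_ge_min\<close>
  supplies the reverse inequality.\<close>

lemma cone_fun_Lip1:
  assumes l: "0 < l"
  shows "cone_fun l \<in> Lip1 \<Omega>" and "J \<Omega> \<Lambda> (cone_fun l) \<le> l + \<Lambda> * collar \<Omega> (1 / l)"
proof -
  have \<Omega>: "\<Omega> \<in> sets lebesgue" using open_dom by auto
  have cont: "continuous_on A (cone_fun l)" for A
    using lipschitz_imp_continuous[OF cone_fun_lipschitz] l by simp
  have m: "cone_fun l \<in> borel_measurable (lebesgue_on \<Omega>)"
    using measurable_restrict_space1[OF continuous_lebesgue_measurable[OF cont]] .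
  have ge: "cone_fun l x \<le> 1" if "x \<in> \<Omega>" for x
    using bdist_pos_iff[of x] that l by (simp add: cone_fun_def)
  have "esssup (lebesgue_on \<Omega>) (\<lambda>x. ereal (norm (cone_fun l x))) \<le> ereal 1"
  proof (rule esssup_I)
    show "AE x in lebesgue_on \<Omega>. ereal (norm (cone_fun l x)) \<le> ereal 1"
      using ge by (intro AE_I2) (auto simp: cone_fun_def)
  qed (use m in measurable)
  then have "cone_fun l \<in> Linf \<Omega>" using m by (auto simp: Linf_def intro: le_less_trans)
  obtain G where G: "has_weak_gradient \<Omega> (cone_fun l) G" "G \<in> borel_measurable lebesgue"
    "AE x in lebesgue_on \<Omega>. norm (G x) \<le> l"
    using convex_lipschitz_has_weak_gradient[OF open_dom cone_fun_convex[OF less_imp_le[OF l]]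
        cone_fun_lipschitz[OF less_imp_le[OF l]] less_imp_le[OF l]] by blast
  have mG: "G \<in> borel_measurable (lebesgue_on \<Omega>)" using G(2) by (rule measurable_restrict_space1)
  have "esssup (lebesgue_on \<Omega>) (\<lambda>x. ereal (norm (G x))) \<le> ereal l"
    by (rule esssup_I) (use mG G(3) in auto)
  then have GL: "G \<in> Linf \<Omega>" using mG by (auto simp: Linf_def intro: le_less_trans)
  show "cone_fun l \<in> Lip1 \<Omega>"
    using \<open>cone_fun l \<in> Linf \<Omega>\<close> GL G(1) cont bdist_frontier
    by (auto simp: Lip1_def W1inf_def cone_fun_def)
  have "Linf_norm \<Omega> (weak_gradient \<Omega> (cone_fun l)) = Linf_norm \<Omega> G"
    unfolding Linf_norm_def weak_gradient_Linf(2)[OF open_dom GL G(1)] ..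
  also have "\<dots> \<le> l" using l by (intro Linf_norm_le mG G(3)) simp
  finally have "Linf_norm \<Omega> (weak_gradient \<Omega> (cone_fun l)) \<le> l" .
  moreover have "{x \<in> \<Omega>. 0 < cone_fun l x} = {x \<in> \<Omega>. bdist \<Omega> x < 1 / l}"
    using l by (auto simp: cone_fun_def field_simps)
  ultimately show "J \<Omega> \<Lambda> (cone_fun l) \<le> l + \<Lambda> * collar \<Omega> (1 / l)"
    by (simp add: J_def collar_def)
qed

end

section \<open>The minimum of the limit problem\<close>

context convex_domain
begin

text \<open>Slopes below 1 / R are left out because their cones are positive on all of \<Omega>, and
  the constant 1 costs no more than they do.\<close>

definition radial_min :: "real \<Rightarrow> real" where
  "radial_min \<Lambda> = (INF l\<in>{1 / inradius \<Omega>..}. l + \<Lambda> * collar \<Omega> (1 / l))"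

lemma inradius_inverse_pos: "0 < 1 / inradius \<Omega>"
  using inradius_pos by simp

lemma energy_nonneg:
  assumes "0 \<le> \<Lambda>" "1 / inradius \<Omega> \<le> l"
  shows "0 \<le> l + \<Lambda> * collar \<Omega> (1 / l)"
proof -
  have "0 \<le> l" using inradius_inverse_pos assms(2) by linarith
  then show ?thesis using assms(1) collar_nonneg by simp
qed

lemma bdd_below_energy:
  "0 \<le> \<Lambda> \<Longrightarrow> bdd_below ((\<lambda>l. l + \<Lambda> * collar \<Omega> (1 / l)) ` {1 / inradius \<Omega>..})"
  by (intro bdd_belowI2[of _ 0] energy_nonneg) auto

lemma radial_min_le:
  assumes "0 \<le> \<Lambda>" "1 / inradius \<Omega> \<le> l"
  shows "radial_min \<Lambda> \<le> l + \<Lambda> * collar \<Omega> (1 / l)"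
  unfolding radial_min_def using assms(2) by (intro cINF_lower bdd_below_energy assms(1)) simp

text \<open>A minimising sequence is bounded, as the energy dominates \<open>l\<close>; take a
  convergent subsequence. Any fixed \<open>s < 1 / l\<close> lies eventually below
  \<open>1 / lk (r k)\<close>, so monotonicity of the collar gives the bound at \<open>s\<close>,
  and \<open>s\<close> then increases to \<open>1 / l\<close> by left continuity.\<close>

lemma radial_min_attained:
  assumes \<Lambda>: "0 \<le> \<Lambda>"
  obtains l where "1 / inradius \<Omega> \<le> l" "l + \<Lambda> * collar \<Omega> (1 / l) = radial_min \<Lambda>"
proof -
  define M where "M = radial_min \<Lambda>"
  define F where "F l = l + \<Lambda> * collar \<Omega> (1 / l)" for l
  have "\<exists>l\<in>{1 / inradius \<Omega>..}. F l < M + inverse (real (Suc k))" for k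
    unfolding F_def M_def radial_min_def
    by (subst cINF_less_iff[symmetric, OF _ bdd_below_energy[OF \<Lambda>]]) auto
  then obtain lk where lk: "\<And>k. 1 / inradius \<Omega> \<le> lk k" "\<And>k. F (lk k) < M + inverse (real (Suc k))"
    by (metis atLeast_iff)
  have "lk k \<le> M + 1" for k
  proof -
    have "lk k \<le> F (lk k)" unfolding F_def using \<Lambda> collar_nonneg by simp
    moreover have "inverse (real (Suc k)) \<le> 1" by (simp add: divide_simps)
    ultimately show ?thesis using lk(2)[of k] by linarith
  qed
  then have "\<forall>k. lk k \<in> {1 / inradius \<Omega>..M + 1}" using lk(1) by simp
  then obtain l r where l: "l \<in> {1 / inradius \<Omega>..M + 1}" "strict_mono r" "(lk \<circ> r) \<longlonglongrightarrow> l"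
    using compact_Icc[unfolded compact_def] by meson
  have "1 / inradius \<Omega> \<le> l" using l(1) by simp
  then have lpos: "0 < l" using inradius_inverse_pos by linarith
  have below: "l + \<Lambda> * collar \<Omega> s \<le> M" if "s < 1 / l" for s
  proof (rule LIMSEQ_le)
    show "(\<lambda>k. lk (r k) + \<Lambda> * collar \<Omega> s) \<longlonglongrightarrow> l + \<Lambda> * collar \<Omega> s"
      using l(3) by (intro tendsto_add tendsto_const) (simp add: o_def)
    have "(\<lambda>k. inverse (real (Suc (r k)))) \<longlonglongrightarrow> 0"
      using LIMSEQ_subseq_LIMSEQ[OF LIMSEQ_inverse_real_of_nat l(2)] by (simp add: o_def)
    then show "(\<lambda>k. M + inverse (real (Suc (r k)))) \<longlonglongrightarrow> M"
      using tendsto_add[OF tendsto_const[of M]] by fastforce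
    have "(\<lambda>k. 1 / lk (r k)) \<longlonglongrightarrow> 1 / l"
      using l(3) lpos by (intro tendsto_divide tendsto_const) (auto simp: o_def)
    from order_tendstoD(1)[OF this that]
    have "\<forall>\<^sub>F k in sequentially. lk (r k) + \<Lambda> * collar \<Omega> s \<le> M + inverse (real (Suc (r k)))"
    proof eventually_elim
      case (elim k)
      have "\<Lambda> * collar \<Omega> s \<le> \<Lambda> * collar \<Omega> (1 / lk (r k))"
        using elim \<Lambda> by (intro mult_left_mono collar_mono) auto
      then show ?case using lk(2)[of "r k"] unfolding F_def by linarith
    qed
    then show "\<exists>N. \<forall>n\<ge>N. lk (r n) + \<Lambda> * collar \<Omega> s \<le> M + inverse (real (Suc (r n)))"
      by (simp add: eventually_sequentially)
  qed
  define s where "s n = 1 / l * (1 - inverse (real (Suc n)))" for n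
  have "(\<lambda>n. 1 / l * (1 - inverse (real (Suc n)))) \<longlonglongrightarrow> 1 / l * (1 - 0)"
    by (intro tendsto_intros LIMSEQ_inverse_real_of_nat)
  then have "s \<longlonglongrightarrow> 1 / l" by (simp add: s_def[abs_def])
  moreover have "incseq s" unfolding s_def using lpos
    by (intro incseq_SucI mult_left_mono diff_left_mono) (auto simp: divide_simps)
  moreover have s_less: "s n < 1 / l" for n
  proof -
    have "1 / l * (1 - inverse (real (Suc n))) < 1 / l * 1"
      using lpos by (intro mult_strict_left_mono) auto
    then show ?thesis by (simp add: s_def)
  qed
  ultimately have "(\<lambda>n. collar \<Omega> (s n)) \<longlonglongrightarrow> collar \<Omega> (1 / l)"
    by (intro collar_left_LIMSEQ)
  then have "(\<lambda>n. l + \<Lambda> * collar \<Omega> (s n)) \<longlonglongrightarrow> l + \<Lambda> * collar \<Omega> (1 / l)"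
    by (intro tendsto_intros)
  then have "l + \<Lambda> * collar \<Omega> (1 / l) \<le> M"
    by (rule LIMSEQ_le_const2) (use below s_less in auto)
  moreover have "M \<le> l + \<Lambda> * collar \<Omega> (1 / l)"
    unfolding M_def using l(1) by (intro radial_min_le \<Lambda>) simp
  ultimately show ?thesis using l(1) that unfolding M_def by (meson antisym atLeastAtMost_iff)
qed

section \<open>Comparison with constant functions and the threshold for \<Lambda>\<close>

lemma const_Lip1: "(\<lambda>x. 1) \<in> Lip1 \<Omega>" and J_const: "J \<Omega> \<Lambda> (\<lambda>x. 1) = \<Lambda> * measure lebesgue \<Omega>"
proof -
  have ne: "emeasure (lebesgue_on \<Omega>) (space (lebesgue_on \<Omega>)) \<noteq> 0"
    using dom_not_null open_dom by (simp add: emeasure_restrict_space)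
  have 1: "(\<lambda>x. 1::real) \<in> Linf \<Omega>" and 0: "(\<lambda>x. 0::'a) \<in> Linf \<Omega>"
    using esssup_const[OF ne, of "ereal 1"] esssup_const[OF ne, of "ereal 0"] by (auto simp: Linf_def)
  have wg: "has_weak_gradient \<Omega> (\<lambda>x. 1) (\<lambda>x. 0)" by (rule has_weak_gradient_const[OF open_dom])
  show "(\<lambda>x. 1) \<in> Lip1 \<Omega>" using 1 0 wg by (auto simp: Lip1_def W1inf_def)
  have "Linf_norm \<Omega> (weak_gradient \<Omega> (\<lambda>x. 1)) = 0"
    unfolding Linf_norm_def weak_gradient_Linf(2)[OF open_dom 0 wg] using esssup_const[OF ne, of "ereal 0"] by simp
  then show "J \<Omega> \<Lambda> (\<lambda>x. 1) = \<Lambda> * measure lebesgue \<Omega>" by (simp add: J_def)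
qed

lemma J_ge_min:
  assumes "u \<in> Lip1 \<Omega>" "0 \<le> \<Lambda>"
  shows "min (\<Lambda> * measure lebesgue \<Omega>) (radial_min \<Lambda>) \<le> J \<Omega> \<Lambda> u"
proof (cases "Linf_norm \<Omega> (weak_gradient \<Omega> u) < 1 / inradius \<Omega>")
  case True
  then show ?thesis using J_ge_collar(1)[OF assms True] Lip1_gradient_bound(1)[OF assms(1)] by simp
next
  case False
  then show ?thesis
    using J_ge_collar(2)[OF assms] radial_min_le[OF assms(2), of "Linf_norm \<Omega> (weak_gradient \<Omega> u)"] by simp
qed

lemma minimizer_exists:
  assumes "0 \<le> \<Lambda>" "radial_min \<Lambda> \<le> \<Lambda> * measure lebesgue \<Omega>"
  obtains u where "is_solution \<Omega> \<Lambda> u" "J \<Omega> \<Lambda> u = radial_min \<Lambda>"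
proof -
  obtain l where l: "1 / inradius \<Omega> \<le> l" "l + \<Lambda> * collar \<Omega> (1 / l) = radial_min \<Lambda>"
    using radial_min_attained[OF assms(1)] by blast
  have "0 < l" using l(1) inradius_inverse_pos by linarith
  note c = cone_fun_Lip1[OF this]
  have ge: "radial_min \<Lambda> \<le> J \<Omega> \<Lambda> v" if "v \<in> Lip1 \<Omega>" for v
    using J_ge_min[OF that assms(1)] assms(2) by simp
  have "J \<Omega> \<Lambda> (cone_fun l) = radial_min \<Lambda>" using c(2)[of \<Lambda>] ge[OF c(1)] l(2) by simp
  then show ?thesis using ge c(1) by (intro that[of "cone_fun l"]) (auto simp: is_solution_def)
qed

lemma min_value_eq:
  assumes "0 \<le> \<Lambda>" "radial_min \<Lambda> \<le> \<Lambda> * measure lebesgue \<Omega>"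
  shows "min_value \<Omega> \<Lambda> = radial_min \<Lambda>"
proof -
  obtain u where u: "is_solution \<Omega> \<Lambda> u" "J \<Omega> \<Lambda> u = radial_min \<Lambda>" using minimizer_exists[OF assms] by blast
  then show ?thesis unfolding min_value_def
    by (intro Least_equality) (auto simp: is_solution_def image_iff intro: bexI[of _ u])
qed

text \<open>A solution does not exceed the energy of the constant 1. If its slope were below 1 / R,
  it would also pay for the whole volume, leaving slope 0 and hence a constant.\<close>

lemma nonconstant_solution_bound:
  assumes \<Lambda>: "0 < \<Lambda>" and u: "is_solution \<Omega> \<Lambda> u" "\<not> u constant_on \<Omega>"
  obtains l where "1 / inradius \<Omega> \<le> l" "l + \<Lambda> * collar \<Omega> (1 / l) \<le> \<Lambda> * measure lebesgue \<Omega>"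
proof -
  define L where "L = Linf_norm \<Omega> (weak_gradient \<Omega> u)"
  have uL: "u \<in> Lip1 \<Omega>" and le: "J \<Omega> \<Lambda> u \<le> \<Lambda> * measure lebesgue \<Omega>"
    using u(1) const_Lip1 J_const[of \<Lambda>] by (auto simp: is_solution_def)
  have "1 / inradius \<Omega> \<le> L"
  proof (rule ccontr)
    assume "\<not> 1 / inradius \<Omega> \<le> L"
    then have "L \<le> 0" using J_ge_collar(1)[OF uL, of \<Lambda>] le \<Lambda> by (simp add: L_def)
    then have "L = 0" using Lip1_gradient_bound(1)[OF uL] by (simp add: L_def)
    obtain x where x: "x \<in> \<Omega>" using nonempty by blast
    have "u y = u x" if "y \<in> \<Omega>" for y
      using Lip1_gradient_bound(2)[OF uL x, of y] that closure_subset[of \<Omega>] \<open>L = 0\<close> by (auto simp: L_def)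
    then show False using u(2) unfolding constant_on_def by blast
  qed
  then show ?thesis using J_ge_collar(2)[OF uL, of \<Lambda>] le \<Lambda> by (intro that[of L]) (auto simp: L_def)
qed

lemma constant_Lip1_J_ge:
  assumes u: "u \<in> Lip1 \<Omega>" "u constant_on \<Omega>" and \<Lambda>: "0 \<le> \<Lambda>"
  shows "\<Lambda> * measure lebesgue \<Omega> \<le> J \<Omega> \<Lambda> u"
proof -
  obtain c where c: "\<And>x. x \<in> \<Omega> \<Longrightarrow> u x = c" using u(2) unfolding constant_on_def by blast
  obtain x where x: "x \<in> \<Omega>" using nonempty by blast
  \<comment> \<open>Any width above \<open>bdist \<Omega> x\<close> will do: only a frontier point
    is wanted, where the boundary value forces the constant to be at least 1.\<close>
  obtain y where y: "y \<in> frontier \<Omega>" using exit_point[OF x, of "bdist \<Omega> x + 1"] by auto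
  have "u y \<le> c"
    by (rule continuous_le_on_closure[of \<Omega>]) (use u(1) y c in \<open>auto simp: Lip1_def frontier_def\<close>)
  then have "0 < c" using u(1) y by (auto simp: Lip1_def)
  then have "{x \<in> \<Omega>. 0 < u x} = \<Omega>" using c by auto
  then show ?thesis using Lip1_gradient_bound(1)[OF u(1)] by (simp add: J_def)
qed

text \<open>Makes the infimum in \<open>Lambda_inf\<close> range over a nonempty set, so that
  \<open>Inf\<close> has its usual meaning.\<close>

lemma nonconstant_solution_exists:
  "\<exists>\<Lambda>>0. \<exists>u. is_solution \<Omega> \<Lambda> u \<and> \<not> u constant_on \<Omega>"
proof -
  obtain r where r: "0 < r" "r \<le> inradius \<Omega>" "collar \<Omega> r < measure lebesgue \<Omega>" using collar_less_dom by blast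
  \<comment> \<open>Chosen so that the volume saved by the cone of slope 1 / r is worth 1 / r + 1,
    one more than the slope costs.\<close>
  define \<Lambda> where "\<Lambda> = (1 / r + 1) / (measure lebesgue \<Omega> - collar \<Omega> r)"
  have \<Lambda>: "0 < \<Lambda>" using r by (simp add: \<Lambda>_def add_pos_pos)
  have "\<Lambda> * (measure lebesgue \<Omega> - collar \<Omega> r) = 1 / r + 1" using r by (simp add: \<Lambda>_def)
  then have "1 / r + \<Lambda> * collar \<Omega> r < \<Lambda> * measure lebesgue \<Omega>" by (simp add: right_diff_distrib)
  moreover have "radial_min \<Lambda> \<le> 1 / r + \<Lambda> * collar \<Omega> (1 / (1 / r))"
    using r \<Lambda> by (intro radial_min_le) (auto simp: divide_simps)
  ultimately have lt: "radial_min \<Lambda> < \<Lambda> * measure lebesgue \<Omega>" by simp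
  obtain u where u: "is_solution \<Omega> \<Lambda> u" "J \<Omega> \<Lambda> u = radial_min \<Lambda>"
    using minimizer_exists[of \<Lambda>] lt \<Lambda> by (metis less_imp_le)
  then have "\<not> u constant_on \<Omega>" using constant_Lip1_J_ge[of u \<Lambda>] lt \<Lambda> by (auto simp: is_solution_def)
  then show ?thesis using u(1) \<Lambda> by blast
qed

text \<open>The infimum may not be attained, so a parameter
  \<open>\<Lambda>0 < \<Lambda> + \<delta>\<close> with a nonconstant solution is used. Raising the
  volume price favours cones over the constant, and the excess \<delta> costs at most \<delta>
  |\<Omega>| = \<epsilon>.\<close>

lemma Lambda_inf_imp:
  assumes "Lambda_inf \<Omega> \<le> \<Lambda>"
  shows "0 \<le> \<Lambda>" and "radial_min \<Lambda> \<le> \<Lambda> * measure lebesgue \<Omega>"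
proof -
  define S where "S = {\<Lambda>. 0 < \<Lambda> \<and> (\<exists>u. is_solution \<Omega> \<Lambda> u \<and> \<not> u constant_on \<Omega>)}"
  have S: "S \<noteq> {}" "bdd_below S" "Inf S \<le> \<Lambda>"
    using nonconstant_solution_exists assms by (auto simp: S_def Lambda_inf_def intro!: bdd_belowI[of _ 0])
  have "0 \<le> Inf S" using S(1) by (intro cInf_greatest) (auto simp: S_def)
  then show \<Lambda>: "0 \<le> \<Lambda>" using S(3) by simp
  show "radial_min \<Lambda> \<le> \<Lambda> * measure lebesgue \<Omega>"
  proof (rule field_le_epsilon)
    fix \<epsilon> :: real assume "\<epsilon> > 0"
    define \<delta> where "\<delta> = \<epsilon> / measure lebesgue \<Omega>"
    have \<delta>: "0 < \<delta>" "\<delta> * measure lebesgue \<Omega> = \<epsilon>" using \<open>\<epsilon> > 0\<close> measure_dom_pos by (auto simp: \<delta>_def)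
    have "Inf S < \<Lambda> + \<delta>" using S(3) \<delta>(1) by simp
    then obtain \<Lambda>0 where "\<Lambda>0 \<in> S" and less: "\<Lambda>0 < \<Lambda> + \<delta>" using cInf_lessD[OF S(1)] by blast
    then obtain l where l: "1 / inradius \<Omega> \<le> l" "l + \<Lambda>0 * collar \<Omega> (1 / l) \<le> \<Lambda>0 * measure lebesgue \<Omega>"
      using nonconstant_solution_bound unfolding S_def by blast
    \<comment> \<open>In this form \<open>\<Lambda>0\<close> multiplies the saved volume, which is
      nonnegative, and can be replaced by the larger \<open>\<Lambda> + \<delta>\<close>.\<close>
    have "l \<le> \<Lambda>0 * (measure lebesgue \<Omega> - collar \<Omega> (1 / l))" using l(2) by (simp add: right_diff_distrib)
    also have "\<dots> \<le> (\<Lambda> + \<delta>) * (measure lebesgue \<Omega> - collar \<Omega> (1 / l))"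
      using less collar_le_dom by (intro mult_right_mono) auto
    finally have "l + \<Lambda> * collar \<Omega> (1 / l) \<le> \<Lambda> * measure lebesgue \<Omega> + \<delta> * (measure lebesgue \<Omega> - collar \<Omega> (1 / l))"
      by (simp add: algebra_simps)
    also have "\<dots> \<le> \<Lambda> * measure lebesgue \<Omega> + \<epsilon>"
      using \<delta> collar_nonneg[of "1 / l"] by (simp add: right_diff_distrib)
    finally show "radial_min \<Lambda> \<le> \<Lambda> * measure lebesgue \<Omega> + \<epsilon>"
      using radial_min_le[OF \<Lambda> l(1)] by simp
  qed
qed

end

section \<open>Competitors for the approximating problems\<close>

text \<open>A smooth substitute for max 0 t. With y = 1 / (k t) and t > 0 it is t exp(-y), so
  exp(-y) \<ge> 1 - y bounds the loss by 1 / k, and its slope (1 + y) exp(-y) lies in [0,1].\<close>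

definition ramp :: "real \<Rightarrow> real \<Rightarrow> real" where
  "ramp k t = t * flat 0 (k * t)"

lemma C_k_ramp: "C_k m (ramp k)"
proof -
  have id: "C_k m (\<lambda>t::real. t)" for m using C_k_inner[of m "1::real"] by simp
  have "C_k m (\<lambda>t. t * flat 0 (k * t))"
    by (intro C_k_mult[OF id] C_k_compose_real[OF C_k_flat] C_k_mult[OF C_k_const id])
  then show ?thesis by (simp add: ramp_def[abs_def])
qed

lemma ramp_nonpos: "0 < k \<Longrightarrow> t \<le> 0 \<Longrightarrow> ramp k t = 0"
  by (auto simp: ramp_def flat_def zero_less_mult_iff)

lemma ramp_ge: "0 < k \<Longrightarrow> t - 1 / k \<le> ramp k t"
proof (cases "0 < t")
  case True
  assume k: "0 < k"
  have "t - 1 / k = t * (1 + - 1 / (k * t))" using True k by (simp add: field_simps)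
  also have "\<dots> \<le> t * exp (- 1 / (k * t))"
    using True by (intro mult_left_mono exp_ge_add_one_self) auto
  finally show ?thesis using True k by (simp add: ramp_def flat_def)
next
  case False
  assume k: "0 < k"
  moreover have "0 < 1 / k" using k by simp
  ultimately show ?thesis using False ramp_nonpos[of k t] by linarith
qed

lemma ramp_derivative:
  assumes k: "0 < k"
  obtains d where "(ramp k has_real_derivative d) (at t)" "0 \<le> d" "d \<le> 1"
proof -
  let ?d = "flat 0 (k * t) + t * (flat 2 (k * t) * k)"
  have "((\<lambda>t. flat 0 (k * t)) has_real_derivative (flat (0 + 2) (k * t) - real 0 * flat (0 + 1) (k * t)) * k) (at t)"
    by (rule DERIV_chain2[OF DERIV_flat]) (auto intro!: derivative_eq_intros)
  then have "((\<lambda>t. flat 0 (k * t)) has_real_derivative flat 2 (k * t) * k) (at t)"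
    by (simp add: numeral_2_eq_2)
  from DERIV_mult[OF DERIV_ident this]
  have "(ramp k has_real_derivative ?d) (at t)"
    by (simp add: ramp_def[abs_def] mult.commute add.commute)
  moreover have "0 \<le> ?d \<and> ?d \<le> 1"
  proof (cases "0 < t")
    case True
    define y where "y = 1 / (k * t)"
    have y: "0 < y" using True k by (simp add: y_def)
    have "?d = (1 + y) * exp (- y)"
      using True k by (simp add: flat_def y_def zero_less_mult_iff field_simps power2_eq_square)
    moreover have "(1 + y) * exp (- y) \<le> exp y * exp (- y)"
      by (intro mult_right_mono exp_ge_add_one_self) auto
    ultimately show ?thesis using y by (simp add: exp_minus_inverse)
  next
    case False
    then have "\<not> 0 < k * t" using k by (simp add: zero_less_mult_iff)
    then show ?thesis by (simp add: flat_def)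
  qed
  ultimately show ?thesis using that by blast
qed

lemma norm_grad_le:
  assumes "(\<phi> has_derivative f') (at x)" "\<And>v. f' v \<le> l * norm v" "0 \<le> l"
  shows "norm (grad \<phi> x) \<le> l"
proof (rule norm_le_of_inner_le[OF assms(3)])
  have eq: "frechet_derivative \<phi> (at x) = f'" using frechet_derivative_at[OF assms(1)] by simp
  have "grad \<phi> x \<bullet> grad \<phi> x = f' (grad \<phi> x)"
    using grad_inner[of \<phi> x "grad \<phi> x"] assms(1) by (simp add: eq)
  then show "grad \<phi> x \<bullet> grad \<phi> x \<le> l * norm (grad \<phi> x)" using assms(2) by simp
qed

lemma sphere_net:
  assumes "0 < \<delta>"
  obtains E :: "'a::euclidean_space set" where "finite E" "E \<noteq> {}" "\<And>e. e \<in> E \<Longrightarrow> norm e = 1"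
    "\<And>e. norm e = 1 \<Longrightarrow> \<exists>e'\<in>E. norm (e - e') \<le> \<delta>"
proof -
  obtain E where E: "E \<subseteq> sphere (0::'a) 1" "finite E" "sphere (0::'a) 1 \<subseteq> (\<Union>e\<in>E. ball e \<delta>)"
    using compactE_image[OF compact_sphere, of "sphere (0::'a) 1" "\<lambda>e. ball e \<delta>" 0 1] assms by force
  have "sphere (0::'a) 1 \<noteq> {}" by simp
  then have "E \<noteq> {}" using E(3) by blast
  moreover have "\<exists>e'\<in>E. norm (e - e') \<le> \<delta>" if "norm e = 1" for e
  proof -
    have "e \<in> (\<Union>e\<in>E. ball e \<delta>)" using that by (intro subsetD[OF E(3)]) simp
    then show ?thesis by (auto simp: dist_norm norm_minus_commute intro: less_imp_le)
  qed
  moreover have "norm e = 1" if "e \<in> E" for e using E(1) that by auto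
  ultimately show ?thesis using E(2) by (intro that)
qed

context convex_domain
begin

lemma inner_le_dist: "x \<bullet> e - x \<bullet> e' \<le> norm x * norm (e - e')"
  using norm_cauchy_schwarz[of x "e - e'"] by (simp add: inner_diff_right)

text \<open>A supremum of functions of \<open>e\<close> that are all Lipschitz with constant
  \<open>B\<close>; this controls the error of passing to a net of directions.\<close>

lemma support_fun_diff:
  assumes B: "\<And>y. y \<in> \<Omega> \<Longrightarrow> norm y \<le> B"
  shows "support_fun \<Omega> e - support_fun \<Omega> e' \<le> B * norm (e - e')"
proof -
  have "support_fun \<Omega> e \<le> support_fun \<Omega> e' + B * norm (e - e')"
  proof (rule support_fun_le)
    fix y assume y: "y \<in> \<Omega>"
    have "y \<bullet> e - y \<bullet> e' \<le> B * norm (e - e')"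
      using inner_le_dist[of y e e'] mult_right_mono[OF B[OF y], of "norm (e - e')"] by simp
    then show "y \<bullet> e \<le> support_fun \<Omega> e' + B * norm (e - e')" using support_fun_ge[OF y, of e'] by simp
  qed
  then show ?thesis by simp
qed

text \<open>The soft minimum \<open>g\<close> of the slacks \<open>h(e) - x \<bullet> e\<close> over a finite net of
  directions is a smooth 1-Lipschitz substitute for the distance to the boundary.\<close>

lemma smooth_competitor:
  assumes l: "0 < l" and \<eta>: "0 < \<eta>"
  obtains \<phi> where "test_function \<Omega> \<phi>" "\<And>x. norm (grad \<phi> x) \<le> l"
    "\<And>x. l * (bdist \<Omega> x - \<eta>) \<le> \<phi> x"
proof -
  obtain B where B: "B > 0" "\<And>y. y \<in> \<Omega> \<Longrightarrow> norm y \<le> B" using obtain_bound by blast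
  \<comment> \<open>The 1/2 yields the a priori bound 2 B on the polyhedron \<open>K\<close> below.
    With that bound the net error is 3 B \<delta>, and 24 = 3 * 8 makes it at most \<eta>/8.\<close>
  define \<delta> where "\<delta> = min (1 / 2) (\<eta> / (24 * B))"
  have \<delta>: "0 < \<delta>" "\<delta> \<le> 1 / 2" "\<delta> * B \<le> \<eta> / 24" using \<eta> B(1) by (auto simp: \<delta>_def min_def field_simps)
  obtain E where E: "finite E" "E \<noteq> {}" "\<And>e. e \<in> E \<Longrightarrow> norm e = 1"
    "\<And>e::'a. norm e = 1 \<Longrightarrow> \<exists>e'\<in>E. norm (e - e') \<le> \<delta>"
    using sphere_net[OF \<delta>(1)] by blast
  define N where "N = real (card E)"
  have N: "1 \<le> N" using E by (simp add: N_def Suc_le_eq card_gt_0_iff)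
  \<comment> \<open>A soft minimum of N terms is off by at most ln N / \<beta>, here at most
    \<eta>/4; the added 1 keeps \<beta> positive for N = 1.\<close>
  define \<beta> where "\<beta> = 4 * (ln N + 1) / \<eta>"
  have \<beta>: "0 < \<beta>" "ln N / \<beta> \<le> \<eta> / 4"
  proof -
    have "0 < ln N + 1" using N by (simp add: add_nonneg_pos)
    then show "0 < \<beta>" using \<eta> by (simp add: \<beta>_def)
    show "ln N / \<beta> \<le> \<eta> / 4" using \<open>0 < ln N + 1\<close> \<eta> by (simp add: \<beta>_def field_simps)
  qed
  define T where "T e x = exp (\<beta> * (x \<bullet> e + - support_fun \<Omega> e))" for e x
  define S where "S x = (\<Sum>e\<in>E. T e x)" for x
  define g where "g x = - (1 / \<beta>) * ln (S x)" for x
  have T_pos: "0 < T e x" for e x by (simp add: T_def)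
  have S_pos: "0 < S x" for x unfolding S_def using E T_pos by (intro sum_pos) auto
  have C_T: "C_k m (T e)" for m e
    unfolding T_def by (intro C_k_compose_real[OF C_k_exp] C_k_mult[OF C_k_const] C_k_add[OF C_k_inner C_k_const])
  have C_S: "C_k m S" for m unfolding S_def by (intro C_k_sum C_T)
  have C_g: "C_k m g" for m
    unfolding g_def by (intro C_k_mult[OF C_k_const] C_k_ln[OF S_pos C_S])
  have g_le: "g x \<le> support_fun \<Omega> e - x \<bullet> e" if "e \<in> E" for x e
  proof -
    have "T e x \<le> S x" unfolding S_def using that E(1) T_pos by (intro member_le_sum) (auto intro: less_imp_le)
    then have "ln (T e x) \<le> ln (S x)" using T_pos S_pos by simp
    then have "\<beta> * (x \<bullet> e - support_fun \<Omega> e) \<le> ln (S x)" by (simp add: T_def)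
    then show ?thesis using \<beta>(1) by (simp add: g_def field_simps)
  qed
  have g_ge: "bdist \<Omega> x - \<eta> / 4 \<le> g x" for x
  proof -
    have "S x \<le> (\<Sum>e\<in>E. exp (\<beta> * - bdist \<Omega> x))"
      unfolding S_def T_def
    proof (intro sum_mono exp_le_cancel_iff[THEN iffD2] mult_left_mono)
      show "x \<bullet> e + - support_fun \<Omega> e \<le> - bdist \<Omega> x" if "e \<in> E" for e
        using bdist_le[OF E(3)[OF that], of x] by simp
    qed (use \<beta> in simp)
    also have "\<dots> = N * exp (\<beta> * - bdist \<Omega> x)" by (simp add: N_def)
    finally have "ln (S x) \<le> ln (N * exp (\<beta> * - bdist \<Omega> x))" using S_pos N by simp
    also have "\<dots> = ln N + \<beta> * - bdist \<Omega> x" using N by (simp add: ln_mult)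
    finally have "(\<beta> * bdist \<Omega> x - ln N) / \<beta> \<le> - ln (S x) / \<beta>"
      using \<beta>(1) by (intro divide_right_mono) auto
    then have "bdist \<Omega> x - ln N / \<beta> \<le> g x" using \<beta>(1) by (simp add: g_def diff_divide_distrib)
    then show ?thesis using \<beta>(2) by simp
  qed
  have g_deriv: "(g has_derivative (\<lambda>v. - ((\<Sum>e\<in>E. (v \<bullet> e) * T e x) / S x))) (at x)" for x
  proof -
    have "(T e has_derivative (\<lambda>v. (v \<bullet> e) * (\<beta> * T e x))) (at x)" for e
      unfolding T_def by (auto intro!: derivative_eq_intros)
    then have "(S has_derivative (\<lambda>v. \<Sum>e\<in>E. (v \<bullet> e) * (\<beta> * T e x))) (at x)"
      unfolding S_def by (intro has_derivative_sum)
    moreover have "(ln has_derivative (\<lambda>t. t * inverse (S x))) (at (S x))"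
      using DERIV_ln[OF S_pos, of x] by (simp add: has_field_derivative_def mult.commute[of _ "inverse _"])
    ultimately have "((\<lambda>x. ln (S x)) has_derivative (\<lambda>v. (\<Sum>e\<in>E. (v \<bullet> e) * (\<beta> * T e x)) * inverse (S x))) (at x)"
      by (rule has_derivative_compose)
    then have "(g has_derivative (\<lambda>v. - (1 / \<beta>) * ((\<Sum>e\<in>E. (v \<bullet> e) * (\<beta> * T e x)) * inverse (S x)))) (at x)"
      unfolding g_def by (rule has_derivative_mult_right)
    moreover have "- (1 / \<beta>) * ((\<Sum>e\<in>E. (v \<bullet> e) * (\<beta> * T e x)) * inverse (S x)) = - ((\<Sum>e\<in>E. (v \<bullet> e) * T e x) / S x)" for v
    proof -
      have "(\<Sum>e\<in>E. (v \<bullet> e) * (\<beta> * T e x)) = \<beta> * (\<Sum>e\<in>E. (v \<bullet> e) * T e x)"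
        by (simp add: sum_distrib_left algebra_simps)
      then show ?thesis using \<beta>(1) by (simp add: field_simps)
    qed
    ultimately show ?thesis by simp
  qed
  \<comment> \<open>The weights \<open>T e x / S x\<close> are positive with sum 1, so the gradient
    of \<open>g\<close> is minus a convex combination of unit vectors.\<close>
  have g_slope: "\<bar>- ((\<Sum>e\<in>E. (v \<bullet> e) * T e x) / S x)\<bar> \<le> norm v" for v x
  proof -
    have "\<bar>\<Sum>e\<in>E. (v \<bullet> e) * T e x\<bar> \<le> (\<Sum>e\<in>E. norm v * T e x)"
    proof (rule order_trans[OF sum_abs sum_mono])
      fix e assume "e \<in> E"
      then have "\<bar>v \<bullet> e\<bar> \<le> norm v" using Cauchy_Schwarz_ineq2[of v e] E(3) by simp
      then show "\<bar>(v \<bullet> e) * T e x\<bar> \<le> norm v * T e x" using T_pos[of e x] by (simp add: abs_mult mult_right_mono)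
    qed
    also have "\<dots> = norm v * S x" by (simp add: S_def sum_distrib_left)
    finally show ?thesis using S_pos[of x] by (simp add: field_simps)
  qed
  \<comment> \<open>Error budget: \<eta>/4 each for the soft minimum, the downward shift in
    \<open>\<phi>\<close> and the ramp.\<close>
  define k where "k = 4 / \<eta>"
  have k: "0 < k" "1 / k = \<eta> / 4" using \<eta> by (auto simp: k_def)
  define \<phi> where "\<phi> x = l * ramp k (g x + - (\<eta> / 4))" for x
  \<comment> \<open>Where \<open>\<phi>\<close> is nonzero, \<open>g\<close> exceeds \<eta>/4, hence
    so do all slacks over the net. The net is fine enough for this polyhedron to be bounded and to
    lie inside \<Omega>.\<close>
  define K where "K = (\<Inter>e\<in>E. {x. x \<bullet> e \<le> support_fun \<Omega> e - \<eta> / 4})"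
  have K_bound: "norm x \<le> 2 * B" and K_dom: "x \<in> \<Omega>" if x: "x \<in> K" for x
  proof -
    have Ke: "x \<bullet> e \<le> support_fun \<Omega> e - \<eta> / 4" if "e \<in> E" for e using x that by (auto simp: K_def)
    show nx: "norm x \<le> 2 * B"
    proof (cases "x = 0")
      case False
      define e where "e = x /\<^sub>R norm x"
      have e: "norm e = 1" "x \<bullet> e = norm x" using False by (auto simp: e_def dot_square_norm power2_eq_square)
      obtain e' where e': "e' \<in> E" "norm (e - e') \<le> \<delta>" using E(4)[OF e(1)] by blast
      have "x \<bullet> e - x \<bullet> e' \<le> norm x * (1 / 2)"
        using inner_le_dist[of x e e'] mult_left_mono[of "norm (e - e')" "1 / 2" "norm x"] e'(2) \<delta>(2) by simp
      moreover have "support_fun \<Omega> e' \<le> B"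
        by (rule support_fun_le) (use B inner_le_norm[OF E(3)[OF e'(1)]] in \<open>auto intro: order_trans\<close>)
      ultimately show ?thesis using Ke[OF e'(1)] e(2) \<eta> by simp
    qed (use B in simp)
    have "\<eta> / 8 \<le> bdist \<Omega> x"
    proof (rule bdist_ge)
      fix e :: 'a assume "norm e = 1"
      then obtain e' where e': "e' \<in> E" "norm (e - e') \<le> \<delta>" using E(4) by blast
      have "x \<bullet> e - x \<bullet> e' \<le> 2 * B * \<delta>"
        using inner_le_dist[of x e e'] mult_mono[OF nx e'(2)] B(1) by simp
      moreover have "support_fun \<Omega> e' - support_fun \<Omega> e \<le> B * \<delta>"
        using support_fun_diff[OF B(2), of e' e] mult_left_mono[OF e'(2), of B] B(1)
        unfolding norm_minus_commute[of e' e] by linarith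
      moreover have "2 * B * \<delta> + B * \<delta> \<le> \<eta> / 8" using \<delta>(3) by (simp add: mult.commute)
      ultimately show "\<eta> / 8 \<le> support_fun \<Omega> e - x \<bullet> e" using Ke[OF e'(1)] by linarith
    qed
    then have "0 < bdist \<Omega> x" using \<eta> by simp
    then show "x \<in> \<Omega>" by (simp add: bdist_pos_iff)
  qed
  have "test_function \<Omega> \<phi>"
  proof (rule test_functionI)
    show "C_k m \<phi>" for m
      unfolding \<phi>_def by (intro C_k_mult[OF C_k_const] C_k_compose_real[OF C_k_ramp] C_k_add[OF C_g C_k_const])
    have "closed K" unfolding K_def
      by (intro closed_INT ballI closed_Collect_le continuous_intros)
    moreover have "bounded K" using K_bound by (intro boundedI)
    ultimately show "compact K" by (simp add: compact_eq_bounded_closed)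
    show "K \<subseteq> \<Omega>" using K_dom by blast
    show "x \<in> K" if "\<phi> x \<noteq> 0" for x
    proof -
      have "\<eta> / 4 < g x" using that ramp_nonpos[OF k(1), of "g x + - (\<eta> / 4)"] by (force simp: \<phi>_def)
      then show ?thesis using g_le[of _ x] by (force simp: K_def)
    qed
  qed
  moreover have "norm (grad \<phi> x) \<le> l" for x
  proof -
    obtain d where d: "(ramp k has_real_derivative d) (at (g x + - (\<eta> / 4)))" "0 \<le> d" "d \<le> 1"
      using ramp_derivative[OF k(1)] by blast
    let ?g' = "\<lambda>v. - ((\<Sum>e\<in>E. (v \<bullet> e) * T e x) / S x)"
    have "((\<lambda>x. g x + - (\<eta> / 4)) has_derivative ?g') (at x)"
      using has_derivative_add[OF g_deriv[of x] has_derivative_const[of "- (\<eta> / 4)"]] by simp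
    then have "((\<lambda>x. ramp k (g x + - (\<eta> / 4))) has_derivative (\<lambda>v. d * ?g' v)) (at x)"
      using d(1) unfolding has_field_derivative_def by (rule has_derivative_compose)
    then have "(\<phi> has_derivative (\<lambda>v. l * (d * ?g' v))) (at x)"
      unfolding \<phi>_def by (rule has_derivative_mult_right)
    then show ?thesis
    proof (rule norm_grad_le)
      fix v
      have "\<bar>d * ?g' v\<bar> \<le> 1 * norm v" unfolding abs_mult using d g_slope by (intro mult_mono) auto
      then have "d * ?g' v \<le> norm v" by linarith
      then show "l * (d * ?g' v) \<le> l * norm v" using l by (intro mult_left_mono) auto
    qed (use l in simp)
  qed
  moreover have "l * (bdist \<Omega> x - \<eta>) \<le> \<phi> x" for x
  proof -
    have "bdist \<Omega> x - \<eta> \<le> ramp k (g x + - (\<eta> / 4))"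
      using ramp_ge[OF k(1), of "g x + - (\<eta> / 4)"] g_ge[of x] k(2) \<eta> by simp
    then show ?thesis unfolding \<phi>_def using l by (intro mult_left_mono) auto
  qed
  ultimately show ?thesis by (rule that)
qed

end

section \<open>Sobolev membership of the competitors\<close>

lemma test_function_uminus:
  assumes "test_function \<Omega> \<phi>"
  shows "test_function \<Omega> (\<lambda>x. - \<phi> x)"
  using test_function_mult[OF assms C_k_const[of _ "-1"]] by simp

lemma grad_uminus:
  assumes "test_function \<Omega> \<phi>"
  shows "grad (\<lambda>x. - \<phi> x) x = - grad \<phi> x"
proof -
  have "frechet_derivative (\<lambda>x. - \<phi> x) (at x) = (\<lambda>v. - pd \<phi> x v)"
    using frechet_derivative_at[OF has_derivative_minus[OF test_function_has_derivative[OF assms]]] by simp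
  then show ?thesis by (simp add: grad_def sum_negf)
qed

lemma weak_gradient_measurable:
  assumes "open \<Omega>" "G \<in> borel_measurable (lebesgue_on \<Omega>)" "has_weak_gradient \<Omega> u G"
  shows "weak_gradient \<Omega> u \<in> borel_measurable (lebesgue_on \<Omega>)"
  using assms by (intro measurable_lebesgue_on_AE_cong[OF _ assms(2) weak_gradient_AE]) auto

lemma integral_powr_norm_AE_cong:
  assumes "f \<in> borel_measurable M" "g \<in> borel_measurable M" "AE x in M. f x = g x"
  shows "(LINT x|M. norm (f x) powr p) = (LINT x|M. norm (g x) powr p)"
    and "integrable M (\<lambda>x. norm (f x) powr p) \<longleftrightarrow> integrable M (\<lambda>x. norm (g x) powr p)"
proof -
  have m: "(\<lambda>x. norm (f x) powr p) \<in> borel_measurable M" "(\<lambda>x. norm (g x) powr p) \<in> borel_measurable M"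
    using assms(1,2) by measurable
  have ae: "AE x in M. norm (f x) powr p = norm (g x) powr p"
    using assms(3) by eventually_elim simp
  show "(LINT x|M. norm (f x) powr p) = (LINT x|M. norm (g x) powr p)"
    by (rule integral_cong_AE[OF m ae])
  show "integrable M (\<lambda>x. norm (f x) powr p) \<longleftrightarrow> integrable M (\<lambda>x. norm (g x) powr p)"
    by (rule integrable_cong_AE[OF m ae])
qed

context convex_domain
begin

lemma dom_sets: "\<Omega> \<in> sets lebesgue"
  using open_dom by auto

lemma finite_measure_dom: "finite_measure (lebesgue_on \<Omega>)"
proof
  show "emeasure (lebesgue_on \<Omega>) (space (lebesgue_on \<Omega>)) \<noteq> \<infinity>"
    using dom_lmeasurable by (auto simp: emeasure_restrict_space fmeasurable_def)
qed

lemma integrable_const_dom: "integrable (lebesgue_on \<Omega>) (\<lambda>x. c::real)"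
  using finite_measure_dom by (rule finite_measure.integrable_const)

lemma integral_const_dom: "(LINT x|lebesgue_on \<Omega>. c) = measure lebesgue \<Omega> * c" for c :: real
  using dom_sets by (simp add: measure_restrict_space)

lemma bounded_Lp:
  fixes f :: "'a \<Rightarrow> 'b::euclidean_space"
  assumes "f \<in> borel_measurable (lebesgue_on \<Omega>)" "AE x in lebesgue_on \<Omega>. norm (f x) \<le> B" "0 < p"
  shows "f \<in> Lp \<Omega> p"
proof -
  have "integrable (lebesgue_on \<Omega>) (\<lambda>x. norm (f x) powr p)"
  proof (rule Bochner_Integration.integrable_bound[OF integrable_const_dom[of "\<bar>B\<bar> powr p"]])
    show "(\<lambda>x. norm (f x) powr p) \<in> borel_measurable (lebesgue_on \<Omega>)" using assms(1) by measurable
    show "AE x in lebesgue_on \<Omega>. norm (norm (f x) powr p) \<le> norm (\<bar>B\<bar> powr p)"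
      using assms(2)
    proof eventually_elim
      case (elim x)
      then show ?case using assms(3) by (auto intro!: powr_mono2)
    qed
  qed
  then show ?thesis using assms(1) by (simp add: Lp_def)
qed

lemma test_function_measurable:
  assumes "test_function \<Omega>' \<phi>"
  shows "\<phi> \<in> borel_measurable (lebesgue_on \<Omega>)" "grad \<phi> \<in> borel_measurable (lebesgue_on \<Omega>)"
  using measurable_restrict_space1[OF continuous_lebesgue_measurable[OF test_function_continuous[OF assms]]]
    measurable_restrict_space1[OF continuous_lebesgue_measurable[OF grad_continuous[OF assms]]] .

lemma grad_bounded:
  assumes "test_function \<Omega> \<phi>"
  obtains B where "\<And>x. norm (grad \<phi> x) \<le> B"
proof -
  obtain B where B: "B \<ge> 0" "\<And>x y. \<bar>\<phi> x - \<phi> y\<bar> \<le> B * norm (x - y)"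
    using test_function_lipschitz[OF assms] by blast
  have "norm (grad \<phi> x) \<le> B" for x
  proof (rule norm_le_of_inner_le[OF B(1)])
    let ?e = "grad \<phi> x"
    have "(\<lambda>n. (\<phi> (x + inverse (real (Suc n)) *\<^sub>R ?e) - \<phi> x) / inverse (real (Suc n))) \<longlonglongrightarrow> pd \<phi> x ?e"
      by (rule has_derivative_difference_quotient[OF test_function_has_derivative[OF assms] LIMSEQ_h])
    moreover have "(\<phi> (x + inverse (real (Suc n)) *\<^sub>R ?e) - \<phi> x) / inverse (real (Suc n)) \<le> B * norm ?e" for n
    proof -
      have "\<phi> (x + inverse (real (Suc n)) *\<^sub>R ?e) - \<phi> x \<le> B * (inverse (real (Suc n)) * norm ?e)"
        using B(2)[of "x + inverse (real (Suc n)) *\<^sub>R ?e" x] by simp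
      then show ?thesis by (simp add: field_simps)
    qed
    ultimately have "pd \<phi> x ?e \<le> B * norm ?e" by (intro LIMSEQ_le_const2) auto
    then show "?e \<bullet> ?e \<le> B * norm ?e"
      by (simp add: grad_inner[OF test_function_has_derivative[OF assms]])
  qed
  then show ?thesis by (rule that)
qed

lemma test_function_Lp:
  assumes \<phi>: "test_function \<Omega> \<phi>" and p: "0 < p"
  shows "\<phi> \<in> Lp \<Omega> p" "grad \<phi> \<in> Lp \<Omega> p"
proof -
  obtain B where B: "B \<ge> 0" "\<And>x. \<bar>\<phi> x\<bar> \<le> B" using test_function_bounded[OF \<phi>] by blast
  obtain B' where B': "\<And>x. norm (grad \<phi> x) \<le> B'" using grad_bounded[OF \<phi>] by blast
  show "\<phi> \<in> Lp \<Omega> p" by (rule bounded_Lp[OF test_function_measurable(1)[OF \<phi>] _ p, of B]) (use B in simp)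
  show "grad \<phi> \<in> Lp \<Omega> p" by (rule bounded_Lp[OF test_function_measurable(2)[OF \<phi>] _ p, of B']) (use B' in simp)
qed

text \<open>The constant sequence works, but the chosen \<open>weak_gradient\<close> of the zero
  function vanishes only almost everywhere, so its norm has to be computed through the almost
  everywhere identification.\<close>

lemma test_function_W1p_0:
  assumes \<phi>: "test_function \<Omega> \<phi>" and p: "0 < p"
  shows "\<phi> \<in> W1p_0 \<Omega> p"
proof -
  have 1: "\<phi> \<in> W1p \<Omega> p"
    using test_function_Lp[OF assms] has_weak_gradient_test[OF open_dom \<phi>] by (auto simp: W1p_def)
  have wg: "has_weak_gradient \<Omega> (\<lambda>x. 0) (\<lambda>x. 0)" by (rule has_weak_gradient_const[OF open_dom])
  have "(LINT x|lebesgue_on \<Omega>. norm (weak_gradient \<Omega> (\<lambda>x. 0) x) powr p) = (LINT x|lebesgue_on \<Omega>. norm (0::'a) powr p)"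
    by (rule integral_powr_norm_AE_cong(1)[OF weak_gradient_measurable[OF open_dom _ wg] _ weak_gradient_AE[OF open_dom wg]]) auto
  then have "W1p_norm \<Omega> p (\<lambda>x. 0) = 0" using p by (simp add: W1p_norm_def)
  then have "(\<lambda>k::nat. W1p_norm \<Omega> p (\<lambda>x. \<phi> x - \<phi> x)) \<longlonglongrightarrow> 0" by simp
  then show ?thesis unfolding W1p_0_def using 1 \<phi> by (intro CollectI conjI exI[of _ "\<lambda>_. \<phi>"]) auto
qed

lemma W1p_1_competitor:
  assumes l: "0 < l" and \<eta>: "0 < \<eta>" and p: "1 \<le> p" and \<Lambda>: "0 \<le> \<Lambda>"
  obtains u where "u \<in> W1p_1 \<Omega> p"
    "Jp \<Omega> \<Lambda> p l u \<le> measure lebesgue \<Omega> / p + l + \<Lambda> * collar \<Omega> (1 / l + \<eta>)"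
proof -
  obtain \<phi> where \<phi>: "test_function \<Omega> \<phi>" "\<And>x. norm (grad \<phi> x) \<le> l"
    "\<And>x. l * (bdist \<Omega> x - \<eta>) \<le> \<phi> x"
    using smooth_competitor[OF l \<eta>] by blast
  define v where "v x = - \<phi> x" for x
  define u where "u x = 1 + v x" for x
  have v: "test_function \<Omega> v" unfolding v_def by (rule test_function_uminus[OF \<phi>(1)])
  have grad_v: "norm (grad v x) \<le> l" for x
    using \<phi>(2)[of x] grad_uminus[OF \<phi>(1), of x] by (simp add: v_def[abs_def])
  have "v \<in> W1p_0 \<Omega> p" using test_function_W1p_0[OF v, of p] p by simp
  then have uW: "u \<in> W1p_1 \<Omega> p" by (auto simp: W1p_1_def u_def[abs_def])
  have wg: "has_weak_gradient \<Omega> u (grad v)"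
    using has_weak_gradient_add[OF open_dom has_weak_gradient_const[OF open_dom] has_weak_gradient_test[OF open_dom v]]
    by (simp add: u_def[abs_def])
  have "(LINT x|lebesgue_on \<Omega>. (norm (weak_gradient \<Omega> u x) / l) powr p) \<le> (LINT x|lebesgue_on \<Omega>. 1)"
  proof (rule integral_mono_AE'[OF integrable_const_dom])
    show "AE x in lebesgue_on \<Omega>. (norm (weak_gradient \<Omega> u x) / l) powr p \<le> 1"
      using weak_gradient_AE[OF open_dom wg]
    proof eventually_elim
      case (elim x)
      then have "norm (weak_gradient \<Omega> u x) / l \<le> 1" using grad_v[of x] l by simp
      then have "(norm (weak_gradient \<Omega> u x) / l) powr p \<le> 1 powr p"
        using l p by (intro powr_mono2) auto
      then show ?case by simp
    qed
  qed auto
  then have 1: "1 / p * (LINT x|lebesgue_on \<Omega>. (norm (weak_gradient \<Omega> u x) / l) powr p) \<le> measure lebesgue \<Omega> / p"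
    using p unfolding integral_const_dom by (simp add: divide_right_mono)
  have "measure lebesgue {x \<in> \<Omega>. 0 < u x} \<le> collar \<Omega> (1 / l + \<eta>)"
    unfolding collar_def
  proof (rule measure_mono_fmeasurable[OF _ _ collar_lmeasurable])
    show "{x \<in> \<Omega>. 0 < u x} \<subseteq> {x \<in> \<Omega>. bdist \<Omega> x < 1 / l + \<eta>}"
    proof clarify
      fix x assume "0 < u x"
      then have "l * (bdist \<Omega> x - \<eta>) < 1" using \<phi>(3)[of x] by (simp add: u_def v_def)
      then show "bdist \<Omega> x < 1 / l + \<eta>" using l by (simp add: field_simps)
    qed
    have "open {x. 0 < u x}"
      unfolding u_def by (intro open_Collect_less continuous_intros test_function_continuous[OF v])
    then have "open (\<Omega> \<inter> {x. 0 < u x})" using open_dom by blast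
    moreover have "\<Omega> \<inter> {x. 0 < u x} = {x \<in> \<Omega>. 0 < u x}" by blast
    ultimately show "{x \<in> \<Omega>. 0 < u x} \<in> sets lebesgue" by (metis borel_open sets_completionI_sets sets_lborel)
  qed
  then have "(p - 1) / p * \<Lambda> * measure lebesgue {x \<in> \<Omega>. 0 < u x} \<le> 1 * \<Lambda> * collar \<Omega> (1 / l + \<eta>)"
    using p \<Lambda> by (intro mult_mono) auto
  then have "Jp \<Omega> \<Lambda> p l u \<le> measure lebesgue \<Omega> / p + l + \<Lambda> * collar \<Omega> (1 / l + \<eta>)"
    using 1 by (simp add: Jp_def)
  with uW show ?thesis by (rule that)
qed

section \<open>The double infimum and its upper bound\<close>

lemma Jp_nonneg:
  assumes "1 / inradius \<Omega> \<le> l" "1 \<le> p" "0 \<le> \<Lambda>"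
  shows "l \<le> Jp \<Omega> \<Lambda> p l u" "0 \<le> Jp \<Omega> \<Lambda> p l u"
proof -
  have l: "0 < l" using assms(1) inradius_inverse_pos by linarith
  have "0 \<le> 1 / p * (LINT x|lebesgue_on \<Omega>. (norm (weak_gradient \<Omega> u x) / l) powr p)"
    using assms(2) by (intro mult_nonneg_nonneg integral_nonneg_AE) auto
  moreover have "0 \<le> (p - 1) / p * \<Lambda> * measure lebesgue {x \<in> \<Omega>. 0 < u x}"
    using assms by (intro mult_nonneg_nonneg) auto
  ultimately show "l \<le> Jp \<Omega> \<Lambda> p l u" by (simp add: Jp_def)
  then show "0 \<le> Jp \<Omega> \<Lambda> p l u" using l by simp
qed

lemma W1p_1_nonempty: "1 \<le> p \<Longrightarrow> W1p_1 \<Omega> p \<noteq> {}"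
  using W1p_1_competitor[of 1 1 p 0] by auto

definition inf_Jp :: "real \<Rightarrow> real \<Rightarrow> real" where
  "inf_Jp \<Lambda> p = (INF l\<in>{1 / inradius \<Omega>..}. INF u\<in>W1p_1 \<Omega> p. Jp \<Omega> \<Lambda> p l u)"

lemma inf_Jp_le:
  assumes "1 / inradius \<Omega> \<le> l" "1 \<le> p" "0 \<le> \<Lambda>" "u \<in> W1p_1 \<Omega> p"
  shows "inf_Jp \<Lambda> p \<le> Jp \<Omega> \<Lambda> p l u"
proof -
  have "inf_Jp \<Lambda> p \<le> (INF u\<in>W1p_1 \<Omega> p. Jp \<Omega> \<Lambda> p l u)"
    unfolding inf_Jp_def
  proof (rule cINF_lower)
    show "bdd_below ((\<lambda>l. INF u\<in>W1p_1 \<Omega> p. Jp \<Omega> \<Lambda> p l u) ` {1 / inradius \<Omega>..})"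
      using assms W1p_1_nonempty by (intro bdd_belowI2[of _ 0] cINF_greatest Jp_nonneg(2)) auto
  qed (use assms in simp)
  also have "\<dots> \<le> Jp \<Omega> \<Lambda> p l u"
    using assms by (intro cINF_lower bdd_belowI2[of _ 0] Jp_nonneg(2)) auto
  finally show ?thesis .
qed

lemma inf_Jp_ge:
  assumes "1 \<le> p" "\<And>l u. 1 / inradius \<Omega> \<le> l \<Longrightarrow> u \<in> W1p_1 \<Omega> p \<Longrightarrow> c \<le> Jp \<Omega> \<Lambda> p l u"
  shows "c \<le> inf_Jp \<Lambda> p"
  unfolding inf_Jp_def using assms W1p_1_nonempty by (intro cINF_greatest) auto

lemma inf_Jp_upper:
  assumes \<Lambda>: "0 \<le> \<Lambda>" and \<epsilon>: "0 < \<epsilon>" and p: "1 \<le> p"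
  shows "inf_Jp \<Lambda> p \<le> measure lebesgue \<Omega> / p + radial_min \<Lambda> + \<epsilon>"
proof -
  obtain l0 where l0: "1 / inradius \<Omega> \<le> l0" "l0 + \<Lambda> * collar \<Omega> (1 / l0) = radial_min \<Lambda>"
    using radial_min_attained[OF \<Lambda>] by blast
  have pos: "0 < l0" using l0(1) inradius_inverse_pos by linarith
  \<comment> \<open>Raising the slope by \<epsilon> leaves room \<eta> for smoothing:
    \<open>1 / l + \<eta>\<close> is exactly \<open>1 / l0\<close>, so the competitor's collar bound
    is that of the minimiser.\<close>
  define l where "l = l0 + \<epsilon>"
  define \<eta> where "\<eta> = 1 / l0 - 1 / l"
  have l: "0 < l" "1 / inradius \<Omega> \<le> l" using pos l0(1) \<epsilon> by (auto simp: l_def)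
  have "1 / l < 1 / l0" using pos \<epsilon> by (intro divide_strict_left_mono) (auto simp: l_def)
  then have "0 < \<eta>" by (simp add: \<eta>_def)
  obtain u where u: "u \<in> W1p_1 \<Omega> p"
    "Jp \<Omega> \<Lambda> p l u \<le> measure lebesgue \<Omega> / p + l + \<Lambda> * collar \<Omega> (1 / l + \<eta>)"
    using W1p_1_competitor[OF l(1) \<open>0 < \<eta>\<close> p \<Lambda>] by blast
  have "inf_Jp \<Lambda> p \<le> Jp \<Omega> \<Lambda> p l u" by (rule inf_Jp_le[OF l(2) p \<Lambda> u(1)])
  also have "\<dots> \<le> measure lebesgue \<Omega> / p + l0 + \<epsilon> + \<Lambda> * collar \<Omega> (1 / l0)"
    using u(2) by (simp add: l_def \<eta>_def)
  finally show ?thesis using l0(2) by simp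
qed

end

section \<open>A Poincare inequality on slabs\<close>

lemma powr_convex_nonneg:
  assumes p: "1 \<le> (p::real)"
  shows "convex_on {0..} (\<lambda>x::real. x powr p)"
proof (rule convex_onI)
  fix t x y :: real assume t: "0 < t" "t < 1" and xy: "x \<in> {0..}" "y \<in> {0..}"
  have le: "(t * z) powr p \<le> t * z powr p" if "0 < t" "t < 1" "0 \<le> z" for t z :: real
  proof -
    have "t powr p \<le> t powr 1" using that p by (intro powr_mono') auto
    then show ?thesis using that by (simp add: powr_mult mult_right_mono)
  qed
  consider "x = 0" | "y = 0" | "0 < x" "0 < y" using xy by fastforce
  then show "((1 - t) *\<^sub>R x + t *\<^sub>R y) powr p \<le> (1 - t) * x powr p + t * y powr p"
  proof cases
    case 1
    then show ?thesis using le[of t y] t xy p by simp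
  next
    case 2
    then show ?thesis using le[of "1 - t" x] t xy p by simp
  next
    case 3
    then show ?thesis using convex_onD[OF powr_convex[OF p], of t x y] t by simp
  qed
qed simp

text \<open>Jensen's inequality with weights 1 - \<tau> and \<tau>. As \<tau> tends to 0 the first
  constant tends to 1, so the main term keeps its sharp constant; the second, which blows up,
  multiplies only vanishing errors.\<close>

lemma powr_add_le:
  fixes a b p \<tau> :: real
  assumes "1 \<le> p" "0 < \<tau>" "\<tau> < 1" "0 \<le> a" "0 \<le> b"
  shows "(a + b) powr p \<le> (1 - \<tau>) powr (1 - p) * a powr p + \<tau> powr (1 - p) * b powr p"
proof -
  have "((1 - \<tau>) *\<^sub>R (a / (1 - \<tau>)) + \<tau> *\<^sub>R (b / \<tau>)) powr p \<le> (1 - \<tau>) * (a / (1 - \<tau>)) powr p + \<tau> * (b / \<tau>) powr p"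
    using assms by (intro convex_onD[OF powr_convex_nonneg]) auto
  moreover have "s * (c / s) powr p = s powr (1 - p) * c powr p" if "0 < s" "0 \<le> c" for s c :: real
    using that by (simp add: powr_divide powr_diff)
  ultimately show ?thesis using assms by simp
qed

text \<open>Jensen's inequality with equal weights. The power p - 1 of \<open>N\<close> combines
  with N integrals over steps of length s / N to give exactly s^p.\<close>

lemma powr_sum_le:
  fixes a :: "nat \<Rightarrow> real"
  assumes p: "1 \<le> p" and a: "\<And>j. 0 \<le> a j" and N: "0 < N"
  shows "(\<Sum>j<N. a j) powr p \<le> real N powr (p - 1) * (\<Sum>j<N. a j powr p)"
proof -
  have "(\<Sum>j<N. (1 / real N) *\<^sub>R a j) powr p \<le> (\<Sum>j<N. (1 / real N) * a j powr p)"
    using N a by (intro convex_on_sum[OF _ _ powr_convex_nonneg[OF p]]) auto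
  also have "(\<Sum>j<N. (1 / real N) *\<^sub>R a j) = (\<Sum>j<N. a j) / N" by (simp add: sum_divide_distrib)
  also have "(\<Sum>j<N. (1 / real N) * a j powr p) = (\<Sum>j<N. a j powr p) / N" by (simp add: sum_divide_distrib)
  finally have "(\<Sum>j<N. a j) powr p / real N powr p \<le> (\<Sum>j<N. a j powr p) / N"
    using a by (simp add: powr_divide sum_nonneg)
  then have "(\<Sum>j<N. a j) powr p \<le> real N powr p * ((\<Sum>j<N. a j powr p) / N)"
    using N by (simp add: field_simps)
  also have "\<dots> = real N powr (p - 1) * (\<Sum>j<N. a j powr p)" using N by (simp add: powr_diff)
  finally show ?thesis .
qed

lemma continuous_compact_support_integrable:
  fixes f :: "'a::euclidean_space \<Rightarrow> real"
  assumes "continuous_on UNIV f" "compact K" "\<And>x. x \<notin> K \<Longrightarrow> f x = 0"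
  shows "integrable lebesgue f"
proof -
  have "f absolutely_integrable_on K"
    using continuous_on_subset[OF assms(1)] by (intro absolutely_integrable_continuous_compact assms(2)) auto
  moreover have "(\<lambda>x. indicator K x *\<^sub>R f x) = f" using assms(3) by (intro ext) (auto simp: indicator_def)
  ultimately show ?thesis by (simp add: set_integrable_def)
qed

context convex_domain
begin

definition slab :: "'a \<Rightarrow> real \<Rightarrow> 'a set" where
  "slab e s = {x \<in> \<Omega>. support_fun \<Omega> e - x \<bullet> e < s}"

lemma slab_lmeasurable: "slab e s \<in> lmeasurable"
proof -
  have "open {x. support_fun \<Omega> e - x \<bullet> e < s}"
    by (intro open_Collect_less continuous_intros)
  then have "open (\<Omega> \<inter> {x. support_fun \<Omega> e - x \<bullet> e < s})" using open_dom by blast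
  moreover have "\<Omega> \<inter> {x. support_fun \<Omega> e - x \<bullet> e < s} = slab e s" by (auto simp: slab_def)
  ultimately show ?thesis using bounded_dom by (intro lmeasurable_open) (auto simp: slab_def intro: bounded_subset)
qed

lemma slab_sets: "slab e s \<in> sets (lebesgue_on \<Omega>)"
proof -
  have "slab e s = \<Omega> \<inter> slab e s" by (auto simp: slab_def)
  then show ?thesis using slab_lmeasurable[of e s] dom_sets
    by (metis fmeasurableD sets_restrict_space image_eqI)
qed

text \<open>A discrete form of integrating along lines: from a slab point, \<open>Suc n\<close>
  steps of length \<tau> n in direction \<open>e\<close> lead out of \<Omega>, so
  \<open>\<phi> x\<close> telescopes into increments. Jensen and translation invariance bound the
  integral by difference quotients, and refining the steps replaces these by the derivative.\<close>

lemma test_function_slab_le: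
  assumes \<phi>: "test_function \<Omega> \<phi>" and e: "norm e = 1" and s: "0 < s" and p: "1 \<le> p"
  shows "(LINT x|lebesgue. indicator (slab e s) x * \<bar>\<phi> x\<bar> powr p) \<le>
    s powr p * (LINT x|lebesgue. \<bar>pd \<phi> x e\<bar> powr p)"
proof -
  define \<tau> where "\<tau> n = s / real (Suc n)" for n
  have \<tau>: "0 < \<tau> n" "\<tau> n \<le> s" "real (Suc n) * \<tau> n = s" for n using s by (auto simp: \<tau>_def field_simps)
  have \<tau>0: "\<tau> \<longlonglongrightarrow> 0"
    unfolding \<tau>_def[abs_def] divide_inverse using tendsto_mult_right_zero[OF LIMSEQ_inverse_real_of_nat] .
  define \<Delta> where "\<Delta> n x = \<bar>\<phi> (x + \<tau> n *\<^sub>R e) - \<phi> x\<bar>" for n x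
  have cont\<phi>: "continuous_on UNIV \<phi>" by (rule test_function_continuous[OF \<phi>])
  have cont\<Delta>: "continuous_on UNIV (\<lambda>x. \<Delta> n x powr p)" for n
    unfolding \<Delta>_def using p
    by (intro continuous_on_powr' continuous_intros continuous_on_compose2[OF cont\<phi>]) auto
  obtain r where r: "\<And>x t. \<phi> (x + t *\<^sub>R e) \<noteq> 0 \<Longrightarrow> norm x \<le> r + \<bar>t\<bar> * norm e"
    using test_function_support_radius[OF \<phi>] by metis
  define K where "K = cball (0::'a) (r + s)"
  have z: "\<phi> (x + t *\<^sub>R e) = 0" if "x \<notin> K" "0 \<le> t" "t \<le> s" for x t
    using r[of x t] that e by (force simp: K_def)
  have \<Delta>_out: "\<Delta> n x powr p = 0" if "x \<notin> K" for n x
    using z[OF that, of 0] z[OF that, of "\<tau> n"] \<tau>[of n] s p by (simp add: \<Delta>_def)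
  have compK: "compact K" by (simp add: K_def)
  have int\<Delta>: "integrable lebesgue (\<lambda>x. \<Delta> n x powr p)" for n
    by (rule continuous_compact_support_integrable[OF cont\<Delta> compK \<Delta>_out])
  have int\<Delta>': "integrable lebesgue (\<lambda>x. \<Delta> n (x + a) powr p)"
    and tr: "(LINT x|lebesgue. \<Delta> n (x + a) powr p) = (LINT x|lebesgue. \<Delta> n x powr p)" for n a
    using lebesgue_integral_translate[OF borel_measurable_continuous_onI[OF cont\<Delta>[of n]], of a] int\<Delta>[of n] by simp_all
  define I where "I = (LINT x|lebesgue. indicator (slab e s) x * \<bar>\<phi> x\<bar> powr p)"
  have step: "I \<le> s powr p * (LINT x|lebesgue. (\<Delta> n x / \<tau> n) powr p)" for n
  proof -
    let ?N = "Suc n"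
    have pt: "indicator (slab e s) x * \<bar>\<phi> x\<bar> powr p \<le>
        real ?N powr (p - 1) * (\<Sum>j<?N. \<Delta> n (x + (real j * \<tau> n) *\<^sub>R e) powr p)" for x
    proof (cases "x \<in> slab e s")
      case True
      have "x + s *\<^sub>R e \<notin> \<Omega>"
      proof
        assume "x + s *\<^sub>R e \<in> \<Omega>"
        from support_fun_ge[OF this, of e] True e show False
          by (simp add: slab_def inner_add_left dot_square_norm)
      qed
      then have out: "\<phi> (x + s *\<^sub>R e) = 0" by (rule test_function_eq_0[OF \<phi>])
      have "(\<Sum>j<?N. \<phi> (x + (real (Suc j) * \<tau> n) *\<^sub>R e) - \<phi> (x + (real j * \<tau> n) *\<^sub>R e)) =
          \<phi> (x + (real ?N * \<tau> n) *\<^sub>R e) - \<phi> (x + (real 0 * \<tau> n) *\<^sub>R e)"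
        by (rule sum_lessThan_telescope)
      also have "\<dots> = - \<phi> x" unfolding \<tau>(3) by (simp add: out)
      finally have "\<bar>\<phi> x\<bar> = \<bar>\<Sum>j<?N. \<phi> (x + (real (Suc j) * \<tau> n) *\<^sub>R e) - \<phi> (x + (real j * \<tau> n) *\<^sub>R e)\<bar>"
        by simp
      also have "\<dots> \<le> (\<Sum>j<?N. \<Delta> n (x + (real j * \<tau> n) *\<^sub>R e))"
        by (rule order_trans[OF sum_abs]) (auto simp: \<Delta>_def algebra_simps intro!: sum_mono)
      finally have "\<bar>\<phi> x\<bar> powr p \<le> (\<Sum>j<?N. \<Delta> n (x + (real j * \<tau> n) *\<^sub>R e)) powr p"
        using p by (intro powr_mono2) auto
      also have "\<dots> \<le> real ?N powr (p - 1) * (\<Sum>j<?N. \<Delta> n (x + (real j * \<tau> n) *\<^sub>R e) powr p)"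
        by (rule powr_sum_le[OF p]) (auto simp: \<Delta>_def)
      finally show ?thesis using True by simp
    next
      case False
      then show ?thesis by (simp add: sum_nonneg)
    qed
    have "I \<le> (LINT x|lebesgue. real ?N powr (p - 1) * (\<Sum>j<?N. \<Delta> n (x + (real j * \<tau> n) *\<^sub>R e) powr p))"
      unfolding I_def using pt int\<Delta>'
      by (intro integral_mono_AE' AE_I2 integrable_mult_right Bochner_Integration.integrable_sum) (auto simp: sum_nonneg)
    also have "\<dots> = real ?N powr (p - 1) * (\<Sum>j<?N. LINT x|lebesgue. \<Delta> n (x + (real j * \<tau> n) *\<^sub>R e) powr p)"
      using int\<Delta>' by (simp only: integral_mult_right_zero Bochner_Integration.integral_sum)
    \<comment> \<open>All \<open>?N\<close> translated integrals are equal, which raises the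
      exponent from p - 1 to p.\<close>
    also have "\<dots> = real ?N powr p * (LINT x|lebesgue. \<Delta> n x powr p)"
      unfolding tr by (simp add: powr_diff)
    also have "(LINT x|lebesgue. \<Delta> n x powr p) = \<tau> n powr p * (LINT x|lebesgue. (\<Delta> n x / \<tau> n) powr p)"
      using \<tau>[of n] by (simp add: powr_divide \<Delta>_def)
    also have "real ?N powr p * (\<tau> n powr p * (LINT x|lebesgue. (\<Delta> n x / \<tau> n) powr p)) =
        s powr p * (LINT x|lebesgue. (\<Delta> n x / \<tau> n) powr p)"
      using \<tau>[of n] powr_mult[of "real ?N" "\<tau> n" p] by simp
    finally show ?thesis .
  qed
  obtain B where B: "B \<ge> 0" "\<And>x y. \<bar>\<phi> x - \<phi> y\<bar> \<le> B * norm (x - y)"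
    using test_function_lipschitz[OF \<phi>] by blast
  have "(\<lambda>n. LINT x|lebesgue. (\<Delta> n x / \<tau> n) powr p) \<longlonglongrightarrow> (LINT x|lebesgue. \<bar>pd \<phi> x e\<bar> powr p)"
  proof (rule integral_dominated_convergence[where w = "\<lambda>x. indicator K x * B powr p"])
    show "integrable lebesgue (\<lambda>x. indicator K x * B powr p :: real)"
      using lmeasurable_compact[OF compK] by (intro integrable_mult_left integrable_real_indicator) (auto simp: fmeasurable_def)
    show "(\<lambda>x. \<bar>pd \<phi> x e\<bar> powr p) \<in> borel_measurable lebesgue"
      using p by (intro continuous_lebesgue_measurable continuous_on_powr' continuous_intros
          test_function_continuous[OF test_function_partial[OF \<phi>]]) auto
    show "(\<lambda>x. (\<Delta> n x / \<tau> n) powr p) \<in> borel_measurable lebesgue" for n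
      unfolding \<Delta>_def using p \<tau>[of n]
      by (intro continuous_lebesgue_measurable continuous_on_powr' continuous_intros continuous_on_compose2[OF cont\<phi>]) auto
    show "AE x in lebesgue. (\<lambda>n. (\<Delta> n x / \<tau> n) powr p) \<longlonglongrightarrow> \<bar>pd \<phi> x e\<bar> powr p"
    proof (rule AE_I2)
      fix x
      have "(\<lambda>n. (\<phi> (x + \<tau> n *\<^sub>R e) - \<phi> x) / \<tau> n) \<longlonglongrightarrow> pd \<phi> x e"
        using \<tau> by (intro has_derivative_difference_quotient[OF test_function_has_derivative[OF \<phi>] \<tau>0])
          (metis less_irrefl)
      then have "(\<lambda>n. \<bar>(\<phi> (x + \<tau> n *\<^sub>R e) - \<phi> x) / \<tau> n\<bar> powr p) \<longlonglongrightarrow> \<bar>pd \<phi> x e\<bar> powr p"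
        using p by (intro tendsto_powr' tendsto_rabs tendsto_const) auto
      moreover have "\<bar>(\<phi> (x + \<tau> n *\<^sub>R e) - \<phi> x) / \<tau> n\<bar> = \<Delta> n x / \<tau> n" for n
        using \<tau>(1)[of n] by (simp add: \<Delta>_def)
      ultimately show "(\<lambda>n. (\<Delta> n x / \<tau> n) powr p) \<longlonglongrightarrow> \<bar>pd \<phi> x e\<bar> powr p" by simp
    qed
    show "AE x in lebesgue. norm ((\<Delta> n x / \<tau> n) powr p) \<le> indicator K x * B powr p" for n
    proof (rule AE_I2)
      fix x
      show "norm ((\<Delta> n x / \<tau> n) powr p) \<le> indicator K x * B powr p"
      proof (cases "x \<in> K")
        case True
        have "\<Delta> n x \<le> B * \<tau> n" using B(2)[of "x + \<tau> n *\<^sub>R e" x] \<tau>(1)[of n] e by (simp add: \<Delta>_def)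
        then have "\<Delta> n x / \<tau> n \<le> B" using \<tau>(1)[of n] by (simp add: field_simps)
        moreover have "0 \<le> \<Delta> n x / \<tau> n" using \<tau>(1)[of n] by (simp add: \<Delta>_def)
        ultimately show ?thesis using True p by (simp add: powr_mono2)
      next
        case False
        then have "\<Delta> n x = 0" using \<Delta>_out[OF False, of n] by simp
        then show ?thesis using False p by simp
      qed
    qed
  qed
  then have "(\<lambda>n. s powr p * (LINT x|lebesgue. (\<Delta> n x / \<tau> n) powr p)) \<longlonglongrightarrow>
      s powr p * (LINT x|lebesgue. \<bar>pd \<phi> x e\<bar> powr p)"
    by (intro tendsto_mult tendsto_const)
  then show ?thesis unfolding I_def[symmetric] by (rule LIMSEQ_le_const) (use step in auto)
qed

end

section \<open>Extending the slab inequality by density\<close>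

lemma norm_add_powr_le:
  fixes x y :: "'b::real_normed_vector"
  assumes "1 \<le> p" "0 < \<tau>" "\<tau> < 1"
  shows "norm (x + y) powr p \<le> (1 - \<tau>) powr (1 - p) * norm x powr p + \<tau> powr (1 - p) * norm y powr p"
proof -
  have "norm (x + y) powr p \<le> (norm x + norm y) powr p"
    using assms(1) by (intro powr_mono2 norm_triangle_ineq) auto
  also have "\<dots> \<le> (1 - \<tau>) powr (1 - p) * norm x powr p + \<tau> powr (1 - p) * norm y powr p"
    using assms by (intro powr_add_le) auto
  finally show ?thesis .
qed

lemma Lp_diff:
  fixes f g :: "'a::euclidean_space \<Rightarrow> 'b::euclidean_space"
  assumes f: "f \<in> Lp \<Omega> p" and g: "g \<in> Lp \<Omega> p" and p: "1 \<le> p"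
  shows "(\<lambda>x. f x - g x) \<in> Lp \<Omega> p"
proof -
  define c where "c = (1 / 2 :: real) powr (1 - p)"
  have m: "(\<lambda>x. f x - g x) \<in> borel_measurable (lebesgue_on \<Omega>)"
    using f g by (intro borel_measurable_diff) (auto simp: Lp_def)
  have "integrable (lebesgue_on \<Omega>) (\<lambda>x. norm (f x - g x) powr p)"
  proof (rule Bochner_Integration.integrable_bound[where f = "\<lambda>x. c * norm (f x) powr p + c * norm (g x) powr p"])
    show "integrable (lebesgue_on \<Omega>) (\<lambda>x. c * norm (f x) powr p + c * norm (g x) powr p)"
      using f g by (auto simp: Lp_def)
    show "(\<lambda>x. norm (f x - g x) powr p) \<in> borel_measurable (lebesgue_on \<Omega>)" using m by measurable
    show "AE x in lebesgue_on \<Omega>. norm (norm (f x - g x) powr p) \<le> norm (c * norm (f x) powr p + c * norm (g x) powr p)"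
    proof (rule AE_I2)
      fix x
      have "norm (f x - g x) powr p \<le> c * norm (f x) powr p + c * norm (g x) powr p"
        using norm_add_powr_le[OF p, of "1 / 2" "f x" "- g x"] by (simp add: c_def)
      then show "norm (norm (f x - g x) powr p) \<le> norm (c * norm (f x) powr p + c * norm (g x) powr p)" by simp
    qed
  qed
  then show ?thesis using m by (simp add: Lp_def)
qed

lemma integral_norm_add_powr_le:
  fixes f g :: "'a \<Rightarrow> 'b::euclidean_space"
  assumes p: "1 \<le> p" and \<tau>: "0 < \<tau>" "\<tau> < 1" and A: "A \<in> sets M"
    and i: "integrable M (\<lambda>x. norm (f x) powr p)" "integrable M (\<lambda>x. norm (g x) powr p)"
  shows "(LINT x|M. indicator A x * norm (f x + g x) powr p) \<le>
    (1 - \<tau>) powr (1 - p) * (LINT x|M. indicator A x * norm (f x) powr p) + \<tau> powr (1 - p) * (LINT x|M. norm (g x) powr p)"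
proof -
  let ?a = "(1 - \<tau>) powr (1 - p)" and ?b = "\<tau> powr (1 - p)"
  have iA: "integrable M (\<lambda>x. indicator A x * norm (f x) powr p)"
    using integrable_mult_indicator[OF A i(1)] by simp
  have "(LINT x|M. indicator A x * norm (f x + g x) powr p) \<le>
      (LINT x|M. ?a * (indicator A x * norm (f x) powr p) + ?b * norm (g x) powr p)"
  proof (rule integral_mono_AE')
    show "integrable M (\<lambda>x. ?a * (indicator A x * norm (f x) powr p) + ?b * norm (g x) powr p)"
      using iA i(2) by simp
    show "AE x in M. indicator A x * norm (f x + g x) powr p \<le> ?a * (indicator A x * norm (f x) powr p) + ?b * norm (g x) powr p"
      by (intro AE_I2) (auto simp: indicator_def intro: norm_add_powr_le[OF p \<tau>])
  qed auto
  also have "\<dots> = ?a * (LINT x|M. indicator A x * norm (f x) powr p) + ?b * (LINT x|M. norm (g x) powr p)"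
    using iA i(2) by simp
  finally show ?thesis .
qed

context convex_domain
begin

lemma W1p_weak_gradient:
  assumes "v \<in> W1p \<Omega> p"
  shows "has_weak_gradient \<Omega> v (weak_gradient \<Omega> v)" "weak_gradient \<Omega> v \<in> Lp \<Omega> p"
proof -
  obtain G where G: "G \<in> Lp \<Omega> p" "has_weak_gradient \<Omega> v G" using assms by (auto simp: W1p_def)
  show "has_weak_gradient \<Omega> v (weak_gradient \<Omega> v)" by (rule has_weak_gradient_weak_gradient[OF G(2)])
  have mG: "G \<in> borel_measurable (lebesgue_on \<Omega>)" using G(1) by (simp add: Lp_def)
  have m: "weak_gradient \<Omega> v \<in> borel_measurable (lebesgue_on \<Omega>)"
    by (rule weak_gradient_measurable[OF open_dom mG G(2)])
  then show "weak_gradient \<Omega> v \<in> Lp \<Omega> p"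
    using integral_powr_norm_AE_cong(2)[OF m mG weak_gradient_AE[OF open_dom G(2)], of p] G(1) by (simp add: Lp_def)
qed

text \<open>Two successive limits: for fixed \<tau> the approximation errors vanish as
  \<open>k\<close> grows, and then \<tau> \<longrightarrow> 0 sends the remaining constants to 1.
  Both passages, from \<open>v\<close> to \<open>\<phi> k\<close> and from the gradient of
  \<open>\<phi> k\<close> back to \<open>G\<close>, cost the same factor.\<close>

lemma W1p_0_slab_le:
  assumes v: "v \<in> W1p_0 \<Omega> p" and e: "norm e = 1" and s: "0 < s" and p: "1 \<le> p"
  shows "(LINT x|lebesgue_on \<Omega>. indicator (slab e s) x * norm (v x) powr p) \<le>
    s powr p * (LINT x|lebesgue_on \<Omega>. norm (weak_gradient \<Omega> v x) powr p)"
proof -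
  define G where "G = weak_gradient \<Omega> v"
  have vW: "v \<in> W1p \<Omega> p" using v by (simp add: W1p_0_def)
  obtain \<phi> where \<phi>: "\<And>k::nat. test_function \<Omega> (\<phi> k)" "(\<lambda>k. W1p_norm \<Omega> p (\<lambda>x. v x - \<phi> k x)) \<longlonglongrightarrow> 0"
    using v by (auto simp: W1p_0_def)
  have vL: "v \<in> Lp \<Omega> p" using vW by (simp add: W1p_def)
  have GL: "G \<in> Lp \<Omega> p" and wg: "has_weak_gradient \<Omega> v G" using W1p_weak_gradient[OF vW] by (auto simp: G_def)
  have p0: "0 < p" using p by simp
  note \<phi>L = test_function_Lp[OF \<phi>(1) p0]
  define A where "A k = (LINT x|lebesgue_on \<Omega>. norm (v x - \<phi> k x) powr p)" for k
  define B where "B k = (LINT x|lebesgue_on \<Omega>. norm (G x - grad (\<phi> k) x) powr p)" for k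
  have AB_nn: "0 \<le> A k" "0 \<le> B k" for k by (auto simp: A_def B_def intro!: integral_nonneg_AE)
  have norm_eq: "W1p_norm \<Omega> p (\<lambda>x. v x - \<phi> k x) = (A k + B k) powr (1 / p)" for k
  proof -
    have wg': "has_weak_gradient \<Omega> (\<lambda>x. v x - \<phi> k x) (\<lambda>x. G x - grad (\<phi> k) x)"
      by (rule has_weak_gradient_diff[OF open_dom wg has_weak_gradient_test[OF open_dom \<phi>(1)]])
    have m: "(\<lambda>x. G x - grad (\<phi> k) x) \<in> borel_measurable (lebesgue_on \<Omega>)"
      using Lp_diff[OF GL \<phi>L(2)[of k] p] by (simp add: Lp_def)
    have "(LINT x|lebesgue_on \<Omega>. norm (weak_gradient \<Omega> (\<lambda>x. v x - \<phi> k x) x) powr p) = B k"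
      unfolding B_def
      by (rule integral_powr_norm_AE_cong(1)[OF weak_gradient_measurable[OF open_dom m wg'] m weak_gradient_AE[OF open_dom wg']])
    then show ?thesis by (simp add: W1p_norm_def A_def)
  qed
  have "(\<lambda>k. ((A k + B k) powr (1 / p)) powr p) \<longlonglongrightarrow> 0 powr p"
    using \<phi>(2) p0 unfolding norm_eq by (intro tendsto_powr' tendsto_const) auto
  then have AB: "(\<lambda>k. A k + B k) \<longlonglongrightarrow> 0" using p0 AB_nn by (simp add: powr_powr)
  have A0: "A \<longlonglongrightarrow> 0"
    by (rule tendsto_sandwich[OF _ _ tendsto_const AB]) (use AB_nn in auto)
  have B0: "B \<longlonglongrightarrow> 0"
    by (rule tendsto_sandwich[OF _ _ tendsto_const AB]) (use AB_nn in auto)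
  define X where "X = (LINT x|lebesgue_on \<Omega>. indicator (slab e s) x * norm (v x) powr p)"
  define Y where "Y = (LINT x|lebesgue_on \<Omega>. norm (G x) powr p)"
  have dom_in: "\<Omega> \<in> sets (lebesgue_on \<Omega>)" using sets.top[of "lebesgue_on \<Omega>"] by simp
  have bound: "X \<le> (1 - \<tau>) powr (1 - p) * (s powr p * ((1 - \<tau>) powr (1 - p) * Y))" if \<tau>: "0 < \<tau>" "\<tau> < 1" for \<tau>
  proof -
    let ?a = "(1 - \<tau>) powr (1 - p)" and ?b = "\<tau> powr (1 - p)"
    have step: "X \<le> ?a * (s powr p * (?a * Y + ?b * B k)) + ?b * A k" for k
    proof -
      have i: "integrable (lebesgue_on \<Omega>) (\<lambda>x. norm (\<phi> k x) powr p)"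
        "integrable (lebesgue_on \<Omega>) (\<lambda>x. norm (v x - \<phi> k x) powr p)"
        "integrable (lebesgue_on \<Omega>) (\<lambda>x. norm (G x) powr p)"
        "integrable (lebesgue_on \<Omega>) (\<lambda>x. norm (grad (\<phi> k) x - G x) powr p)"
        "integrable (lebesgue_on \<Omega>) (\<lambda>x. norm (grad (\<phi> k) x) powr p)"
        using \<phi>L[of k] Lp_diff[OF vL \<phi>L(1)[of k] p] GL Lp_diff[OF \<phi>L(2)[of k] GL p] by (auto simp: Lp_def)
      have 1: "X \<le> ?a * (LINT x|lebesgue_on \<Omega>. indicator (slab e s) x * norm (\<phi> k x) powr p) + ?b * A k"
        using integral_norm_add_powr_le[OF p \<tau> slab_sets i(1,2)] by (simp add: X_def A_def)
      have "(LINT x|lebesgue_on \<Omega>. indicator (slab e s) x * norm (\<phi> k x) powr p) =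
          (LINT x|lebesgue. indicator (slab e s) x * \<bar>\<phi> k x\<bar> powr p)"
        using dom_sets by (subst lebesgue_on_integral_eq) (auto simp: slab_def)
      also have "\<dots> \<le> s powr p * (LINT x|lebesgue. \<bar>pd (\<phi> k) x e\<bar> powr p)"
        by (rule test_function_slab_le[OF \<phi>(1) e s p])
      also have "(LINT x|lebesgue. \<bar>pd (\<phi> k) x e\<bar> powr p) =
          (LINT x|lebesgue_on \<Omega>. \<bar>pd (\<phi> k) x e\<bar> powr p)"
        using dom_sets p0 by (subst lebesgue_on_integral_eq) (auto simp: test_derivative_outside[OF \<phi>(1)])
      also have "\<dots> \<le> (LINT x|lebesgue_on \<Omega>. norm (grad (\<phi> k) x) powr p)"
      proof (rule integral_mono_AE'[OF i(5)])
        show "AE x in lebesgue_on \<Omega>. \<bar>pd (\<phi> k) x e\<bar> powr p \<le> norm (grad (\<phi> k) x) powr p"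
        proof (rule AE_I2)
          fix x
          have "\<bar>grad (\<phi> k) x \<bullet> e\<bar> \<le> norm (grad (\<phi> k) x)"
            using Cauchy_Schwarz_ineq2[of "grad (\<phi> k) x" e] e by simp
          then show "\<bar>pd (\<phi> k) x e\<bar> powr p \<le> norm (grad (\<phi> k) x) powr p"
            unfolding grad_inner[OF test_function_has_derivative[OF \<phi>(1)]] using p0 by (intro powr_mono2) auto
        qed
      qed auto
      finally have 2: "(LINT x|lebesgue_on \<Omega>. indicator (slab e s) x * norm (\<phi> k x) powr p) \<le>
          s powr p * (LINT x|lebesgue_on \<Omega>. norm (grad (\<phi> k) x) powr p)" by (simp add: mult_left_mono)
      have ind: "(LINT x|lebesgue_on \<Omega>. indicator \<Omega> x * f x) = (LINT x|lebesgue_on \<Omega>. f x)" for f :: "'a \<Rightarrow> real"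
        by (rule Bochner_Integration.integral_cong) auto
      have 3: "(LINT x|lebesgue_on \<Omega>. norm (grad (\<phi> k) x) powr p) \<le> ?a * Y + ?b * B k"
        using integral_norm_add_powr_le[OF p \<tau> dom_in i(3,4)]
        by (simp add: ind Y_def B_def norm_minus_commute)
      have "(LINT x|lebesgue_on \<Omega>. indicator (slab e s) x * norm (\<phi> k x) powr p) \<le> s powr p * (?a * Y + ?b * B k)"
        using 2 mult_left_mono[OF 3, of "s powr p"] by simp
      then show ?thesis using 1 mult_left_mono[of _ "s powr p * (?a * Y + ?b * B k)" ?a] by fastforce
    qed
    have "(\<lambda>k. ?a * (s powr p * (?a * Y + ?b * B k)) + ?b * A k) \<longlonglongrightarrow>
        ?a * (s powr p * (?a * Y + ?b * 0)) + ?b * 0"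
      by (intro tendsto_intros A0 B0)
    then have "X \<le> ?a * (s powr p * (?a * Y + ?b * 0)) + ?b * 0"
      by (rule LIMSEQ_le_const) (use step in auto)
    then show ?thesis by simp
  qed
  \<comment> \<open>The double successor keeps \<tau> strictly below 1 already at
    \<open>n = 0\<close>.\<close>
  define \<tau> where "\<tau> n = inverse (real (Suc (Suc n)))" for n
  have \<tau>: "\<tau> \<longlonglongrightarrow> 0" using LIMSEQ_Suc[OF LIMSEQ_inverse_real_of_nat] by (simp add: \<tau>_def[abs_def])
  have "(\<lambda>n. (1 - \<tau> n) powr (1 - p) * (s powr p * ((1 - \<tau> n) powr (1 - p) * Y))) \<longlonglongrightarrow>
      (1 - 0) powr (1 - p) * (s powr p * ((1 - 0) powr (1 - p) * Y))"
    by (intro tendsto_intros \<tau>) auto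
  then have "X \<le> (1 - 0) powr (1 - p) * (s powr p * ((1 - 0) powr (1 - p) * Y))"
  proof (rule LIMSEQ_le_const)
    have "0 < \<tau> n \<and> \<tau> n < 1" for n by (simp add: \<tau>_def divide_simps)
    then show "\<exists>N. \<forall>n\<ge>N. X \<le> (1 - \<tau> n) powr (1 - p) * (s powr p * ((1 - \<tau> n) powr (1 - p) * Y))"
      using bound by blast
  qed
  then show ?thesis by (simp add: X_def Y_def G_def)
qed

end

section \<open>Passing to the limit\<close>

context convex_domain
begin

text \<open>Replacing a direction by one in the net changes the slack by at most 2 B \<delta> = (1 -
  \<theta>) s0 \<le> (1 - \<theta>) s, so one net serves every thickness from \<open>s0\<close>
  on.\<close>

lemma finite_slab_cover:
  assumes \<theta>: "\<theta> < 1" and s0: "0 < s0"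
  obtains E where "finite E" "\<And>e. e \<in> E \<Longrightarrow> norm e = 1"
    "\<And>s. s0 \<le> s \<Longrightarrow> {x \<in> \<Omega>. bdist \<Omega> x < \<theta> * s} \<subseteq> (\<Union>e\<in>E. slab e s)"
proof -
  obtain B where B: "B > 0" "\<And>y. y \<in> \<Omega> \<Longrightarrow> norm y \<le> B" using obtain_bound by blast
  define \<delta> where "\<delta> = (1 - \<theta>) * s0 / (2 * B)"
  have \<delta>: "0 < \<delta>" "2 * (B * \<delta>) = (1 - \<theta>) * s0" using \<theta> s0 B(1) by (auto simp: \<delta>_def)
  obtain E where "E \<noteq> {}" and E: "finite E" "\<And>e. e \<in> E \<Longrightarrow> norm e = 1"
    "\<And>e::'a. norm e = 1 \<Longrightarrow> \<exists>e'\<in>E. norm (e - e') \<le> \<delta>"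
    using sphere_net[OF \<delta>(1)] by metis
  have "{x \<in> \<Omega>. bdist \<Omega> x < \<theta> * s} \<subseteq> (\<Union>e\<in>E. slab e s)" if s: "s0 \<le> s" for s
  proof clarify
    fix x assume x: "x \<in> \<Omega>" "bdist \<Omega> x < \<theta> * s"
    obtain e where e: "norm e = 1" "support_fun \<Omega> e - x \<bullet> e < \<theta> * s" using bdist_less[OF x(2)] by blast
    obtain e' where e': "e' \<in> E" "norm (e - e') \<le> \<delta>" using E(3)[OF e(1)] by blast
    have "x \<bullet> e - x \<bullet> e' \<le> B * \<delta>"
      using inner_le_dist[of x e e'] mult_mono[OF B(2)[OF x(1)] e'(2)] B(1) by simp
    moreover have "support_fun \<Omega> e' - support_fun \<Omega> e \<le> B * \<delta>"
      using support_fun_diff[OF B(2), of e' e] mult_left_mono[OF e'(2), of B] B(1)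
      unfolding norm_minus_commute[of e' e] by linarith
    moreover have "2 * (B * \<delta>) \<le> (1 - \<theta>) * s" unfolding \<delta>(2) using s \<theta> by (intro mult_left_mono) auto
    then have "2 * (B * \<delta>) \<le> s - \<theta> * s" by (simp add: left_diff_distrib)
    ultimately have "support_fun \<Omega> e' - x \<bullet> e' < s" using e(2) by linarith
    then show "x \<in> (\<Union>e\<in>E. slab e s)" using x(1) e'(1) by (auto simp: slab_def)
  qed
  with E(1,2) show ?thesis by (rule that)
qed

text \<open>Markov's inequality at threshold 1: where \<open>1 + v\<close> is not positive,
  \<open>norm (v x)\<close> is at least 1.\<close>

lemma measure_slab_nonpos_le:
  assumes v: "v \<in> W1p_0 \<Omega> p" and e: "norm e = 1" and s: "0 < s" and p: "1 \<le> p"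
  shows "{x \<in> slab e s. 1 + v x \<le> 0} \<in> sets lebesgue"
    and "measure lebesgue {x \<in> slab e s. 1 + v x \<le> 0} \<le>
      s powr p * (LINT x|lebesgue_on \<Omega>. norm (weak_gradient \<Omega> v x) powr p)"
proof -
  define Z where "Z = {x \<in> slab e s. 1 + v x \<le> 0}"
  have vL: "v \<in> Lp \<Omega> p" using v by (simp add: W1p_0_def W1p_def)
  then have mv: "v \<in> borel_measurable (lebesgue_on \<Omega>)" by (simp add: Lp_def)
  have "{x \<in> space (lebesgue_on \<Omega>). 1 + v x \<le> 0} \<in> sets (lebesgue_on \<Omega>)" using mv by measurable
  then have "slab e s \<inter> {x \<in> space (lebesgue_on \<Omega>). 1 + v x \<le> 0} \<in> sets (lebesgue_on \<Omega>)"
    using slab_sets by (rule sets.Int[rotated])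
  moreover have "slab e s \<inter> {x \<in> space (lebesgue_on \<Omega>). 1 + v x \<le> 0} = Z" by (auto simp: Z_def slab_def)
  ultimately have Z: "Z \<in> sets (lebesgue_on \<Omega>)" by simp
  then show "{x \<in> slab e s. 1 + v x \<le> 0} \<in> sets lebesgue"
    using dom_sets by (simp add: Z_def[symmetric] sets_restrict_space_iff)
  have "measure lebesgue Z = measure (lebesgue_on \<Omega>) Z"
    using dom_sets by (subst measure_restrict_space) (auto simp: Z_def slab_def)
  also have "\<dots> = (LINT x|lebesgue_on \<Omega>. indicator Z x)"
  proof -
    have "Z \<inter> \<Omega> = Z" by (auto simp: Z_def slab_def)
    then show ?thesis by simp
  qed
  also have "\<dots> \<le> (LINT x|lebesgue_on \<Omega>. indicator (slab e s) x * norm (v x) powr p)"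
  proof (rule integral_mono_AE')
    show "integrable (lebesgue_on \<Omega>) (\<lambda>x. indicator (slab e s) x * norm (v x) powr p)"
      using integrable_mult_indicator[OF slab_sets, of "\<lambda>x. norm (v x) powr p"] vL by (simp add: Lp_def)
    show "AE x in lebesgue_on \<Omega>. indicator Z x \<le> indicator (slab e s) x * norm (v x) powr p"
    proof (rule AE_I2)
      fix x
      show "indicator Z x \<le> indicator (slab e s) x * norm (v x) powr p"
      proof (cases "x \<in> Z")
        case True
        then have "1 \<le> norm (v x)" by (auto simp: Z_def)
        then have "1 \<le> norm (v x) powr p" using p by (intro ge_one_powr_ge_zero) auto
        then show ?thesis using True by (simp add: Z_def)
      qed simp
    qed
  qed auto
  also have "\<dots> \<le> s powr p * (LINT x|lebesgue_on \<Omega>. norm (weak_gradient \<Omega> v x) powr p)"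
    by (rule W1p_0_slab_le[OF v e s p])
  finally show "measure lebesgue {x \<in> slab e s. 1 + v x \<le> 0} \<le>
      s powr p * (LINT x|lebesgue_on \<Omega>. norm (weak_gradient \<Omega> v x) powr p)" by (simp add: Z_def)
qed

text \<open>A union bound over the slabs. Their number is harmless, since it will be fixed while the
  bound for each slab decays in \<open>p\<close>.\<close>

lemma positivity_measure_ge:
  assumes E: "finite E" "\<And>e. e \<in> E \<Longrightarrow> norm e = 1"
    and cover: "{x \<in> \<Omega>. bdist \<Omega> x < t} \<subseteq> (\<Union>e\<in>E. slab e s)"
    and v: "v \<in> W1p_0 \<Omega> p" and s: "0 < s" and p: "1 \<le> p"
  shows "collar \<Omega> t \<le> measure lebesgue {x \<in> \<Omega>. 0 < 1 + v x} +
    real (card E) * (s powr p * (LINT x|lebesgue_on \<Omega>. norm (weak_gradient \<Omega> v x) powr p))"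
proof -
  let ?Y = "s powr p * (LINT x|lebesgue_on \<Omega>. norm (weak_gradient \<Omega> v x) powr p)"
  let ?P = "{x \<in> \<Omega>. 0 < 1 + v x}"
  let ?Z = "\<lambda>e. {x \<in> slab e s. 1 + v x \<le> 0}"
  have Z: "?Z e \<in> sets lebesgue" "measure lebesgue (?Z e) \<le> ?Y" if "e \<in> E" for e
    using measure_slab_nonpos_le[OF v E(2)[OF that] s p] by auto
  have Zf: "?Z e \<in> lmeasurable" if "e \<in> E" for e
    using Z(1)[OF that] by (intro fmeasurableI2[OF slab_lmeasurable[of e s]]) auto
  have "v \<in> borel_measurable (lebesgue_on \<Omega>)" using v by (simp add: W1p_0_def W1p_def Lp_def)
  then have "{x \<in> space (lebesgue_on \<Omega>). 0 < 1 + v x} \<in> sets (lebesgue_on \<Omega>)" by measurable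
  then have P: "?P \<in> sets lebesgue" using dom_sets by (simp add: sets_restrict_space_iff)
  then have Pf: "?P \<in> lmeasurable" by (intro fmeasurableI2[OF dom_lmeasurable]) auto
  have Uf: "(\<Union>e\<in>E. ?Z e) \<in> lmeasurable" using E(1) Zf by (intro fmeasurable.finite_UN) auto
  have "collar \<Omega> t \<le> measure lebesgue (?P \<union> (\<Union>e\<in>E. ?Z e))"
    unfolding collar_def
  proof (rule measure_mono_fmeasurable)
    show "{x \<in> \<Omega>. bdist \<Omega> x < t} \<subseteq> ?P \<union> (\<Union>e\<in>E. ?Z e)"
      using cover by (force simp: not_less)
    show "{x \<in> \<Omega>. bdist \<Omega> x < t} \<in> sets lebesgue" using collar_lmeasurable by (rule fmeasurableD)
    show "?P \<union> (\<Union>e\<in>E. ?Z e) \<in> lmeasurable" using Pf Uf by (rule fmeasurable.Un)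
  qed
  also have "\<dots> \<le> measure lebesgue ?P + measure lebesgue (\<Union>e\<in>E. ?Z e)"
    using P Uf by (intro measure_Un_le) (auto dest: fmeasurableD)
  also have "measure lebesgue (\<Union>e\<in>E. ?Z e) \<le> (\<Sum>e\<in>E. measure lebesgue (?Z e))"
    using E(1) Z(1) by (intro measure_UNION_le) auto
  also have "\<dots> \<le> (\<Sum>e\<in>E. ?Y)" using Z(2) by (intro sum_mono) auto
  finally show ?thesis by simp
qed

lemma radial_min_pos: "0 \<le> \<Lambda> \<Longrightarrow> 0 < radial_min \<Lambda>"
proof -
  assume \<Lambda>: "0 \<le> \<Lambda>"
  have "1 / inradius \<Omega> \<le> radial_min \<Lambda>"
    unfolding radial_min_def using \<Lambda> collar_nonneg
    by (intro cINF_greatest) (auto intro: add_increasing2)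
  then show ?thesis using inradius_inverse_pos by linarith
qed

text \<open>The rescaling \<open>l \<mapsto> l / \<theta>\<^sup>2\<close> absorbs the loss of thickness of the collar
  into a factor \<open>\<theta>\<^sup>2\<close>, so no continuity of the collar measure is needed here.\<close>

lemma Jp_lower:
  assumes \<Lambda>: "0 \<le> \<Lambda>" and \<theta>: "0 < \<theta>" "\<theta> < 1"
  obtains N :: real where "\<And>p l u. 1 \<le> p \<Longrightarrow> 1 / inradius \<Omega> \<le> l \<Longrightarrow> u \<in> W1p_1 \<Omega> p \<Longrightarrow>
    (p - 1) / p * (\<theta>\<^sup>2 * radial_min \<Lambda>) - N * (p * \<theta> powr p) \<le> Jp \<Omega> \<Lambda> p l u"
proof -
  define M where "M = radial_min \<Lambda>"
  have M: "0 < M" unfolding M_def by (rule radial_min_pos[OF \<Lambda>])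
  \<comment> \<open>The slabs will have thickness \<theta> / l. In the only relevant case the
    energy, hence \<open>l\<close>, is below \<open>M\<close>, so \<theta> / M is a lower bound for
    the thickness independent of \<open>l\<close> and \<open>p\<close>.\<close>
  obtain E where E: "finite E" "\<And>e. e \<in> E \<Longrightarrow> norm e = 1"
    "\<And>s. \<theta> / M \<le> s \<Longrightarrow> {x \<in> \<Omega>. bdist \<Omega> x < \<theta> * s} \<subseteq> (\<Union>e\<in>E. slab e s)"
    using finite_slab_cover[OF \<theta>(2), of "\<theta> / M"] \<theta>(1) M by auto
  define N where "N = \<Lambda> * real (card E) * M"
  have N: "0 \<le> N" using \<Lambda> M by (simp add: N_def)
  have "(p - 1) / p * (\<theta>\<^sup>2 * M) - N * (p * \<theta> powr p) \<le> Jp \<Omega> \<Lambda> p l u"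
    if p: "1 \<le> p" and l: "1 / inradius \<Omega> \<le> l" and u: "u \<in> W1p_1 \<Omega> p" for p l u
  proof (cases "Jp \<Omega> \<Lambda> p l u < M")
    case False
    have "(p - 1) / p * (\<theta>\<^sup>2 * M) \<le> 1 * (1 * M)"
      using p M \<theta> by (intro mult_mono power_le_one) auto
    moreover have "0 \<le> N * (p * \<theta> powr p)" using N p by simp
    ultimately show ?thesis using False by simp
  next
    case True
    have lpos: "0 < l" using l inradius_inverse_pos by linarith
    have lM: "l < M" using Jp_nonneg(1)[OF l p \<Lambda>, of u] True by simp
    obtain v where v: "v \<in> W1p_0 \<Omega> p" "u = (\<lambda>x. 1 + v x)" using u by (auto simp: W1p_1_def)
    have vW: "v \<in> W1p \<Omega> p" using v(1) by (simp add: W1p_0_def)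
    have wg: "has_weak_gradient \<Omega> u (weak_gradient \<Omega> v)"
      using has_weak_gradient_add[OF open_dom has_weak_gradient_const[OF open_dom, of 1] W1p_weak_gradient(1)[OF vW]]
      by (simp add: v(2))
    have m: "weak_gradient \<Omega> v \<in> borel_measurable (lebesgue_on \<Omega>)"
      using W1p_weak_gradient(2)[OF vW] by (simp add: Lp_def)
    define Y where "Y = (LINT x|lebesgue_on \<Omega>. norm (weak_gradient \<Omega> v x) powr p)"
    have "(LINT x|lebesgue_on \<Omega>. (norm (weak_gradient \<Omega> u x) / l) powr p) =
        (LINT x|lebesgue_on \<Omega>. norm (weak_gradient \<Omega> u x) powr p) / l powr p"
      using lpos by (simp add: powr_divide)
    also have "(LINT x|lebesgue_on \<Omega>. norm (weak_gradient \<Omega> u x) powr p) = Y"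
      unfolding Y_def
      by (rule integral_powr_norm_AE_cong(1)[OF weak_gradient_measurable[OF open_dom m wg] m weak_gradient_AE[OF open_dom wg]])
    finally have Jp_eq: "Jp \<Omega> \<Lambda> p l u = 1 / p * (Y / l powr p) + l + (p - 1) / p * \<Lambda> * measure lebesgue {x \<in> \<Omega>. 0 < u x}"
      by (simp add: Jp_def)
    have Y: "0 \<le> Y" unfolding Y_def by (rule integral_nonneg_AE) auto
    have "0 \<le> (p - 1) / p * \<Lambda> * measure lebesgue {x \<in> \<Omega>. 0 < u x}"
      using p \<Lambda> by (intro mult_nonneg_nonneg) auto
    then have "1 / p * (Y / l powr p) \<le> M" using Jp_eq True lpos by linarith
    then have "p * (1 / p * (Y / l powr p)) \<le> p * M" using p by (intro mult_left_mono) auto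
    then have YM: "Y / l powr p \<le> p * M" using p by simp
    \<comment> \<open>The l^p in the gradient bound cancels, leaving \<theta>^p; and the covered
      collar has width \<theta> s, the one belonging to slope l / \<theta>^2.\<close>
    define s where "s = \<theta> / l"
    have s: "0 < s" "\<theta> / M \<le> s" "\<theta> * s = 1 / (l / \<theta>\<^sup>2)"
      using \<theta>(1) lpos lM by (auto simp: s_def power2_eq_square intro!: divide_left_mono)
    have "s powr p * Y = \<theta> powr p * (Y / l powr p)"
      using \<theta>(1) lpos by (simp add: s_def powr_divide)
    also have "\<dots> \<le> \<theta> powr p * (p * M)" using YM by (intro mult_left_mono) auto
    finally have sY: "s powr p * Y \<le> \<theta> powr p * (p * M)" .
    define P where "P = measure lebesgue {x \<in> \<Omega>. 0 < u x}"
    have "collar \<Omega> (\<theta> * s) \<le> P + real (card E) * (s powr p * Y)"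
      using positivity_measure_ge[OF E(1,2) E(3)[OF s(2)] v(1) s(1) p] by (simp add: P_def Y_def v(2))
    also have "\<dots> \<le> P + real (card E) * (\<theta> powr p * (p * M))"
      using sY by (intro add_left_mono mult_left_mono) auto
    finally have collar: "collar \<Omega> (1 / (l / \<theta>\<^sup>2)) \<le> P + real (card E) * (\<theta> powr p * (p * M))"
      unfolding s(3) .
    define c where "c = collar \<Omega> (1 / (l / \<theta>\<^sup>2))"
    have \<theta>2: "0 < \<theta>\<^sup>2" "\<theta>\<^sup>2 \<le> 1" using \<theta> by (auto intro: power_le_one)
    \<comment> \<open>The enlarged slope is still at least 1 / R, so it is admissible in
      \<open>radial_min\<close>.\<close>
    have "l \<le> l / \<theta>\<^sup>2" using \<theta>2 lpos by (simp add: field_simps)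
    then have "M \<le> l / \<theta>\<^sup>2 + \<Lambda> * c"
      unfolding M_def c_def using l by (intro radial_min_le[OF \<Lambda>]) simp
    then have "\<theta>\<^sup>2 * M \<le> \<theta>\<^sup>2 * (l / \<theta>\<^sup>2 + \<Lambda> * c)" using \<theta>2 by (intro mult_left_mono) auto
    also have "\<dots> = l + \<theta>\<^sup>2 * (\<Lambda> * c)" using \<theta>2 by (simp add: distrib_left)
    also have "\<dots> \<le> l + 1 * (\<Lambda> * c)"
      using \<theta>2 \<Lambda> collar_nonneg by (intro add_left_mono mult_right_mono) (auto simp: c_def)
    also have "\<dots> \<le> l + \<Lambda> * (P + real (card E) * (\<theta> powr p * (p * M)))"
      using collar \<Lambda> unfolding c_def[symmetric] by (intro add_left_mono) (simp add: mult_left_mono)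
    also have "\<dots> = l + \<Lambda> * P + N * (p * \<theta> powr p)"
      by (simp add: N_def algebra_simps)
    finally have key: "\<theta>\<^sup>2 * M \<le> l + \<Lambda> * P + N * (p * \<theta> powr p)" .
    define q where "q = (p - 1) / p"
    have q: "0 \<le> q" "q \<le> 1" using p by (auto simp: q_def)
    have "q * (\<theta>\<^sup>2 * M) \<le> q * (l + \<Lambda> * P + N * (p * \<theta> powr p))"
      using key q(1) by (rule mult_left_mono)
    also have "\<dots> = q * l + q * \<Lambda> * P + q * (N * (p * \<theta> powr p))"
      by (simp add: algebra_simps)
    also have "\<dots> \<le> 1 * l + q * \<Lambda> * P + 1 * (N * (p * \<theta> powr p))"
      using q lpos N p by (intro add_mono mult_right_mono order_refl) auto
    finally have "q * (\<theta>\<^sup>2 * M) - N * (p * \<theta> powr p) \<le> l + q * \<Lambda> * P" by simp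
    moreover have "0 \<le> 1 / p * (Y / l powr p)" using Y p by simp
    ultimately show ?thesis unfolding Jp_eq P_def[symmetric] q_def[symmetric] by linarith
  qed
  then show ?thesis using that unfolding M_def by blast
qed

text \<open>For the lower estimate \<theta> is written as exp(-c). It is fixed first, close enough
  to 1 for \<theta>^2 M to exceed \<open>a\<close>; only then does p grow, which kills the error p
  exp(-c p).\<close>

lemma inf_Jp_tendsto:
  assumes \<Lambda>: "0 \<le> \<Lambda>"
  shows "(inf_Jp \<Lambda> \<longlongrightarrow> radial_min \<Lambda>) at_top"
proof (rule order_tendstoI)
  define M where "M = radial_min \<Lambda>"
  have M: "0 < M" unfolding M_def by (rule radial_min_pos[OF \<Lambda>])
  fix a assume "a < radial_min \<Lambda>"
  then have a: "a < M" by (simp add: M_def)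
  have "((\<lambda>c. (exp (- c))\<^sup>2 * M) \<longlongrightarrow> (exp (- 0))\<^sup>2 * M) (at_right 0)"
    by (intro tendsto_intros)
  then have "((\<lambda>c. (exp (- c))\<^sup>2 * M) \<longlongrightarrow> M) (at_right 0)" by simp
  from order_tendstoD(1)[OF this a] have "\<forall>\<^sub>F c in at_right 0. 0 < c \<and> a < (exp (- c))\<^sup>2 * M"
    using eventually_at_right_less by (rule eventually_conj[rotated])
  then obtain c :: real where c: "0 < c" "a < (exp (- c))\<^sup>2 * M"
    using eventually_happens'[OF trivial_limit_at_right_real] by blast
  obtain N where N: "\<And>p l u. 1 \<le> p \<Longrightarrow> 1 / inradius \<Omega> \<le> l \<Longrightarrow> u \<in> W1p_1 \<Omega> p \<Longrightarrow>
    (p - 1) / p * ((exp (- c))\<^sup>2 * M) - N * (p * exp (- c) powr p) \<le> Jp \<Omega> \<Lambda> p l u"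
    using Jp_lower[OF \<Lambda>, of "exp (- c)"] c(1) unfolding M_def by auto
  have "((\<lambda>p::real. 1 - 1 / p) \<longlongrightarrow> 1 - 0) at_top"
    by (intro tendsto_intros tendsto_divide_0[OF tendsto_const] filterlim_at_top_imp_at_infinity filterlim_ident)
  moreover have "\<forall>\<^sub>F p::real in at_top. 1 - 1 / p = (p - 1) / p"
    using eventually_ge_at_top[of 1] by eventually_elim (simp add: field_simps)
  ultimately have "((\<lambda>p::real. (p - 1) / p) \<longlongrightarrow> 1) at_top"
    using Lim_transform_eventually by fastforce
  moreover have "((\<lambda>p::real. p * exp (- c * p)) \<longlongrightarrow> 0) at_top"
  proof -
    have "filterlim ((*) c) at_top at_top"
      using c(1) by (rule filterlim_tendsto_pos_mult_at_top[OF tendsto_const _ filterlim_ident])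
    from tendsto_mult_right_zero[OF filterlim_compose[OF tendsto_power_div_exp_0[of 1] this], of "1 / c"]
    show ?thesis using c(1) by (simp add: exp_minus field_simps)
  qed
  ultimately have "((\<lambda>p. (p - 1) / p * ((exp (- c))\<^sup>2 * M) - N * (p * exp (- c * p))) \<longlongrightarrow> 1 * ((exp (- c))\<^sup>2 * M) - N * 0) at_top"
    by (intro tendsto_intros)
  then have "((\<lambda>p. (p - 1) / p * ((exp (- c))\<^sup>2 * M) - N * (p * exp (- c) powr p)) \<longlongrightarrow> (exp (- c))\<^sup>2 * M) at_top"
    by (simp add: powr_def mult.commute)
  from order_tendstoD(1)[OF this c(2)]
  show "\<forall>\<^sub>F p in at_top. a < inf_Jp \<Lambda> p"
    using eventually_ge_at_top[of 1]
  proof eventually_elim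
    case (elim p)
    then show ?case using inf_Jp_ge[OF elim(2) N[OF elim(2)]] by simp
  qed
next
  fix a assume a: "radial_min \<Lambda> < a"
  define \<epsilon> where "\<epsilon> = (a - radial_min \<Lambda>) / 2"
  have \<epsilon>: "0 < \<epsilon>" "radial_min \<Lambda> + \<epsilon> < a" using a by (auto simp: \<epsilon>_def field_simps)
  have "((\<lambda>p. measure lebesgue \<Omega> / p) \<longlongrightarrow> 0) at_top"
    by (intro tendsto_divide_0[OF tendsto_const] filterlim_at_top_imp_at_infinity filterlim_ident)
  then have "((\<lambda>p. measure lebesgue \<Omega> / p + radial_min \<Lambda> + \<epsilon>) \<longlongrightarrow> 0 + radial_min \<Lambda> + \<epsilon>) at_top"
    by (intro tendsto_intros)
  then have "((\<lambda>p. measure lebesgue \<Omega> / p + radial_min \<Lambda> + \<epsilon>) \<longlongrightarrow> radial_min \<Lambda> + \<epsilon>) at_top" by simp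
  from order_tendstoD(2)[OF this \<epsilon>(2)]
  show "\<forall>\<^sub>F p in at_top. inf_Jp \<Lambda> p < a"
    using eventually_ge_at_top[of 1]
  proof eventually_elim
    case (elim p)
    then show ?case using inf_Jp_upper[OF \<Lambda> \<epsilon>(1) elim(2)] by simp
  qed
qed

end

theorem theorem11:
  fixes \<Omega> :: "(real ^ 'n) set" and \<Lambda> :: real
  assumes "CARD('n) \<ge> 2"
    and "\<Omega> \<noteq> {}" and "open \<Omega>" and "bounded \<Omega>" and "convex \<Omega>"
    and "\<Lambda> \<ge> Lambda_inf \<Omega>"
  shows "((\<lambda>p::real. INF l\<in>{1 / inradius \<Omega>..}. INF u\<in>W1p_1 \<Omega> p. Jp \<Omega> \<Lambda> p l u)
           \<longlongrightarrow> min_value \<Omega> \<Lambda>) at_top"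
proof -
  interpret convex_domain \<Omega> using assms by unfold_locales
  \<comment> \<open>Besides \<open>0 \<le> \<Lambda>\<close>, this says that the constant 1 does not
    beat the best cone, so the least value of \<open>J\<close> is
    \<open>radial_min \<Lambda>\<close>.\<close>
  note \<Lambda> = Lambda_inf_imp[OF assms(6)]
  show ?thesis
    using inf_Jp_tendsto[OF \<Lambda>(1)] unfolding inf_Jp_def[abs_def] min_value_eq[OF \<Lambda>] .
qed

end
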